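(* Let $k\in\mathbb C\setminus\mathbb Z_{\ge0}$ and $\lambda_1,\lambda_2\in\mathbb C$. Assume that $R$ is an irreducible $\mathbb Z_{\ge0}$-graded $\mathcal W_k$-module with top component $R_{top}$, and assume that $R_{top}\otimes\Pi_{-1,-1}(\lambda_1,\lambda_2)_{top}$ is an irreducible $\mathfrak{sl}_3$-module. Then $R\otimes\Pi_{-1,-1}(\lambda_1,\lambda_2)$ is an irreducible $L_k(\mathfrak{sl}_3)$-module.
   Context: $V^k(\mathfrak{sl}_3)$ is the universal affine vertex algebra of level $k$, $L_k(\mathfrak{sl}_3)$ its simple (graded) quotient. Notation: $e_1=e_{1,2}$, $e_2=e_{2,3}$, $e_3=e_{1,3}$, $h_1=e_{1,1}-e_{2,2}$, $h_2=e_{2,2}-e_{3,3}$, $f_1=e_{2,1}$, $f_2=e_{3,2}$, $f_3=e_{3,1}=[f_2,f_1]$. Bershadsky-Polyakov algebra. For $k\neq-3$, $\mathcal W^k$ is freely and strongly generated by $J,G^\pm,L^{\rm BP}$: $L^{\rm BP}$ is a Virasoro field of central charge $-\frac{(2k+3)(3k+1)}{k+3}$; $J$, $G^\pm$ are primary of weights $1$, $\frac32$; $J(z)J(w)\sim\frac{2k+3}{3(z-w)^2}$; $J(z)G^\pm(w)\sim\frac{\pm G^\pm(w)}{z-w}$; $G^\pm(z)G^\pm(w)\sim0$; and $$G^+(z)G^-(w)\sim\frac{(k+1)(2k+3)}{(z-w)^3}+\frac{3(k+1)J(w)}{(z-w)^2}+\frac{1}{z-w}\Big(3{:}J(w)^2{:}+\tfrac{3(k+1)}2\partial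 J(w)-(k+3)L^{\rm BP}(w)\Big).$$ For $k=-3$, $L^{\rm BP}$ is replaced by a commutative field $T^{\rm BP}$ of weight 2 via $(k+3)L^{\rm BP}\mapsto T^{\rm BP}$. $\mathcal W^k$ is $\mathbb Z_{\ge0}$-graded with $J,G^+,G^-$ of weights $1,1,2$ (for $k\ne-3$: grading by the zero mode of $\widetilde L=L^{\rm BP}+\frac12\partial J$), and $\mathcal W_k$ is its simple (graded) quotient. A $\mathbb Z_{\ge0}$-graded $\mathcal W_k$-module is $R=\bigoplus_{n\ge0}R(n)$, $R(0)\neq0$, such that for $A$ of weight $\Delta$ (in this grading) the mode $A(m)$, $A(z)=\sum A(m)z^{-m-\Delta}$, maps $R(n)$ to $R(n-m)$; $R_{top}=R(0)$. $\Pi(0)^{\otimes2}$ is the vertex algebra generated by Heisenberg fields $c_1,c_2,d_1,d_2$ with $c_i(z)d_j(w)\sim\frac{2\delta_{i,j}}{(z-w)^2}$, $c_ic_j\sim0\sim d_id_j$, and $e^{\pm c_1},e^{\pm c_2}$ (so it is $M(1)\otimes\mathbb C[\mathbb Zc_1+\mathbb Zc_2]$). $\Pi_{-1,-1}(\lambda_1,\lambda_2)=\Pi(0)^{\otimes2}e^{-\frac{d_1}2-\frac{d_2}2+\lambda_1c_1+\lambda_2c_2}$, and $\Pi_{-1,-1}(\lambda_1,\lambda_2)_{top}$ is the span of all $e^{-\frac{d_1}2-\frac{d_2}2+(\lambda_1+n_1)c_1+(\lambda_2+n_2)c_2}$, $n_1,n_2\in\mathbb Z$. The action: let $\beta=e^{c_1}$,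 $\gamma=-\frac12{:}(c_1+d_1)e^{-c_1}{:}$ (generating a $\beta\gamma$ vertex algebra, $\beta(z)\gamma(w)\sim\frac1{z-w}$) and $c=c_2$, $d=d_2$. There is a homomorphism $V^k(\mathfrak{sl}_3)\to\mathcal W_k\otimes\Pi(0)^{\otimes2}$ given by $e_1\mapsto-\gamma e^{c}$, $e_2\mapsto\beta$, $e_3\mapsto e^c$, $h_1\mapsto-2J+{:}\gamma\beta{:}-\frac{2k+9}6c+\frac12d$, $h_2\mapsto J-2{:}\gamma\beta{:}+\frac{4k+9}6c+\frac12d$, $f_1\mapsto G^+-{:}(2J+\frac{8k+9}6c-\frac12d)\beta e^{-c}{:}+(k+1)(\partial\beta)e^{-c}$, $f_2\mapsto G^-e^{-c}+(J+\frac{4k+9}6c+\frac12d)\gamma+k\,\partial\gamma-{:}\gamma^2\beta{:}$ ($f_3$ determined by $f_3=[f_2,f_1]$), which for $k\notin\mathbb Z_{\ge0}$ factors through an embedding of $L_k(\mathfrak{sl}_3)$; in this way $R\otimes\Pi_{-1,-1}(\lambda_1,\lambda_2)$ is an $L_k(\mathfrak{sl}_3)$-module. The space $R_{top}\otimes\Pi_{-1,-1}(\lambda_1,\lambda_2)_{top}$ is an $\mathfrak{sl}_3$-module through the zero modes $u(0)$, $u\in\mathfrak{sl}_3$. *)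

theory Defs
  imports
    "HOL-Analysis.Analysis"
    "HOL-Library.Poly_Mapping"
    "HOL-Library.Groups_Big_Fun"
begin

section \<open>Complex vector spaces\<close>

class scaleC =
  fixes scaleC :: "complex \<Rightarrow> 'a \<Rightarrow> 'a"  (infixr "*\<^sub>C" 75)

class complex_vector = scaleC + ab_group_add +
  assumes scaleC_add_right: "a *\<^sub>C (x + y) = a *\<^sub>C x + a *\<^sub>C y"
    and scaleC_add_left: "(a + b) *\<^sub>C x = a *\<^sub>C x + b *\<^sub>C x"
    and scaleC_scaleC: "a *\<^sub>C b *\<^sub>C x = (a * b) *\<^sub>C x"
    and scaleC_one: "1 *\<^sub>C x = x"

global_interpretation cvs: vector_space "scaleC :: complex \<Rightarrow> 'a \<Rightarrow> 'a::complex_vector"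
  by unfold_locales
    (simp_all add: scaleC_add_right scaleC_add_left scaleC_scaleC scaleC_one)

abbreviation clinear :: "('a::complex_vector \<Rightarrow> 'b::complex_vector) \<Rightarrow> bool"
  where "clinear \<equiv> Vector_Spaces.linear scaleC scaleC"

definition cbilinear :: "('a::complex_vector \<Rightarrow> 'b::complex_vector \<Rightarrow> 'c::complex_vector) \<Rightarrow> bool"
  where "cbilinear f \<longleftrightarrow> (\<forall>x. clinear (f x)) \<and> (\<forall>y. clinear (\<lambda>x. f x y))"

instantiation complex :: complex_vector
begin
definition scaleC_complex :: "complex \<Rightarrow> complex \<Rightarrow> complex"
  where "scaleC_complex a x = a * x"
instance
  by standard (simp_all add: scaleC_complex_def algebra_simps)
end

instantiation vec :: (complex_vector, finite) complex_vector
begin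
definition scaleC_vec :: "complex \<Rightarrow> ('a, 'b) vec \<Rightarrow> ('a, 'b) vec"
  where "scaleC_vec a x = (\<chi> i. a *\<^sub>C (x $ i))"
instance
  by standard
    (simp_all add: scaleC_vec_def vec_eq_iff scaleC_add_right scaleC_add_left scaleC_scaleC scaleC_one)
end

instantiation poly_mapping :: (type, complex_vector) complex_vector
begin
definition scaleC_poly_mapping :: "complex \<Rightarrow> ('a \<Rightarrow>\<^sub>0 'b) \<Rightarrow> ('a \<Rightarrow>\<^sub>0 'b)"
  where "scaleC_poly_mapping a x = Poly_Mapping.map (scaleC a) x"

lemma lookup_scaleC [simp]:
  "Poly_Mapping.lookup (a *\<^sub>C x) i = a *\<^sub>C Poly_Mapping.lookup x i"
  for x :: "'a \<Rightarrow>\<^sub>0 'b"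
  by (simp add: scaleC_poly_mapping_def map.rep_eq when_def)

instance
  by standard
    (auto intro!: poly_mapping_eqI
      simp: lookup_add scaleC_add_right scaleC_add_left scaleC_scaleC scaleC_one)
end


section \<open>Tensor products over the complex numbers\<close>

text \<open>The tensor product is the free vector space on pairs, modulo bilinearity.\<close>

abbreviation free_pair :: "'a \<Rightarrow> 'b \<Rightarrow> ('a \<times> 'b) \<Rightarrow>\<^sub>0 complex"
  where "free_pair a b \<equiv> Poly_Mapping.single (a, b) 1"

definition tensor_relators ::
  "(('a::complex_vector \<times> 'b::complex_vector) \<Rightarrow>\<^sub>0 complex) set"
  where "tensor_relators = cvs.span
    ({free_pair (a + a') b - free_pair a b - free_pair a' b | a a' b. True} \<union>
     {free_pair a (b + b') - free_pair a b - free_pair a b' | a b b'. True} \<union>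
     {free_pair (s *\<^sub>C a) b - s *\<^sub>C free_pair a b | s a b. True} \<union>
     {free_pair a (s *\<^sub>C b) - s *\<^sub>C free_pair a b | s a b. True})"

quotient_type (overloaded) ('a, 'b) tensor =
  "('a::complex_vector \<times> 'b::complex_vector) \<Rightarrow>\<^sub>0 complex" / "\<lambda>x y. x - y \<in> tensor_relators"
proof (rule equivpI)
  let ?R = "\<lambda>x y :: ('a \<times> 'b) \<Rightarrow>\<^sub>0 complex. x - y \<in> tensor_relators"
  show "reflp ?R"
    by (auto intro!: reflpI simp: tensor_relators_def cvs.span_zero)
  show "symp ?R"
    by (rule sympI, unfold tensor_relators_def, drule cvs.span_neg) simp
  show "transp ?R"
    by (rule transpI, unfold tensor_relators_def, drule (1) cvs.span_add) simp
qed

instantiation tensor :: (complex_vector, complex_vector) complex_vector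
begin

lift_definition zero_tensor :: "('a, 'b) tensor" is 0 .

lift_definition plus_tensor :: "('a, 'b) tensor \<Rightarrow> ('a, 'b) tensor \<Rightarrow> ('a, 'b) tensor" is "(+)"
  unfolding tensor_relators_def by (drule (1) cvs.span_add) (simp add: algebra_simps)

lift_definition minus_tensor :: "('a, 'b) tensor \<Rightarrow> ('a, 'b) tensor \<Rightarrow> ('a, 'b) tensor" is "(-)"
  unfolding tensor_relators_def by (drule (1) cvs.span_diff) (simp add: algebra_simps)

lift_definition uminus_tensor :: "('a, 'b) tensor \<Rightarrow> ('a, 'b) tensor" is "uminus"
  unfolding tensor_relators_def by (drule cvs.span_neg) simp

lift_definition scaleC_tensor :: "complex \<Rightarrow> ('a, 'b) tensor \<Rightarrow> ('a, 'b) tensor" is "scaleC"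
  unfolding tensor_relators_def by (drule cvs.span_scale) (simp add: cvs.scale_right_diff_distrib)

instance
  by standard
    (transfer; simp add: algebra_simps scaleC_add_right scaleC_add_left scaleC_scaleC scaleC_one
      tensor_relators_def cvs.span_zero)+
end

lift_definition tens :: "'a::complex_vector \<Rightarrow> 'b::complex_vector \<Rightarrow> ('a, 'b) tensor"  (infix "\<otimes>" 78)
  is free_pair .

lemma cbilinear_tens: "cbilinear (tens :: 'a::complex_vector \<Rightarrow> 'b::complex_vector \<Rightarrow> _)"
proof -
  have "(a + a') \<otimes> b = a \<otimes> b + a' \<otimes> b" for a a' :: 'a and b :: 'b
    by transfer (unfold tensor_relators_def diff_diff_eq[symmetric], rule cvs.span_base, rule UnI1, rule UnI1, rule UnI1,
      rule CollectI, intro exI conjI, rule refl, rule TrueI)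
  moreover have "a \<otimes> (b + b') = a \<otimes> b + a \<otimes> b'" for a :: 'a and b b' :: 'b
    by transfer (unfold tensor_relators_def diff_diff_eq[symmetric], rule cvs.span_base, rule UnI1, rule UnI1, rule UnI2,
      rule CollectI, intro exI conjI, rule refl, rule TrueI)
  moreover have "(s *\<^sub>C a) \<otimes> b = s *\<^sub>C (a \<otimes> b)" for s and a :: 'a and b :: 'b
    by transfer (unfold tensor_relators_def, rule cvs.span_base, rule UnI1, rule UnI2,
      rule CollectI, intro exI conjI, rule refl, rule TrueI)
  moreover have "a \<otimes> (s *\<^sub>C b) = s *\<^sub>C (a \<otimes> b)" for s and a :: 'a and b :: 'b
    by transfer (unfold tensor_relators_def, rule cvs.span_base, rule UnI2,
      rule CollectI, intro exI conjI, rule refl, rule TrueI)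
  ultimately show ?thesis
    by (simp add: cbilinear_def Vector_Spaces.linear_iff cvs.vector_space_axioms)
qed

definition free_extend ::
  "('a \<Rightarrow> 'b \<Rightarrow> 'c::complex_vector) \<Rightarrow> (('a \<times> 'b) \<Rightarrow>\<^sub>0 complex) \<Rightarrow> 'c"
  where "free_extend f x =
    (\<Sum>p\<in>Poly_Mapping.keys x. Poly_Mapping.lookup x p *\<^sub>C f (fst p) (snd p))"

text \<open>The linear map on the tensor product induced by a bilinear map; only meaningful for
  bilinear arguments, where it does not depend on the chosen representative.\<close>

definition tensor_lift ::
  "('a::complex_vector \<Rightarrow> 'b::complex_vector \<Rightarrow> 'c::complex_vector) \<Rightarrow> ('a, 'b) tensor \<Rightarrow> 'c"
  where "tensor_lift f t = free_extend f (rep_tensor t)"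

lemma free_extend_superset:
  assumes "finite A" "Poly_Mapping.keys x \<subseteq> A"
  shows "free_extend f x = (\<Sum>p\<in>A. Poly_Mapping.lookup x p *\<^sub>C f (fst p) (snd p))"
  unfolding free_extend_def
  by (rule sum.mono_neutral_left) (use assms in \<open>auto simp: in_keys_iff\<close>)

lemma clinear_free_extend: "clinear (free_extend f)"
proof -
  have "free_extend f (x + y) = free_extend f x + free_extend f y" for x y
  proof -
    let ?A = "Poly_Mapping.keys x \<union> Poly_Mapping.keys y"
    have "Poly_Mapping.keys (x + y) \<subseteq> ?A" by (rule Poly_Mapping.keys_add)
    then show ?thesis
      by (simp add: free_extend_superset[of ?A] lookup_add scaleC_add_left sum.distrib)
  qed
  moreover have "free_extend f (s *\<^sub>C x) = s *\<^sub>C free_extend f x" for s x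
  proof -
    have "Poly_Mapping.keys (s *\<^sub>C x) \<subseteq> Poly_Mapping.keys x"
      by (auto simp: in_keys_iff)
    then show ?thesis
      by (simp add: free_extend_superset[of "Poly_Mapping.keys x"] cvs.scale_sum_right
          scaleC_scaleC scaleC_complex_def)
  qed
  ultimately show ?thesis
    by (simp add: Vector_Spaces.linear_iff cvs.vector_space_axioms)
qed

lemma free_extend_pair [simp]: "free_extend f (free_pair a b) = f a b"
  by (simp add: free_extend_def scaleC_one)

lemma free_extend_relators:
  assumes "cbilinear f" and "x \<in> tensor_relators"
  shows "free_extend f x = 0"
proof -
  note fl = clinear_free_extend[of f]
  note l = Vector_Spaces.linear_iff
  have f1: "f (a + a') b = f a b + f a' b" "f (s *\<^sub>C a) b = s *\<^sub>C f a b" for s a a' b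
    using assms(1) by (auto simp: cbilinear_def l)
  have f2: "f a (b + b') = f a b + f a b'" "f a (s *\<^sub>C b) = s *\<^sub>C f a b" for s a b b'
    using assms(1) by (auto simp: cbilinear_def l)
  have add: "free_extend f (u - v) = free_extend f u - free_extend f v" for u v
    using fl by (metis module_hom.diff Vector_Spaces.linear_def)
  have sc: "free_extend f (s *\<^sub>C u) = s *\<^sub>C free_extend f u" for s u
    using fl by (metis module_hom.scale Vector_Spaces.linear_def)
  have add': "free_extend f (u + v) = free_extend f u + free_extend f v" for u v
    using fl by (metis module_hom.add Vector_Spaces.linear_def)
  have z: "free_extend f 0 = 0" by (simp add: free_extend_def)
  show ?thesis
    using assms(2) unfolding tensor_relators_def
  proof (induction rule: cvs.span_induct_alt)
    case base
    show ?case by (rule z)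
  next
    case (step s u v)
    then have "free_extend f u = 0"
      by (auto simp: add sc f1 f2)
    with step show ?case
      by (simp add: add' sc)
  qed
qed

lemma tensor_lift_abs:
  assumes "cbilinear f"
  shows "tensor_lift f (abs_tensor x) = free_extend f x"
proof -
  have "rep_tensor (abs_tensor x) - x \<in> tensor_relators"
    using Quotient3_rep_abs[OF Quotient3_tensor] by (simp add: tensor_relators_def cvs.span_zero)
  from free_extend_relators[OF assms this] show ?thesis
    using clinear_free_extend[of f]
    by (simp add: tensor_lift_def) (metis eq_iff_diff_eq_0 module_hom.diff Vector_Spaces.linear_def)
qed

lemma tensor_lift_tens [simp]: "cbilinear f \<Longrightarrow> tensor_lift f (a \<otimes> b) = f a b"
  by (simp add: tens.abs_eq tensor_lift_abs)

lemma clinear_tensor_lift: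
  assumes "cbilinear f"
  shows "clinear (tensor_lift f)"
proof -
  have "tensor_lift f (x + y) = tensor_lift f x + tensor_lift f y" for x y
  proof (induction x rule: tensor.abs_induct, induction y rule: tensor.abs_induct)
    fix u v :: "('a \<times> 'b) \<Rightarrow>\<^sub>0 complex"
    show "tensor_lift f (abs_tensor u + abs_tensor v) =
      tensor_lift f (abs_tensor u) + tensor_lift f (abs_tensor v)"
      using clinear_free_extend[of f]
      by (simp add: plus_tensor.abs_eq tensor_lift_abs assms Vector_Spaces.linear_iff)
  qed
  moreover have "tensor_lift f (s *\<^sub>C x) = s *\<^sub>C tensor_lift f x" for s x
  proof (induction x rule: tensor.abs_induct)
    fix u :: "('a \<times> 'b) \<Rightarrow>\<^sub>0 complex"
    show "tensor_lift f (s *\<^sub>C abs_tensor u) = s *\<^sub>C tensor_lift f (abs_tensor u)"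
      using clinear_free_extend[of f]
      by (simp add: scaleC_tensor.abs_eq tensor_lift_abs assms Vector_Spaces.linear_iff)
  qed
  ultimately show ?thesis
    by (simp add: Vector_Spaces.linear_iff cvs.vector_space_axioms)
qed


section \<open>Vertex algebras and their modules\<close>

text \<open>\<^term>\<open>nprod V a n b\<close> is the product $a_{(n)}b$, where
  $Y(a,z)=\sum_n a_{(n)}z^{-n-1}$. All the sums \<^const>\<open>Sum_any\<close> below have finite support,
  by the truncation condition.\<close>

record 'a va =
  vacuum :: 'a
  nprod :: "'a \<Rightarrow> int \<Rightarrow> 'a \<Rightarrow> 'a"

definition va_module ::
  "'a::complex_vector va \<Rightarrow> ('a \<Rightarrow> int \<Rightarrow> 'm \<Rightarrow> 'm::complex_vector) \<Rightarrow> bool"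
  where "va_module V act \<longleftrightarrow>
    (\<forall>n. cbilinear (\<lambda>a. act a n)) \<and>
    (\<forall>a x. \<exists>N. \<forall>n\<ge>N. act a n x = 0) \<and>
    (\<forall>n x. act (vacuum V) n x = (if n = -1 then x else 0)) \<and>
    (\<forall>a b x p q r.
      Sum_any (\<lambda>j::nat. ((of_int p :: complex) gchoose j) *\<^sub>C
        act (nprod V a (r + int j) b) (p + q - int j) x) =
      Sum_any (\<lambda>j::nat. ((-1) ^ j * ((of_int r :: complex) gchoose j)) *\<^sub>C
        (act a (p + r - int j) (act b (q + int j) x)
          - ((-1) powi r) *\<^sub>C act b (q + r - int j) (act a (p + int j) x))))"

definition vertex_algebra :: "'a::complex_vector va \<Rightarrow> bool"
  where "vertex_algebra V \<longleftrightarrow>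
    va_module V (nprod V) \<and>
    (\<forall>a. nprod V a (-1) (vacuum V) = a) \<and>
    (\<forall>a n. n \<ge> 0 \<longrightarrow> nprod V a n (vacuum V) = 0)"

definition va_deriv :: "'a va \<Rightarrow> 'a \<Rightarrow> 'a"
  where "va_deriv V a = nprod V a (-2) (vacuum V)"

definition va_hom :: "'a::complex_vector va \<Rightarrow> 'b::complex_vector va \<Rightarrow> ('a \<Rightarrow> 'b) \<Rightarrow> bool"
  where "va_hom V W f \<longleftrightarrow> clinear f \<and> f (vacuum V) = vacuum W \<and>
    (\<forall>a n b. f (nprod V a n b) = nprod W (f a) n (f b))"

definition va_irreducible ::
  "'a::complex_vector va \<Rightarrow> ('a \<Rightarrow> int \<Rightarrow> 'm \<Rightarrow> 'm::complex_vector) \<Rightarrow> bool"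
  where "va_irreducible V act \<longleftrightarrow>
    va_module V act \<and> (\<exists>x::'m. x \<noteq> 0) \<and>
    (\<forall>N. cvs.subspace N \<and> (\<forall>a n. \<forall>x\<in>N. act a n x \<in> N) \<longrightarrow> N = {0} \<or> N = UNIV)"

text \<open>$Y(a\otimes b,z)(x\otimes y)=Y(a,z)x\otimes Y(b,z)y$\<close>

definition tensor_act ::
  "('a::complex_vector \<Rightarrow> int \<Rightarrow> 'm \<Rightarrow> 'm::complex_vector) \<Rightarrow>
   ('b::complex_vector \<Rightarrow> int \<Rightarrow> 'n \<Rightarrow> 'n::complex_vector) \<Rightarrow>
   ('a, 'b) tensor \<Rightarrow> int \<Rightarrow> ('m, 'n) tensor \<Rightarrow> ('m, 'n) tensor"
  where "tensor_act F G t n u =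
    tensor_lift (\<lambda>a b. tensor_lift (\<lambda>x y.
      Sum_any (\<lambda>i::int. F a i x \<otimes> G b (n - i - 1) y)) u) t"

lemma tensor_act_tens:
  fixes F :: "'a::complex_vector \<Rightarrow> int \<Rightarrow> 'm \<Rightarrow> 'm::complex_vector"
    and G :: "'b::complex_vector \<Rightarrow> int \<Rightarrow> 'n \<Rightarrow> 'n::complex_vector"
  assumes "va_module V F" "va_module W G"
  shows "tensor_act F G (a \<otimes> b) n (x \<otimes> y) =
    Sum_any (\<lambda>i::int. F a i x \<otimes> G b (n - i - 1) y)"
proof -
  define T where "T a b x y i = F a i x \<otimes> G b (n - i - 1) y" for a b x y and i :: int
  have F: "cbilinear (\<lambda>a. F a i)" and G: "cbilinear (\<lambda>b. G b i)" for i
    using assms by (auto simp: va_module_def)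
  have t: "(u + u') \<otimes> w = u \<otimes> w + u' \<otimes> w" "(s *\<^sub>C u) \<otimes> w = s *\<^sub>C (u \<otimes> w)"
    "u \<otimes> (w + w') = u \<otimes> w + u \<otimes> w'" "u \<otimes> (s *\<^sub>C w) = s *\<^sub>C (u \<otimes> w)"
    for s and u u' :: 'm and w w' :: 'n
    using cbilinear_tens[where 'a='m and 'b='n]
    by (auto simp: cbilinear_def Vector_Spaces.linear_iff)
  have t0: "(0::'m) \<otimes> w = 0" "u \<otimes> (0::'n) = 0" for u :: 'm and w :: 'n
    using t(2)[of 0 u w] t(4)[of u 0 w] by simp_all
  have fin: "finite {i. T a b x y i \<noteq> 0}" for a b x y
  proof -
    obtain M where M: "\<And>i. i \<ge> M \<Longrightarrow> F a i x = 0"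
      using assms(1) unfolding va_module_def by meson
    obtain N where N: "\<And>i. i \<ge> N \<Longrightarrow> G b i y = 0"
      using assms(2) unfolding va_module_def by meson
    have "T a b x y i = 0" if "i \<notin> {n - 1 - N<..<M}" for i
    proof (cases "i \<ge> M")
      case True
      then show ?thesis
        using M by (simp add: T_def t0)
    next
      case False
      with that have "n - i - 1 \<ge> N" by auto
      then show ?thesis
        using N by (simp add: T_def t0)
    qed
    then have "{i. T a b x y i \<noteq> 0} \<subseteq> {n - 1 - N<..<M}" by blast
    then show ?thesis by (rule finite_subset) simp
  qed
  have T: "T (a + a') b x y i = T a b x y i + T a' b x y i"
    "T a (b + b') x y i = T a b x y i + T a b' x y i"
    "T a b (x + x') y i = T a b x y i + T a b x' y i"
    "T a b x (y + y') i = T a b x y i + T a b x y' i"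
    "T (s *\<^sub>C a) b x y i = s *\<^sub>C T a b x y i"
    "T a (s *\<^sub>C b) x y i = s *\<^sub>C T a b x y i"
    "T a b (s *\<^sub>C x) y i = s *\<^sub>C T a b x y i"
    "T a b x (s *\<^sub>C y) i = s *\<^sub>C T a b x y i" for a a' b b' x x' y y' s i
    using F[of i] G[of "n - i - 1"]
    by (simp_all add: T_def t cbilinear_def Vector_Spaces.linear_iff)
  have add: "Sum_any (T a b x y) + Sum_any (T a' b' x' y') =
      Sum_any (\<lambda>i. T a b x y i + T a' b' x' y' i)" for a b x y a' b' x' y'
    by (rule Sum_any.distrib[symmetric]) (rule fin)+
  have sc: "s *\<^sub>C Sum_any (T a b x y) = Sum_any (\<lambda>i. s *\<^sub>C T a b x y i)" for s a b x y
  proof -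
    have "{i. s *\<^sub>C T a b x y i \<noteq> 0} \<subseteq> {i. T a b x y i \<noteq> 0}" by auto
    then have "Sum_any (\<lambda>i. s *\<^sub>C T a b x y i) = (\<Sum>i | T a b x y i \<noteq> 0. s *\<^sub>C T a b x y i)"
      by (rule Sum_any.expand_superset[OF fin])
    then show ?thesis
      by (simp only: Sum_any.expand_set cvs.scale_sum_right)
  qed
  have ST: "Sum_any (T (a + a') b x y) = Sum_any (T a b x y) + Sum_any (T a' b x y)"
    "Sum_any (T a (b + b') x y) = Sum_any (T a b x y) + Sum_any (T a b' x y)"
    "Sum_any (T a b (x + x') y) = Sum_any (T a b x y) + Sum_any (T a b x' y)"
    "Sum_any (T a b x (y + y')) = Sum_any (T a b x y) + Sum_any (T a b x y')"
    "Sum_any (T (s *\<^sub>C a) b x y) = s *\<^sub>C Sum_any (T a b x y)"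
    "Sum_any (T a (s *\<^sub>C b) x y) = s *\<^sub>C Sum_any (T a b x y)"
    "Sum_any (T a b (s *\<^sub>C x) y) = s *\<^sub>C Sum_any (T a b x y)"
    "Sum_any (T a b x (s *\<^sub>C y)) = s *\<^sub>C Sum_any (T a b x y)" for a a' b b' x x' y y' s
    by (simp_all only: add sc) (rule Sum_any.cong, rule T)+
  have inner: "cbilinear (\<lambda>x y. Sum_any (T a b x y))" for a b
    unfolding cbilinear_def Vector_Spaces.linear_iff
    by (simp only: ST cvs.vector_space_axioms simp_thms)
  have lift_add: "tensor_lift f u + tensor_lift g u = tensor_lift (\<lambda>x y. f x y + g x y) u"
    for f g :: "'m \<Rightarrow> 'n \<Rightarrow> ('m, 'n) tensor" and u
    by (simp add: tensor_lift_def free_extend_def scaleC_add_right sum.distrib)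
  have lift_sc: "s *\<^sub>C tensor_lift f u = tensor_lift (\<lambda>x y. s *\<^sub>C f x y) u"
    for s and f :: "'m \<Rightarrow> 'n \<Rightarrow> ('m, 'n) tensor" and u
    by (simp add: tensor_lift_def free_extend_def cvs.scale_sum_right scaleC_scaleC mult.commute)
  have "clinear (\<lambda>a. tensor_lift (\<lambda>x y. Sum_any (T a b x y)) u)"
    "clinear (\<lambda>b. tensor_lift (\<lambda>x y. Sum_any (T a b x y)) u)" for a b u
    unfolding Vector_Spaces.linear_iff
    by (simp_all only: lift_add lift_sc ST cvs.vector_space_axioms simp_thms)
  then have outer: "cbilinear (\<lambda>a b. tensor_lift (\<lambda>x y. Sum_any (T a b x y)) u)" for u
    unfolding cbilinear_def by blast
  show ?thesis
    unfolding tensor_act_def T_def[symmetric]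
    by (subst tensor_lift_tens[OF outer]) (rule tensor_lift_tens[OF inner])
qed

definition tensor_va ::
  "'a::complex_vector va \<Rightarrow> 'b::complex_vector va \<Rightarrow> ('a, 'b) tensor va"
  where "tensor_va V W =
    \<lparr>vacuum = vacuum V \<otimes> vacuum W, nprod = tensor_act (nprod V) (nprod W)\<rparr>"

text \<open>$a(z)b(w)\sim\sum_n\frac{c_n(w)}{(z-w)^{n+1}}$ for the list of coefficients $c_0,c_1,\dots$\<close>

definition ope :: "'a::complex_vector va \<Rightarrow> 'a \<Rightarrow> 'a \<Rightarrow> 'a list \<Rightarrow> bool"
  where "ope V a b cs \<longleftrightarrow>
    (\<forall>n. nprod V a (int n) b = (if n < length cs then cs ! n else 0))"


section \<open>Free generation, gradings, simple graded quotients\<close>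

text \<open>A word is a list of pairs $(i,n)$, each standing for the operator
  $(a_i)_{(-n-1)}$ with $a_i$ the $i$-th generator.\<close>

definition word_act ::
  "('a \<Rightarrow> int \<Rightarrow> 'm \<Rightarrow> 'm) \<Rightarrow> 'a list \<Rightarrow> (nat \<times> nat) list \<Rightarrow> 'm \<Rightarrow> 'm"
  where "word_act act gens xs x =
    foldr (\<lambda>(i, n). act (gens ! i) (- int n - 1)) xs x"

definition ordered_words :: "nat \<Rightarrow> (nat \<times> nat) list set"
  where "ordered_words r =
    {xs. (\<forall>(i, n)\<in>set xs. i < r) \<and>
         sorted_wrt (\<lambda>(i, m) (j, n). i < j \<or> (i = j \<and> m \<le> n)) xs}"

text \<open>The ordered monomials in the negative modes of the generators, applied to the
  vectors of the family \<open>v\<close>, form a basis.\<close>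

definition free_over ::
  "('a \<Rightarrow> int \<Rightarrow> 'm \<Rightarrow> 'm::complex_vector) \<Rightarrow> 'a list \<Rightarrow> ('i \<Rightarrow> 'm) \<Rightarrow> bool"
  where "free_over act gens v \<longleftrightarrow>
    (let S = ordered_words (length gens) \<times> (UNIV :: 'i set);
         mon = (\<lambda>(xs, i). word_act act gens xs (v i))
     in inj_on mon S \<and> \<not> cvs.dependent (mon ` S) \<and> cvs.span (mon ` S) = UNIV)"

definition freely_strongly_generated :: "'a::complex_vector va \<Rightarrow> 'a list \<Rightarrow> bool"
  where "freely_strongly_generated V gens \<longleftrightarrow>
    free_over (nprod V) gens (\<lambda>_::unit. vacuum V)"

text \<open>Weight spaces when the $i$-th generator has weight \<open>wts ! i\<close>: the mode
  $(a_i)_{(-n-1)}$ raises the weight by \<open>wts ! i + n\<close>.\<close>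

definition weight_space ::
  "'a::complex_vector va \<Rightarrow> 'a list \<Rightarrow> nat list \<Rightarrow> nat \<Rightarrow> 'a set"
  where "weight_space V gens wts N = cvs.span
    {word_act (nprod V) gens xs (vacuum V) | xs.
      xs \<in> ordered_words (length gens) \<and> (\<Sum>(i, n)\<leftarrow>xs. wts ! i + n) = N}"

definition graded_ideal :: "'a::complex_vector va \<Rightarrow> (nat \<Rightarrow> 'a set) \<Rightarrow> 'a set \<Rightarrow> bool"
  where "graded_ideal V gr I \<longleftrightarrow>
    cvs.subspace I \<and>
    (\<forall>a n. \<forall>x\<in>I. nprod V a n x \<in> I \<and> nprod V x n a \<in> I) \<and>
    I = cvs.span (\<Union>n. I \<inter> gr n)"

text \<open>\<open>Q\<close>, with projection \<open>\<pi>\<close>, is the quotient of the graded vertex algebra \<open>V\<close> by its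
  largest proper graded ideal.\<close>

definition simple_graded_quotient ::
  "'a::complex_vector va \<Rightarrow> (nat \<Rightarrow> 'a set) \<Rightarrow> 'b::complex_vector va \<Rightarrow> ('a \<Rightarrow> 'b) \<Rightarrow> bool"
  where "simple_graded_quotient V gr Q \<pi> \<longleftrightarrow>
    vertex_algebra Q \<and> va_hom V Q \<pi> \<and> surj \<pi> \<and>
    graded_ideal V gr {x. \<pi> x = 0} \<and> {x. \<pi> x = 0} \<noteq> UNIV \<and>
    (\<forall>I. graded_ideal V gr I \<and> I \<noteq> UNIV \<longrightarrow> I \<subseteq> {x. \<pi> x = 0})"

text \<open>A $\mathbb Z_{\ge0}$-graded module over a vertex algebra with weight spaces \<open>gr\<close>. For
  $A$ of weight $\Delta$ the mode $A(m)$ is $A_{(m+\Delta-1)}$, so that $A_{(j)}$ maps $R(n)$ to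
  $R(n+\Delta-1-j)$, which is zero for a negative argument.\<close>

definition graded_va_module ::
  "'a::complex_vector va \<Rightarrow> (nat \<Rightarrow> 'a set) \<Rightarrow>
   ('a \<Rightarrow> int \<Rightarrow> 'm \<Rightarrow> 'm::complex_vector) \<Rightarrow> (nat \<Rightarrow> 'm set) \<Rightarrow> bool"
  where "graded_va_module V gr act R \<longleftrightarrow>
    va_module V act \<and>
    (\<forall>n. cvs.subspace (R n)) \<and>
    (\<forall>x. \<exists>!f. (\<forall>n. f n \<in> R n) \<and> finite {n. f n \<noteq> 0} \<and> x = Sum_any f) \<and>
    R 0 \<noteq> {0} \<and>
    (\<forall>\<Delta> n j. \<forall>A\<in>gr \<Delta>. \<forall>x\<in>R n.
      act A j x \<in> (let l = int n + int \<Delta> - 1 - j in if l \<ge> 0 then R (nat l) else {0}))"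


section \<open>The Lie algebra and its universal affine vertex algebra\<close>

type_synonym mat3 = "complex^3^3"

definition sl3 :: "mat3 set"
  where "sl3 = {x. trace x = 0}"

definition lie_bracket :: "mat3 \<Rightarrow> mat3 \<Rightarrow> mat3"
  where "lie_bracket x y = x ** y - y ** x"

definition mat_unit :: "3 \<Rightarrow> 3 \<Rightarrow> mat3"
  where "mat_unit i j = (\<chi> a b. if a = i \<and> b = j then 1 else 0)"

definition "e\<^sub>1 = mat_unit 1 2"
definition "e\<^sub>2 = mat_unit 2 3"
definition "e\<^sub>3 = mat_unit 1 3"
definition "h\<^sub>1 = mat_unit 1 1 - mat_unit 2 2"
definition "h\<^sub>2 = mat_unit 2 2 - mat_unit 3 3"
definition "f\<^sub>1 = mat_unit 2 1"
definition "f\<^sub>2 = mat_unit 3 2"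
definition "f\<^sub>3 = mat_unit 3 1"

definition sl3_basis :: "mat3 list"
  where "sl3_basis = [e\<^sub>1, e\<^sub>2, e\<^sub>3, h\<^sub>1, h\<^sub>2, f\<^sub>1, f\<^sub>2, f\<^sub>3]"

text \<open>The values of \<open>\<iota>\<close> outside \<^const>\<open>sl3\<close> are irrelevant. The invariant form is the trace
  form. By the Poincare-Birkhoff-Witt theorem, the last condition says that \<open>V\<close> is the module
  induced from the one-dimensional $\mathfrak{sl}_3[t]\oplus\mathbb CK$-module on which $K=k$.\<close>

definition universal_affine_sl3 ::
  "complex \<Rightarrow> 'a::complex_vector va \<Rightarrow> (mat3 \<Rightarrow> 'a) \<Rightarrow> bool"
  where "universal_affine_sl3 k V \<iota> \<longleftrightarrow>
    vertex_algebra V \<and>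
    (\<forall>x\<in>sl3. \<forall>y\<in>sl3. \<forall>a. \<iota> (x + y) = \<iota> x + \<iota> y \<and> \<iota> (a *\<^sub>C x) = a *\<^sub>C \<iota> x) \<and>
    (\<forall>x\<in>sl3. \<forall>y\<in>sl3. ope V (\<iota> x) (\<iota> y)
      [\<iota> (lie_bracket x y), (k * trace (x ** y)) *\<^sub>C vacuum V]) \<and>
    freely_strongly_generated V (map \<iota> sl3_basis)"

definition affine_grading :: "'a::complex_vector va \<Rightarrow> (mat3 \<Rightarrow> 'a) \<Rightarrow> nat \<Rightarrow> 'a set"
  where "affine_grading V \<iota> = weight_space V (map \<iota> sl3_basis) (replicate 8 1)"

text \<open>An irreducible \<^const>\<open>sl3\<close>-module on the subspace \<open>U\<close> of the ambient space.\<close>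

definition sl3_module :: "(mat3 \<Rightarrow> 'm \<Rightarrow> 'm::complex_vector) \<Rightarrow> 'm set \<Rightarrow> bool"
  where "sl3_module \<rho> U \<longleftrightarrow>
    cvs.subspace U \<and>
    (\<forall>x\<in>sl3. \<forall>u\<in>U. \<rho> x u \<in> U) \<and>
    (\<forall>x\<in>sl3. \<forall>u\<in>U. \<forall>v\<in>U. \<forall>a. \<rho> x (u + v) = \<rho> x u + \<rho> x v \<and> \<rho> x (a *\<^sub>C u) = a *\<^sub>C \<rho> x u) \<and>
    (\<forall>x\<in>sl3. \<forall>y\<in>sl3. \<forall>u\<in>U. \<forall>a.
      \<rho> (x + y) u = \<rho> x u + \<rho> y u \<and> \<rho> (a *\<^sub>C x) u = a *\<^sub>C \<rho> x u \<and>
      \<rho> (lie_bracket x y) u = \<rho> x (\<rho> y u) - \<rho> y (\<rho> x u))"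

definition sl3_irreducible :: "(mat3 \<Rightarrow> 'm \<Rightarrow> 'm::complex_vector) \<Rightarrow> 'm set \<Rightarrow> bool"
  where "sl3_irreducible \<rho> U \<longleftrightarrow>
    sl3_module \<rho> U \<and> U \<noteq> {0} \<and>
    (\<forall>N. cvs.subspace N \<and> N \<subseteq> U \<and> (\<forall>x\<in>sl3. \<forall>u\<in>N. \<rho> x u \<in> N) \<longrightarrow> N = {0} \<or> N = U)"


section \<open>The Bershadsky-Polyakov algebra\<close>

text \<open>For $k\ne-3$ the generator \<open>L\<close> is the Virasoro vector $L^{\rm BP}$; for $k=-3$ it is
  $T^{\rm BP}$, which takes the place of $(k+3)L^{\rm BP}$.\<close>

definition bershadsky_polyakov ::
  "complex \<Rightarrow> 'a::complex_vector va \<Rightarrow> 'a \<Rightarrow> 'a \<Rightarrow> 'a \<Rightarrow> 'a \<Rightarrow> bool"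
  where "bershadsky_polyakov k V J Gp Gm L \<longleftrightarrow>
    vertex_algebra V \<and>
    freely_strongly_generated V [J, Gp, Gm, L] \<and>
    ope V J J [0, ((2 * k + 3) / 3) *\<^sub>C vacuum V] \<and>
    ope V J Gp [Gp] \<and>
    ope V J Gm [- Gm] \<and>
    ope V Gp Gp [] \<and>
    ope V Gm Gm [] \<and>
    ope V Gp Gm
      [3 *\<^sub>C nprod V J (-1) J + (3 * (k + 1) / 2) *\<^sub>C va_deriv V J
         - (if k = -3 then L else (k + 3) *\<^sub>C L),
       (3 * (k + 1)) *\<^sub>C J,
       ((k + 1) * (2 * k + 3)) *\<^sub>C vacuum V] \<and>
    (if k = -3
     then ope V L J [] \<and> ope V L Gp [] \<and> ope V L Gm [] \<and> ope V L L []
     else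
       ope V L L [va_deriv V L, 2 *\<^sub>C L, 0,
         (- ((2 * k + 3) * (3 * k + 1) / (k + 3)) / 2) *\<^sub>C vacuum V] \<and>
       ope V L J [va_deriv V J, J] \<and>
       ope V L Gp [va_deriv V Gp, (3 / 2) *\<^sub>C Gp] \<and>
       ope V L Gm [va_deriv V Gm, (3 / 2) *\<^sub>C Gm])"

definition bp_grading ::
  "'a::complex_vector va \<Rightarrow> 'a \<Rightarrow> 'a \<Rightarrow> 'a \<Rightarrow> 'a \<Rightarrow> nat \<Rightarrow> 'a set"
  where "bp_grading V J Gp Gm L = weight_space V [J, Gp, Gm, L] [1, 1, 2, 2]"


section \<open>The vertex algebra generated by half a lattice, and its modules\<close>

text \<open>\<open>c i\<close>, \<open>d i\<close> ($i=1,2$) are the Heisenberg fields and \<open>e m\<^sub>1 m\<^sub>2\<close> is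
  $e^{m_1c_1+m_2c_2}$. The following describes the module spanned by the Fock spaces over
  $v_{n_1,n_2}=e^\mu$, where
  $\mu=\frac12(r_1d_1+r_2d_2)+(l_1+n_1)c_1+(l_2+n_2)c_2$ and $n_1,n_2$ are arbitrary
  integers: $h_{(0)}e^\mu=(h,\mu)e^\mu$ and $h_{(n)}e^\mu=0$ for $n>0$ and $h$ in the Heisenberg
  algebra, and $Y(e^\alpha,z)e^\mu=z^{(\alpha,\mu)}(e^{\alpha+\mu}+\cdots)$, where
  $(\alpha,\mu)=m_1r_1+m_2r_2$ for $\alpha=m_1c_1+m_2c_2$.\<close>

definition Pi_fock_module ::
  "'p::complex_vector va \<Rightarrow> (nat \<Rightarrow> 'p) \<Rightarrow> (nat \<Rightarrow> 'p) \<Rightarrow> (int \<Rightarrow> int \<Rightarrow> 'p) \<Rightarrow>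
   int \<Rightarrow> int \<Rightarrow> complex \<Rightarrow> complex \<Rightarrow>
   ('p \<Rightarrow> int \<Rightarrow> 'm \<Rightarrow> 'm::complex_vector) \<Rightarrow> (int \<Rightarrow> int \<Rightarrow> 'm) \<Rightarrow> bool"
  where "Pi_fock_module P c d e r\<^sub>1 r\<^sub>2 l\<^sub>1 l\<^sub>2 act v \<longleftrightarrow>
    va_module P act \<and>
    (\<forall>n\<^sub>1 n\<^sub>2.
      act (c 1) 0 (v n\<^sub>1 n\<^sub>2) = of_int r\<^sub>1 *\<^sub>C v n\<^sub>1 n\<^sub>2 \<and>
      act (c 2) 0 (v n\<^sub>1 n\<^sub>2) = of_int r\<^sub>2 *\<^sub>C v n\<^sub>1 n\<^sub>2 \<and>
      act (d 1) 0 (v n\<^sub>1 n\<^sub>2) = (2 * (l\<^sub>1 + of_int n\<^sub>1)) *\<^sub>C v n\<^sub>1 n\<^sub>2 \<and>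
      act (d 2) 0 (v n\<^sub>1 n\<^sub>2) = (2 * (l\<^sub>2 + of_int n\<^sub>2)) *\<^sub>C v n\<^sub>1 n\<^sub>2 \<and>
      (\<forall>n>0. \<forall>i\<in>{1, 2}. act (c i) n (v n\<^sub>1 n\<^sub>2) = 0 \<and> act (d i) n (v n\<^sub>1 n\<^sub>2) = 0) \<and>
      (\<forall>m\<^sub>1 m\<^sub>2. let s = m\<^sub>1 * r\<^sub>1 + m\<^sub>2 * r\<^sub>2 in
        act (e m\<^sub>1 m\<^sub>2) (- s - 1) (v n\<^sub>1 n\<^sub>2) = v (n\<^sub>1 + m\<^sub>1) (n\<^sub>2 + m\<^sub>2) \<and>
        (\<forall>n > - s - 1. act (e m\<^sub>1 m\<^sub>2) n (v n\<^sub>1 n\<^sub>2) = 0))) \<and>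
    free_over act [c 1, c 2, d 1, d 2] (\<lambda>(n\<^sub>1, n\<^sub>2). v n\<^sub>1 n\<^sub>2)"

text \<open>$\Pi(0)^{\otimes2}=M(1)\otimes\mathbb C[\mathbb Zc_1+\mathbb Zc_2]$. The condition
  $\partial e^\alpha={:}\alpha e^\alpha{:}$ pins down the fields $e^\alpha(z)$.\<close>

definition Pi_0_squared ::
  "'p::complex_vector va \<Rightarrow> (nat \<Rightarrow> 'p) \<Rightarrow> (nat \<Rightarrow> 'p) \<Rightarrow> (int \<Rightarrow> int \<Rightarrow> 'p) \<Rightarrow> bool"
  where "Pi_0_squared P c d e \<longleftrightarrow>
    vertex_algebra P \<and>
    (\<forall>i\<in>{1, 2}. \<forall>j\<in>{1, 2}.
      ope P (c i) (d j) [0, (if i = j then 2 else 0) *\<^sub>C vacuum P] \<and>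
      ope P (c i) (c j) [] \<and> ope P (d i) (d j) []) \<and>
    e 0 0 = vacuum P \<and>
    (\<forall>m\<^sub>1 m\<^sub>2. va_deriv P (e m\<^sub>1 m\<^sub>2) =
      nprod P (of_int m\<^sub>1 *\<^sub>C c 1 + of_int m\<^sub>2 *\<^sub>C c 2) (-1) (e m\<^sub>1 m\<^sub>2)) \<and>
    Pi_fock_module P c d e 0 0 0 0 (nprod P) e"


section \<open>The free field realization\<close>

text \<open>\<open>\<iota>\<close> embeds \<^const>\<open>sl3\<close> into the affine vertex algebra \<open>V\<close>, and \<open>J\<close>, \<open>Gp\<close>, \<open>Gm\<close> are the
  generators of \<open>W\<close>. Normally ordered products are right-nested, and the normally ordered
  product of $w\in W$ and $p\in P$ is $w\otimes p$. The image of $f_3=[f_2,f_1]$ is forced.\<close>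

definition free_field_realization ::
  "complex \<Rightarrow> 'v::complex_vector va \<Rightarrow> (mat3 \<Rightarrow> 'v) \<Rightarrow>
   'w::complex_vector va \<Rightarrow> 'w \<Rightarrow> 'w \<Rightarrow> 'w \<Rightarrow>
   'p::complex_vector va \<Rightarrow> (nat \<Rightarrow> 'p) \<Rightarrow> (nat \<Rightarrow> 'p) \<Rightarrow> (int \<Rightarrow> int \<Rightarrow> 'p) \<Rightarrow>
   ('v \<Rightarrow> ('w, 'p) tensor) \<Rightarrow> bool"
  where "free_field_realization k V \<iota> W J Gp Gm P c d e \<phi> \<longleftrightarrow>
    va_hom V (tensor_va W P) \<phi> \<and>
    (let one\<^sub>W = vacuum W;
         one\<^sub>P = vacuum P;
         no = (\<lambda>x y. nprod P x (-1) y);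
         \<beta> = e 1 0;
         \<gamma> = (- 1 / 2) *\<^sub>C no (c 1 + d 1) (e (-1) 0);
         exp_c = e 0 1;
         exp_mc = e 0 (-1)
     in
       \<phi> (\<iota> e\<^sub>1) = - (one\<^sub>W \<otimes> no \<gamma> exp_c) \<and>
       \<phi> (\<iota> e\<^sub>2) = one\<^sub>W \<otimes> \<beta> \<and>
       \<phi> (\<iota> e\<^sub>3) = one\<^sub>W \<otimes> exp_c \<and>
       \<phi> (\<iota> h\<^sub>1) = (- 2) *\<^sub>C (J \<otimes> one\<^sub>P)
         + one\<^sub>W \<otimes> (no \<gamma> \<beta> - ((2 * k + 9) / 6) *\<^sub>C c 2 + (1 / 2) *\<^sub>C d 2) \<and>
       \<phi> (\<iota> h\<^sub>2) = J \<otimes> one\<^sub>P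
         + one\<^sub>W \<otimes> ((- 2) *\<^sub>C no \<gamma> \<beta> + ((4 * k + 9) / 6) *\<^sub>C c 2 + (1 / 2) *\<^sub>C d 2) \<and>
       \<phi> (\<iota> f\<^sub>1) = Gp \<otimes> one\<^sub>P
         - (2 *\<^sub>C (J \<otimes> no \<beta> exp_mc)
            + one\<^sub>W \<otimes> no (((8 * k + 9) / 6) *\<^sub>C c 2 - (1 / 2) *\<^sub>C d 2) (no \<beta> exp_mc))
         + (k + 1) *\<^sub>C (one\<^sub>W \<otimes> no (va_deriv P \<beta>) exp_mc) \<and>
       \<phi> (\<iota> f\<^sub>2) = Gm \<otimes> exp_mc
         + (J \<otimes> \<gamma> + one\<^sub>W \<otimes> no (((4 * k + 9) / 6) *\<^sub>C c 2 + (1 / 2) *\<^sub>C d 2) \<gamma>)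
         + k *\<^sub>C (one\<^sub>W \<otimes> va_deriv P \<gamma>)
         - one\<^sub>W \<otimes> no \<gamma> (no \<gamma> \<beta>))"

end

(*
Write M for the tensor product of R with the Fock module. Over the full tensor product of W_k with
the half lattice vertex algebra M is irreducible: a vector of minimal length in the Heisenberg
creation operators is killed by all annihilation operators, hence by the Euler operator, hence has
length 0, and the zero modes of d_1, d_2 separate the exponentials.

The fields of e_2 and e_3 are e^{c_1} and e^{c_2}, and their zero modes E_1, E_2 are bijective on M,
because both the generalized kernel and the intersection of the images of the powers of E_i are
stable under all fields. A subspace stable under sl_3-hat and under the inverses of E_1, E_2 is
stable under e^{-c_1} and e^{-c_2}, since e^{c}(z) e^{-c}(z) = 1, and therefore under all of W_k and
of the half lattice algebra; so it is 0 or M.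

Let N be a nonzero submodule. As E_1, E_2 act ad-nilpotently, the union of the preimages and the
intersection of the images of N under the monomials in E_1, E_2 are again submodules, now stable
under the inverses. The union is M, so N meets the top component and hence contains it. The top
component is contained in its own images under E_1 and E_2, so it lies in the intersection, which is
therefore M as well.
*)

theory Submission
  imports Defs
begin

section \<open>Linear algebra of tensor products\<close>

text \<open>Zero modes are the right operators to invert: [u_(0), a_(n)] = (u_(0) a)_(n), so local
  nilpotency of u_(0) on the algebra is an Ore condition, and since E_1, E_2 are bijective on M,
  localizations of submodules are again subspaces of M. That zero modes shift the exponentials of
  the top component comes from the shift -d_1/2 - d_2/2: it pairs to -1 with c_1 and c_2, so the
  leading mode of e^{a c_1 + b c_2} has index a + b - 1. Inverting is unavoidable because the
  realization supplies e^{c_1} and e^{c_2} by themselves, but e^{-c_1} and e^{-c_2} only inside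
  composite fields. Two localizations are used because they give dual information: that the union is
  M says only that some monomial moves a given vector into N, whereas the intersection lies in N and
  bounds it from below. That M is a module over the tensor product is not visible from the formula
  for the modes. The Borcherds identity does not factor over the tensor product, but locality and
  weak associativity do, and the identity is recovered from these two by a recursion in its
  indices.\<close>

lemma clinear_iff: "clinear f \<longleftrightarrow> (\<forall>x y. f (x + y) = f x + f y) \<and> (\<forall>s x. f (s *\<^sub>C x) = s *\<^sub>C f x)"
  by (simp add: Vector_Spaces.linear_iff cvs.vector_space_axioms)

lemma clinear_add: "clinear f \<Longrightarrow> f (x + y) = f x + f y"
  and clinear_scale: "clinear f \<Longrightarrow> f (s *\<^sub>C x) = s *\<^sub>C f x"
  by (simp_all add: clinear_iff)

lemma clinear_zero: "clinear f \<Longrightarrow> f 0 = 0"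
  using clinear_scale[of f 0 0] by simp

lemma clinear_minus: "clinear f \<Longrightarrow> f (- x) = - f x"
  using clinear_scale[of f "-1" x] by (simp add: cvs.scale_minus_left)

lemma clinear_diff: "clinear f \<Longrightarrow> f (x - y) = f x - f y"
  using clinear_add[of f x "- y"] clinear_minus[of f y] by simp

lemma clinear_sum:
  assumes "clinear f"
  shows "f (sum g A) = (\<Sum>i\<in>A. f (g i))"
  by (induction A rule: infinite_finite_induct)
    (simp_all add: clinear_zero[OF assms] clinear_add[OF assms])

lemma clinear_compose: "clinear f \<Longrightarrow> clinear g \<Longrightarrow> clinear (\<lambda>x. f (g x))"
  by (simp add: clinear_iff)

lemma clinear_sum_fun: "(\<And>i. clinear (f i)) \<Longrightarrow> clinear (\<lambda>x. \<Sum>i\<in>A. f i x)"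
  by (simp add: clinear_iff sum.distrib cvs.scale_sum_right)

lemma clinear_scale_fun: "clinear f \<Longrightarrow> clinear (\<lambda>x. s *\<^sub>C f x)"
  by (simp add: clinear_iff scaleC_add_right mult.commute)

lemma clinear_funpow: "clinear f \<Longrightarrow> clinear (f ^^ n)"
  for f :: "'a::complex_vector \<Rightarrow> 'a"
  by (induction n) (simp_all add: clinear_iff)

lemma cbilinear_left: "cbilinear f \<Longrightarrow> clinear (\<lambda>x. f x y)"
  and cbilinear_right: "cbilinear f \<Longrightarrow> clinear (f x)"
  by (simp_all add: cbilinear_def)

lemma Sum_any_eq_sum:
  assumes "finite A" and "\<And>i. i \<notin> A \<Longrightarrow> f i = 0"
  shows "Sum_any f = sum f A"
  by (rule Sum_any.expand_superset) (use assms in auto)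

lemma Sum_any_eq_sum_lessThan:
  assumes "\<And>j. j \<ge> K \<Longrightarrow> f j = 0"
  shows "Sum_any f = (\<Sum>j<K::nat. f j)"
  by (rule Sum_any_eq_sum) (use assms in \<open>auto simp: not_less\<close>)

lemma clinear_Sum_any:
  assumes g: "clinear g" and f: "finite {i. f i \<noteq> 0}"
  shows "g (Sum_any f) = Sum_any (\<lambda>i. g (f i))"
proof -
  have "Sum_any (\<lambda>i. g (f i)) = (\<Sum>i | f i \<noteq> 0. g (f i))"
    by (rule Sum_any_eq_sum) (use f in \<open>auto simp: clinear_zero[OF g]\<close>)
  then show ?thesis
    by (simp only: Sum_any.expand_set clinear_sum[OF g])
qed

lemma subspace_Sum_any:
  assumes "cvs.subspace N" and "\<And>i. f i \<in> N"
  shows "Sum_any f \<in> N"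
  unfolding Sum_any.expand_set using assms by (intro cvs.subspace_sum)

lemma Sum_any_pair:
  fixes f :: "'a \<Rightarrow> 'b \<Rightarrow> 'c::comm_monoid_add"
  assumes "finite {p. f (fst p) (snd p) \<noteq> 0}"
  shows "Sum_any (\<lambda>i. Sum_any (f i)) = Sum_any (\<lambda>(i, j). f i j)"
proof -
  define S where "S = {p. f (fst p) (snd p) \<noteq> 0}"
  have supp: "f i j = 0" if "(i, j) \<notin> S" for i j
    using that by (simp add: S_def)
  have A: "f i j = 0" if "i \<notin> fst ` S" for i j
    by (rule supp) (use that in \<open>auto intro: rev_image_eqI\<close>)
  have B: "f i j = 0" if "j \<notin> snd ` S" for i j
    by (rule supp) (use that in \<open>auto intro: rev_image_eqI\<close>)
  have fin: "finite (fst ` S)" "finite (snd ` S)"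
    using assms by (simp_all add: S_def)
  have "Sum_any (f i) = (\<Sum>j\<in>snd ` S. f i j)" for i
    by (rule Sum_any_eq_sum[OF fin(2) B])
  moreover have "Sum_any (\<lambda>i. \<Sum>j\<in>snd ` S. f i j) = (\<Sum>i\<in>fst ` S. \<Sum>j\<in>snd ` S. f i j)"
    by (rule Sum_any_eq_sum[OF fin(1)]) (simp add: A)
  moreover have "Sum_any (\<lambda>(i, j). f i j) = (\<Sum>(i, j)\<in>fst ` S \<times> snd ` S. f i j)"
  proof (rule Sum_any_eq_sum)
    fix p assume "p \<notin> fst ` S \<times> snd ` S"
    then have "p \<notin> S" by (auto simp: mem_Times_iff)
    then show "(case p of (i, j) \<Rightarrow> f i j) = 0" by (cases p) (simp add: supp)
  qed (simp add: fin)
  ultimately show ?thesis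
    by (simp add: sum.cartesian_product)
qed

lemma Sum_any_reindex:
  assumes "bij h"
  shows "Sum_any (\<lambda>i. f (h i)) = Sum_any f"
  by (rule Sum_any.reindex_cong[of h, symmetric])
    (use assms in \<open>auto simp: bij_def inj_on_def dest: surjD\<close>)

lemmas clinear_tens_left = cbilinear_left[OF cbilinear_tens]
  and clinear_tens_right = cbilinear_right[OF cbilinear_tens]

lemmas tens_add_left = clinear_add[OF clinear_tens_left]
  and tens_add_right = clinear_add[OF clinear_tens_right]
  and tens_scale_left = clinear_scale[OF clinear_tens_left]
  and tens_scale_right = clinear_scale[OF clinear_tens_right]
  and tens_zero_left [simp] = clinear_zero[OF clinear_tens_left]
  and tens_zero_right [simp] = clinear_zero[OF clinear_tens_right]

lemma span_tens: "cvs.span (range (\<lambda>(x, y). x \<otimes> y)) = UNIV"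
proof -
  have "t \<in> cvs.span (range (\<lambda>(x, y). x \<otimes> y))" for t :: "('a, 'b) tensor"
  proof (induction t rule: tensor.abs_induct)
    case (1 u)
    have u: "u = (\<Sum>p\<in>Poly_Mapping.keys u. Poly_Mapping.lookup u p *\<^sub>C free_pair (fst p) (snd p))"
    proof (rule poly_mapping_eqI)
      fix k
      have "(\<Sum>p\<in>Poly_Mapping.keys u. Poly_Mapping.lookup u p * (if p = k then 1 else 0)) =
        (\<Sum>p\<in>Poly_Mapping.keys u. if p = k then Poly_Mapping.lookup u p else 0)"
        by (rule sum.cong) auto
      then show "Poly_Mapping.lookup u k = Poly_Mapping.lookup
          (\<Sum>p\<in>Poly_Mapping.keys u. Poly_Mapping.lookup u p *\<^sub>C free_pair (fst p) (snd p)) k"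
        by (simp add: lookup_sum lookup_single when_def scaleC_complex_def in_keys_iff)
    qed
    have lin: "clinear (abs_tensor :: _ \<Rightarrow> ('a, 'b) tensor)"
      by (simp add: clinear_iff plus_tensor.abs_eq scaleC_tensor.abs_eq)
    have "abs_tensor u = (\<Sum>p\<in>Poly_Mapping.keys u. Poly_Mapping.lookup u p *\<^sub>C (fst p \<otimes> snd p))"
      by (subst arg_cong[OF u, of abs_tensor])
        (simp add: clinear_sum[OF lin] clinear_scale[OF lin] tens.abs_eq)
    also have "\<dots> \<in> cvs.span (range (\<lambda>(x, y). x \<otimes> y))"
      by (intro cvs.span_sum cvs.span_scale cvs.span_base) force
    finally show ?case .
  qed
  then show ?thesis by blast
qed

text \<open>A scalar is absorbed into the left factor of a pure tensor, so sums of pure tensors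
  already exhaust the tensor product.\<close>

lemma tensor_induct [case_names tens add]:
  assumes "\<And>x y. P (x \<otimes> y)" and "\<And>t u. P t \<Longrightarrow> P u \<Longrightarrow> P (t + u)"
  shows "P t"
proof -
  have "t \<in> cvs.span (range (\<lambda>(x, y). x \<otimes> y))"
    by (simp add: span_tens)
  then show ?thesis
  proof (induction rule: cvs.span_induct_alt)
    case base
    show ?case using assms(1)[of 0 0] by simp
  next
    case (step c t u)
    then obtain x y where "t = x \<otimes> y" by auto
    then have "c *\<^sub>C t = (c *\<^sub>C x) \<otimes> y" by (simp add: tens_scale_left)
    with step assms show ?case by metis
  qed
qed

section \<open>Bilinearity and truncation of the tensor product action\<close>

lemma va_moduleD:
  assumes "va_module V act"
  shows va_module_cbilinear: "cbilinear (\<lambda>a. act a n)"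
    and va_module_truncation: "\<exists>N. \<forall>n\<ge>N. act a n x = 0"
    and va_module_vacuum: "act (vacuum V) n x = (if n = -1 then x else 0)"
    and va_module_borcherds: "Sum_any (\<lambda>j::nat. ((of_int p :: complex) gchoose j) *\<^sub>C
        act (nprod V a (r + int j) b) (p + q - int j) x) =
      Sum_any (\<lambda>j::nat. ((-1) ^ j * ((of_int r :: complex) gchoose j)) *\<^sub>C
        (act a (p + r - int j) (act b (q + int j) x)
          - ((-1) powi r) *\<^sub>C act b (q + r - int j) (act a (p + int j) x)))"
  using assms unfolding va_module_def by blast+

lemma va_module_clinear:
  assumes "va_module V act"
  shows va_module_clinear_left: "clinear (\<lambda>a. act a n x)"
    and va_module_clinear_right: "clinear (act a n)"
  using va_module_cbilinear[OF assms] by (auto simp: cbilinear_def)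

lemma tensor_act_finite_support:
  assumes "va_module V F" "va_module W G"
  shows "finite {i. F a i x \<otimes> G b (n - i - 1) y \<noteq> 0}"
proof -
  obtain M where M: "\<And>i. i \<ge> M \<Longrightarrow> F a i x = 0"
    using va_module_truncation[OF assms(1)] by blast
  obtain N where N: "\<And>i. i \<ge> N \<Longrightarrow> G b i y = 0"
    using va_module_truncation[OF assms(2)] by blast
  have "F a i x \<otimes> G b (n - i - 1) y = 0" if "i \<notin> {n - 1 - N<..<M}" for i
    using that M[of i] N[of "n - i - 1"] by (cases "i \<ge> M") auto
  then have "{i. F a i x \<otimes> G b (n - i - 1) y \<noteq> 0} \<subseteq> {n - 1 - N<..<M}" by blast
  then show ?thesis by (rule finite_subset) simp
qed

text \<open>In the algebra argument, linearity is that of the outer lift. In the module argument it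
  comes from the inner lift, which is visible only for a pure algebra argument; sums of these are
  handled by the linearity already obtained.\<close>

lemma cbilinear_tensor_act:
  fixes F :: "'a::complex_vector \<Rightarrow> int \<Rightarrow> 'm \<Rightarrow> 'm::complex_vector"
    and G :: "'b::complex_vector \<Rightarrow> int \<Rightarrow> 'n \<Rightarrow> 'n::complex_vector"
  assumes V: "va_module V F" and W: "va_module W G"
  shows "cbilinear (\<lambda>t. tensor_act F G t n)"
proof -
  define S where "S a b x y = Sum_any (\<lambda>i::int. F a i x \<otimes> G b (n - i - 1) y)" for a b x y
  note fin = tensor_act_finite_support[OF V W]
  note lin = va_module_clinear[OF V] va_module_clinear[OF W]
  have add: "Sum_any (\<lambda>i::int. F a i x \<otimes> G b (n - i - 1) y + F a' i x' \<otimes> G b' (n - i - 1) y') =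
    S a b x y + S a' b' x' y'" for a b x y a' b' x' y'
    unfolding S_def by (rule Sum_any.distrib) (rule fin)+
  have sc: "Sum_any (\<lambda>i::int. s *\<^sub>C (F a i x \<otimes> G b (n - i - 1) y)) = s *\<^sub>C S a b x y" for s a b x y
    unfolding S_def
    by (rule clinear_Sum_any[symmetric]) (auto intro: fin simp: clinear_iff scaleC_add_right cvs.scale_left_commute)
  have S: "S (a + a') b x y = S a b x y + S a' b x y"
    "S a (b + b') x y = S a b x y + S a b' x y"
    "S a b (x + x') y = S a b x y + S a b x' y"
    "S a b x (y + y') = S a b x y + S a b x y'"
    "S (s *\<^sub>C a) b x y = s *\<^sub>C S a b x y"
    "S a (s *\<^sub>C b) x y = s *\<^sub>C S a b x y"
    "S a b (s *\<^sub>C x) y = s *\<^sub>C S a b x y"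
    "S a b x (s *\<^sub>C y) = s *\<^sub>C S a b x y" for a a' b b' x x' y y' s
    unfolding add[symmetric] sc[symmetric] unfolding S_def
    by (simp_all only: lin[THEN clinear_add] lin[THEN clinear_scale] tens_add_left tens_add_right
        tens_scale_left tens_scale_right)
  have inner: "cbilinear (\<lambda>x y. S a b x y)" for a b
    by (simp add: cbilinear_def clinear_iff S)
  \<comment> \<open>The lift is evaluated on one chosen representative of u, so it depends linearly
    on the lifted map, whether or not that map is bilinear.\<close>
  have lift_add: "tensor_lift f u + tensor_lift g u = tensor_lift (\<lambda>x y. f x y + g x y) u"
    for f g :: "'m \<Rightarrow> 'n \<Rightarrow> ('m, 'n) tensor" and u
    by (simp add: tensor_lift_def free_extend_def scaleC_add_right sum.distrib)
  have lift_sc: "s *\<^sub>C tensor_lift f u = tensor_lift (\<lambda>x y. s *\<^sub>C f x y) u"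
    for s and f :: "'m \<Rightarrow> 'n \<Rightarrow> ('m, 'n) tensor" and u
    by (simp add: tensor_lift_def free_extend_def cvs.scale_sum_right scaleC_scaleC mult.commute)
  have outer: "cbilinear (\<lambda>a b. tensor_lift (S a b) u)" for u
  proof -
    have "S (a + a') b = (\<lambda>x y. S a b x y + S a' b x y)" "S a (b + b') = (\<lambda>x y. S a b x y + S a b' x y)"
      "S (s *\<^sub>C a) b = (\<lambda>x y. s *\<^sub>C S a b x y)" "S a (s *\<^sub>C b) = (\<lambda>x y. s *\<^sub>C S a b x y)"
      for a a' b b' s by (intro ext S)+
    then show ?thesis
      by (simp add: cbilinear_def clinear_iff) (simp add: lift_add lift_sc)
  qed
  have eq: "tensor_act F G t n u = tensor_lift (\<lambda>a b. tensor_lift (S a b) u) t" for t u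
    by (simp add: tensor_act_def S_def[abs_def])
  have left: "clinear (\<lambda>t. tensor_act F G t n u)" for u
    unfolding eq by (rule clinear_tensor_lift[OF outer])
  moreover have "clinear (tensor_act F G t n)" for t
  proof (induction t rule: tensor_induct)
    case (tens a b)
    show ?case
      unfolding eq tensor_lift_tens[OF outer] by (rule clinear_tensor_lift[OF inner])
  next
    case (add t u)
    then show ?case
      by (simp add: clinear_iff clinear_add[OF left] scaleC_add_right add_ac)
  qed
  ultimately show ?thesis
    by (simp add: cbilinear_def)
qed

lemma tensor_act_truncation:
  assumes V: "va_module V F" and W: "va_module W G"
  shows "\<exists>N. \<forall>n\<ge>N. tensor_act F G t n u = 0"
proof (induction t rule: tensor_induct)
  case (tens a b)
  show ?case
  proof (induction u rule: tensor_induct)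
    case (tens x y)
    obtain M where M: "\<And>i. i \<ge> M \<Longrightarrow> F a i x = 0"
      using va_module_truncation[OF V] by blast
    obtain N where N: "\<And>i. i \<ge> N \<Longrightarrow> G b i y = 0"
      using va_module_truncation[OF W] by blast
    \<comment> \<open>The two mode indices add up to n - 1 \<ge> M + N - 1, so one of them has
      reached its bound.\<close>
    have "tensor_act F G (a \<otimes> b) n (x \<otimes> y) = 0" if "n \<ge> M + N" for n
    proof -
      have "F a i x \<otimes> G b (n - i - 1) y = 0" for i
        using that M[of i] N[of "n - i - 1"] by (cases "i \<ge> M") auto
      then show ?thesis by (simp add: tensor_act_tens[OF V W])
    qed
    then show ?case by blast
  next
    case (add u v)
    then obtain N M where "\<forall>n\<ge>N. tensor_act F G (a \<otimes> b) n u = 0"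
      "\<forall>n\<ge>M. tensor_act F G (a \<otimes> b) n v = 0" by blast
    then show ?case
      by (intro exI[of _ "max N M"])
        (simp add: clinear_add[OF cbilinear_right[OF cbilinear_tensor_act[OF V W]]])
  qed
next
  case (add t v)
  then obtain N M where "\<forall>n\<ge>N. tensor_act F G t n u = 0"
    "\<forall>n\<ge>M. tensor_act F G v n u = 0" by blast
  then show ?case
    by (intro exI[of _ "max N M"])
      (simp add: clinear_add[OF cbilinear_left[OF cbilinear_tensor_act[OF V W]]])
qed

section \<open>Products of formal distributions in two variables\<close>

text \<open>\<open>bsum \<epsilon> f p q r\<close> is the residue of
  $z_1^pz_2^q(z_1+\varepsilon z_2)^r\sum_{m,n}f_{m,n}z_1^{-m-1}z_2^{-n-1}$, expanded in $|z_1|>|z_2|$,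
  and \<open>conv\<close> multiplies two such formal distributions.\<close>

definition bsum :: "complex \<Rightarrow> (int \<Rightarrow> int \<Rightarrow> 'm::complex_vector) \<Rightarrow> int \<Rightarrow> int \<Rightarrow> int \<Rightarrow> 'm"
  where "bsum \<epsilon> f p q r =
    Sum_any (\<lambda>j::nat. (\<epsilon> ^ j * (of_int r gchoose j)) *\<^sub>C f (p + r - int j) (q + int j))"

text \<open>Modelled on the family a_(m) b_(n) x: the inner index n has a bound independent of m,
  while the bound for the outer index m depends on n. This is what makes \<open>bsum\<close> and
  \<open>conv\<close> finite sums.\<close>

definition truncated :: "(int \<Rightarrow> int \<Rightarrow> 'm::zero) \<Rightarrow> bool"
  where "truncated f \<longleftrightarrow>
    (\<exists>N. \<forall>m. \<forall>n\<ge>N. f m n = 0) \<and> (\<forall>n. \<exists>M. \<forall>m\<ge>M. f m n = 0)"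

definition conv ::
  "(int \<Rightarrow> int \<Rightarrow> 'm::complex_vector) \<Rightarrow> (int \<Rightarrow> int \<Rightarrow> 'n::complex_vector) \<Rightarrow> int \<Rightarrow> int \<Rightarrow> ('m, 'n) tensor"
  where "conv f g p q = Sum_any (\<lambda>(m, n). f m n \<otimes> g (p - 1 - m) (q - 1 - n))"

lemma bsum_eq_sum:
  assumes "\<And>m n. n \<ge> N \<Longrightarrow> f m n = 0" and "q + int K \<ge> N"
  shows "bsum \<epsilon> f p q r =
    (\<Sum>j<K. (\<epsilon> ^ j * (of_int r gchoose j)) *\<^sub>C f (p + r - int j) (q + int j))"
  unfolding bsum_def by (rule Sum_any_eq_sum_lessThan) (use assms in simp)

lemma bsum_0 [simp]: "bsum \<epsilon> f p q 0 = f p q"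
proof -
  have "bsum \<epsilon> f p q 0 = (\<Sum>j<1::nat. (\<epsilon> ^ j * (of_int 0 gchoose j)) *\<^sub>C f (p + 0 - int j) (q + int j))"
    unfolding bsum_def
  proof (rule Sum_any_eq_sum_lessThan)
    fix j :: nat assume "1 \<le> j"
    then obtain i where "j = Suc i" by (cases j) auto
    then show "(\<epsilon> ^ j * (of_int 0 gchoose j)) *\<^sub>C f (p + 0 - int j) (q + int j) = 0" by simp
  qed
  then show ?thesis by (simp add: scaleC_one)
qed

lemma bsum_shift_first: "bsum \<epsilon> (\<lambda>m n. f (m + a) n) p q r = bsum \<epsilon> f (p + a) q r"
  unfolding bsum_def by (simp add: algebra_simps)

text \<open>Multiplication by one more factor z_1 + \<epsilon> z_2; on the binomial coefficients
  this is Pascal's rule.\<close>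

lemma bsum_add_one:
  assumes "\<exists>N. \<forall>m. \<forall>n\<ge>N. f m n = 0"
  shows "bsum \<epsilon> f p q (r + 1) = bsum \<epsilon> f (p + 1) q r + \<epsilon> *\<^sub>C bsum \<epsilon> f p (q + 1) r"
proof -
  obtain N where N: "\<And>m n. n \<ge> N \<Longrightarrow> f m n = 0" using assms by blast
  define K where "K = nat (N - q)"
  have K: "q + int K \<ge> N" "q + int (Suc K) \<ge> N" "q + 1 + int K \<ge> N" by (auto simp: K_def)
  let ?t = "\<lambda>j. f (p + 1 + r - int j) (q + int j)"
  have "bsum \<epsilon> f p q (r + 1) = (\<Sum>j<Suc K. (\<epsilon> ^ j * (of_int (r + 1) gchoose j)) *\<^sub>C ?t j)"
    by (subst bsum_eq_sum[OF N K(2)]) (simp_all add: algebra_simps)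
  also have "\<dots> = ?t 0 + (\<Sum>j<K. (\<epsilon> ^ Suc j * (of_int r gchoose Suc j)) *\<^sub>C ?t (Suc j))
      + (\<Sum>j<K. (\<epsilon> ^ Suc j * (of_int r gchoose j)) *\<^sub>C ?t (Suc j))"
    by (simp only: sum.lessThan_Suc_shift of_int_add of_int_1 gbinomial_Suc_Suc)
      (simp add: scaleC_one distrib_left scaleC_add_left sum.distrib add_ac)
  also have "?t 0 + (\<Sum>j<K. (\<epsilon> ^ Suc j * (of_int r gchoose Suc j)) *\<^sub>C ?t (Suc j)) = bsum \<epsilon> f (p + 1) q r"
    by (subst bsum_eq_sum[OF N K(2)]) (simp_all only: sum.lessThan_Suc_shift, simp add: scaleC_one)
  also have "(\<Sum>j<K. (\<epsilon> ^ Suc j * (of_int r gchoose j)) *\<^sub>C ?t (Suc j)) = \<epsilon> *\<^sub>C bsum \<epsilon> f p (q + 1) r"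
    by (subst bsum_eq_sum[OF N K(3)])
      (simp_all add: cvs.scale_sum_right scaleC_scaleC mult.assoc algebra_simps)
  finally show ?thesis .
qed

lemma truncated_shift: "truncated f \<Longrightarrow> truncated (\<lambda>m n. f (m + a) (n + b))"
  unfolding truncated_def
  by (metis (no_types, lifting) add_le_cancel_right diff_add_cancel)

text \<open>For fixed q only finitely many inner indices q + j lie below N, and their outer bounds
  have a common upper bound. It concerns p + r alone, so truncation follows in p as well as in
  r.\<close>

lemma truncated_bsum_aux:
  assumes "truncated f"
  shows "\<exists>N. \<forall>q\<ge>N. \<forall>p r. bsum \<epsilon> f p q r = 0"
    and "\<exists>M. \<forall>p r. p + r \<ge> M \<longrightarrow> bsum \<epsilon> f p q r = 0"
proof -
  obtain N where N: "\<And>m n. n \<ge> N \<Longrightarrow> f m n = 0"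
    using assms unfolding truncated_def by blast
  have "bsum \<epsilon> f p q r = 0" if "q \<ge> N" for p q r
    by (subst bsum_eq_sum[OF N, where K = 0]) (use that in auto)
  then show "\<exists>N. \<forall>q\<ge>N. \<forall>p r. bsum \<epsilon> f p q r = 0" by blast
  have "\<forall>n. \<exists>M. \<forall>m\<ge>M. f m n = 0"
    using assms by (simp add: truncated_def)
  then obtain M where M: "\<And>m n. m \<ge> M n \<Longrightarrow> f m n = 0" by metis
  define K where "K = nat (N - q)"
  define B where "B = (\<Sum>j<K. \<bar>M (q + int j)\<bar>) + int K"
  have "bsum \<epsilon> f p q r = 0" if "p + r \<ge> B" for p r
  proof (subst bsum_eq_sum[OF N, where K = K])
    show "N \<le> q + int K" by (simp add: K_def)
    show "(\<Sum>j<K. (\<epsilon> ^ j * (of_int r gchoose j)) *\<^sub>C f (p + r - int j) (q + int j)) = 0"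
    proof (rule sum.neutral, rule ballI)
      fix j assume j: "j \<in> {..<K}"
      then have "\<bar>M (q + int j)\<bar> \<le> (\<Sum>j<K. \<bar>M (q + int j)\<bar>)"
        by (intro member_le_sum) auto
      with j that have "p + r - int j \<ge> M (q + int j)" by (auto simp: B_def)
      then show "(\<epsilon> ^ j * (of_int r gchoose j)) *\<^sub>C f (p + r - int j) (q + int j) = 0"
        by (simp add: M)
    qed
  qed
  then show "\<exists>M. \<forall>p r. p + r \<ge> M \<longrightarrow> bsum \<epsilon> f p q r = 0" by blast
qed

lemma truncated_bsum:
  assumes "truncated f"
  shows "truncated (\<lambda>p q. bsum \<epsilon> f p q r)" and "truncated (\<lambda>r q. bsum \<epsilon> f p q r)"
proof -
  note tr = truncated_bsum_aux[OF assms, of \<epsilon>]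
  have "\<exists>M. \<forall>p\<ge>M. bsum \<epsilon> f p q r = 0" "\<exists>M. \<forall>r\<ge>M. bsum \<epsilon> f p q r = 0" for p q r
  proof -
    obtain M where M: "\<And>p r. p + r \<ge> M \<Longrightarrow> bsum \<epsilon> f p q r = 0" using tr(2) by blast
    show "\<exists>M. \<forall>p\<ge>M. bsum \<epsilon> f p q r = 0"
      by (rule exI[of _ "M - r"]) (auto intro!: M)
    show "\<exists>M. \<forall>r\<ge>M. bsum \<epsilon> f p q r = 0"
      by (rule exI[of _ "M - p"]) (auto intro!: M)
  qed
  with tr(1) show "truncated (\<lambda>p q. bsum \<epsilon> f p q r)" "truncated (\<lambda>r q. bsum \<epsilon> f p q r)"
    unfolding truncated_def by blast+
qed

text \<open>The uniform bounds of f and g confine n to a finite window; for each such n the bounds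
  depending on n confine m.\<close>

lemma conv_finite_support:
  assumes "truncated f" "truncated g"
  shows "finite {x. f (fst x) (snd x) \<otimes> g (p - 1 - fst x) (q - 1 - snd x) \<noteq> 0}"
proof -
  obtain N where N: "\<And>m n. n \<ge> N \<Longrightarrow> f m n = 0"
    using assms unfolding truncated_def by blast
  obtain N' where N': "\<And>m n. n \<ge> N' \<Longrightarrow> g m n = 0"
    using assms unfolding truncated_def by blast
  have "\<forall>n. \<exists>M. \<forall>m\<ge>M. f m n = 0" "\<forall>n. \<exists>M. \<forall>m\<ge>M. g m n = 0"
    using assms by (simp_all add: truncated_def)
  then obtain M M' where M: "\<And>m n. m \<ge> M n \<Longrightarrow> f m n = 0" and M': "\<And>m n. m \<ge> M' n \<Longrightarrow> g m n = 0"
    by metis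
  let ?S = "SIGMA n:{q - 1 - N'<..<N}. {p - 1 - M' (q - 1 - n)<..<M n}"
  have "x \<in> prod.swap ` ?S" if "f (fst x) (snd x) \<otimes> g (p - 1 - fst x) (q - 1 - snd x) \<noteq> 0" for x
  proof -
    have "f (fst x) (snd x) \<noteq> 0" "g (p - 1 - fst x) (q - 1 - snd x) \<noteq> 0"
      using that by auto
    then have "snd x < N" "q - 1 - snd x < N'" "fst x < M (snd x)"
      "p - 1 - fst x < M' (q - 1 - snd x)"
      using N N' M M' by (meson not_le)+
    then show ?thesis
      by (cases x) (auto intro!: rev_image_eqI)
  qed
  then have "{x. f (fst x) (snd x) \<otimes> g (p - 1 - fst x) (q - 1 - snd x) \<noteq> 0} \<subseteq> prod.swap ` ?S"
    by blast
  then show ?thesis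
    by (rule finite_subset) (intro finite_imageI finite_SigmaI finite_greaterThanLessThan_int)
qed

lemma conv_add_scale_left:
  assumes "truncated f" "truncated f'" "truncated g"
  shows "conv (\<lambda>m n. f m n + s *\<^sub>C f' m n) g p q = conv f g p q + s *\<^sub>C conv f' g p q"
proof -
  let ?t = "\<lambda>f x. f (fst x) (snd x) \<otimes> g (p - 1 - fst x) (q - 1 - snd x)"
  note fin = conv_finite_support[OF assms(1,3), of p q] conv_finite_support[OF assms(2,3), of p q]
  have "s *\<^sub>C Sum_any (?t f') = Sum_any (\<lambda>x. s *\<^sub>C ?t f' x)"
    by (rule clinear_Sum_any) (use fin in \<open>auto simp: clinear_iff scaleC_add_right cvs.scale_left_commute\<close>)
  moreover have "Sum_any (\<lambda>x. ?t f x + s *\<^sub>C ?t f' x) = Sum_any (?t f) + Sum_any (\<lambda>x. s *\<^sub>C ?t f' x)"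
    by (rule Sum_any.distrib) (use fin in \<open>auto elim: rev_finite_subset\<close>)
  ultimately show ?thesis
    by (simp add: conv_def case_prod_unfold tens_add_left tens_scale_left)
qed

lemma conv_add_scale_right:
  assumes "truncated f" "truncated g" "truncated g'"
  shows "conv f (\<lambda>m n. g m n + s *\<^sub>C g' m n) p q = conv f g p q + s *\<^sub>C conv f g' p q"
proof -
  let ?t = "\<lambda>g x. f (fst x) (snd x) \<otimes> g (p - 1 - fst x) (q - 1 - snd x)"
  note fin = conv_finite_support[OF assms(1,2), of p q] conv_finite_support[OF assms(1,3), of p q]
  have "s *\<^sub>C Sum_any (?t g') = Sum_any (\<lambda>x. s *\<^sub>C ?t g' x)"
    by (rule clinear_Sum_any) (use fin in \<open>auto simp: clinear_iff scaleC_add_right cvs.scale_left_commute\<close>)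
  moreover have "Sum_any (\<lambda>x. ?t g x + s *\<^sub>C ?t g' x) = Sum_any (?t g) + Sum_any (\<lambda>x. s *\<^sub>C ?t g' x)"
    by (rule Sum_any.distrib) (use fin in \<open>auto elim: rev_finite_subset\<close>)
  ultimately show ?thesis
    by (simp add: conv_def case_prod_unfold tens_add_right tens_scale_right)
qed

lemma conv_shift:
  "conv (\<lambda>m n. f (m + a) (n + b)) (\<lambda>m n. g (m + a') (n + b')) p q = conv f g (p + a + a') (q + b + b')"
proof -
  have "bij (\<lambda>(m, n). (m + a, n + b))"
    by (rule o_bij[where g = "\<lambda>(m, n). (m - a, n - b)"]) auto
  from Sum_any_reindex[OF this,
      of "\<lambda>(m, n). f m n \<otimes> g (p + a + a' - 1 - m) (q + b + b' - 1 - n)"]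
  show ?thesis
    by (simp add: conv_def case_prod_unfold algebra_simps)
qed

lemma conv_swap: "conv (\<lambda>m n. f n m) (\<lambda>m n. g n m) p q = conv f g q p"
proof -
  have "bij (prod.swap :: int \<times> int \<Rightarrow> _)" by simp
  from Sum_any_reindex[OF this, of "\<lambda>(m, n). f m n \<otimes> g (q - 1 - m) (p - 1 - n)"]
  show ?thesis by (simp add: conv_def case_prod_unfold)
qed

lemma conv_truncated_second:
  assumes "\<And>m n. n \<ge> N \<Longrightarrow> f m n = 0" "\<And>m n. n \<ge> N' \<Longrightarrow> g m n = 0" "q \<ge> N + N'"
  shows "conv f g p q = 0"
proof -
  have "f m n \<otimes> g (p - 1 - m) (q - 1 - n) = 0" for m n
    using assms(1)[of n m] assms(2)[of "q - 1 - n" "p - 1 - m"] assms(3) by (cases "n \<ge> N") auto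
  then show ?thesis by (simp add: conv_def)
qed

lemma truncated_conv_second:
  assumes "truncated f" "truncated g"
  shows "\<exists>N. \<forall>p. \<forall>q\<ge>N. conv f g p q = 0"
proof -
  obtain N where N: "\<And>m n. n \<ge> N \<Longrightarrow> f m n = 0"
    using assms unfolding truncated_def by blast
  obtain N' where N': "\<And>m n. n \<ge> N' \<Longrightarrow> g m n = 0"
    using assms unfolding truncated_def by blast
  show ?thesis using conv_truncated_second[of N f N' g] N N' by blast
qed

text \<open>Each factor absorbs its own power of $z_1+\varepsilon z_2$.\<close>

lemma bsum_conv:
  assumes f: "truncated f" and g: "truncated g"
  shows "bsum \<epsilon> (conv f g) p q (int r + int s) =
    conv (\<lambda>m n. bsum \<epsilon> f m n (int r)) (\<lambda>m n. bsum \<epsilon> g m n (int s)) p q"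
proof -
  note cut = truncated_conv_second[OF f g]
  have 1: "\<exists>N. \<forall>m. \<forall>n\<ge>N. f m n = 0" "\<exists>N. \<forall>m. \<forall>n\<ge>N. g m n = 0"
    using f g by (simp_all add: truncated_def)
  have base: "bsum \<epsilon> (conv f g) p q (int r) = conv (\<lambda>m n. bsum \<epsilon> f m n (int r)) g p q" for r p q
  proof (induction r arbitrary: p q)
    case (Suc r)
    let ?F = "\<lambda>m n. bsum \<epsilon> f m n (int r)"
    have t: "truncated (\<lambda>m n. ?F (m + 1) n)" "truncated (\<lambda>m n. ?F m (n + 1))"
      using truncated_shift[of ?F 1 0, OF truncated_bsum(1)[OF f]]
        truncated_shift[of ?F 0 1, OF truncated_bsum(1)[OF f]] by simp_all
    have "bsum \<epsilon> (conv f g) p q (int (Suc r)) = conv ?F g (p + 1) q + \<epsilon> *\<^sub>C conv ?F g p (q + 1)"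
      using bsum_add_one[OF cut, of \<epsilon> p q "int r"] by (simp add: Suc.IH add.commute)
    also have "\<dots> = conv (\<lambda>m n. ?F (m + 1) n + \<epsilon> *\<^sub>C ?F m (n + 1)) g p q"
      using conv_add_scale_left[OF t g, of \<epsilon> p q] conv_shift[of ?F 1 0 g 0 0 p q] conv_shift[of ?F 0 1 g 0 0 p q]
      by simp
    also have "\<dots> = conv (\<lambda>m n. bsum \<epsilon> f m n (int (Suc r))) g p q"
      using bsum_add_one[OF 1(1), of \<epsilon> _ _ "int r"] by (simp add: add.commute)
    finally show ?case .
  qed simp
  show ?thesis
  proof (induction s arbitrary: p q)
    case 0
    show ?case by (simp add: base)
  next
    case (Suc s)
    let ?F = "\<lambda>m n. bsum \<epsilon> f m n (int r)" and ?G = "\<lambda>m n. bsum \<epsilon> g m n (int s)"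
    have t: "truncated ?F" "truncated (\<lambda>m n. ?G (m + 1) n)" "truncated (\<lambda>m n. ?G m (n + 1))"
      using truncated_bsum(1)[OF f] truncated_shift[of ?G 1 0, OF truncated_bsum(1)[OF g]]
        truncated_shift[of ?G 0 1, OF truncated_bsum(1)[OF g]] by simp_all
    have "bsum \<epsilon> (conv f g) p q (int r + int (Suc s)) = conv ?F ?G (p + 1) q + \<epsilon> *\<^sub>C conv ?F ?G p (q + 1)"
      using bsum_add_one[OF cut, of \<epsilon> p q "int r + int s"] by (simp add: Suc.IH add_ac)
    also have "\<dots> = conv ?F (\<lambda>m n. ?G (m + 1) n + \<epsilon> *\<^sub>C ?G m (n + 1)) p q"
      using conv_add_scale_right[OF t, of \<epsilon> p q] conv_shift[of ?F 0 0 ?G 1 0 p q] conv_shift[of ?F 0 0 ?G 0 1 p q]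
      by simp
    also have "\<dots> = conv ?F (\<lambda>m n. bsum \<epsilon> g m n (int (Suc s))) p q"
      using bsum_add_one[OF 1(2), of \<epsilon> _ _ "int s"] by (simp add: add.commute)
    finally show ?case .
  qed
qed

text \<open>Negating the upper indices removes the summation index from them: they become -m - 1 and
  m + l - r, with sum l - r - 1. Vandermonde's identity applies, and a last negation returns
  r.\<close>

lemma gbinomial_Vandermonde_shifted:
  "(\<Sum>i\<le>l. (of_int (m + int i) gchoose i) * (of_int (r - 1 - m - int i) gchoose (l - i))) =
    (of_int r gchoose l :: complex)"
proof -
  let ?m = "of_int m :: complex" and ?r = "of_int r :: complex"
  have "(of_int (m + int i) gchoose i) * (of_int (r - 1 - m - int i) gchoose (l - i)) =
      (-1) ^ l * ((- ?m - 1 gchoose i) * (?m + of_nat l - ?r gchoose (l - i)))" if "i \<le> l" for i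
  proof -
    have "(of_int (m + int i) gchoose i) = (-1) ^ i * (- ?m - 1 gchoose i)"
      by (subst gbinomial_negated_upper) simp
    moreover have "(of_int (r - 1 - m - int i) gchoose (l - i)) = (-1) ^ (l - i) * (?m + of_nat l - ?r gchoose (l - i))"
      by (subst gbinomial_negated_upper) (use that in \<open>simp add: of_nat_diff algebra_simps\<close>)
    moreover have "(-1 :: complex) ^ l = (-1) ^ i * (-1) ^ (l - i)"
      using that by (simp flip: power_add)
    ultimately show ?thesis by simp
  qed
  then have "(\<Sum>i\<le>l. (of_int (m + int i) gchoose i) * (of_int (r - 1 - m - int i) gchoose (l - i))) =
    (-1) ^ l * (\<Sum>i=0..l. (- ?m - 1 gchoose i) * (?m + of_nat l - ?r gchoose (l - i)))"
    by (simp add: sum_distrib_left atMost_atLeast0)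
  also have "\<dots> = (-1) ^ l * (of_nat l - ?r - 1 gchoose l)"
    by (simp add: gbinomial_Vandermonde algebra_simps)
  also have "\<dots> = (?r gchoose l)"
    by (subst (2) gbinomial_negated_upper) simp
  finally show ?thesis .
qed

lemma tens_sum: "sum f A \<otimes> sum g B = (\<Sum>i\<in>A. \<Sum>j\<in>B. f i \<otimes> g j)"
  by (subst clinear_sum[OF clinear_tens_left], subst clinear_sum[OF clinear_tens_right]) (rule refl)

lemma Sum_any_sum:
  assumes "finite A" and "\<And>i. i \<in> A \<Longrightarrow> finite {x. t i x \<noteq> 0}"
  shows "Sum_any (\<lambda>x. \<Sum>i\<in>A. t i x) = (\<Sum>i\<in>A. Sum_any (t i))"
  using assms
proof (induction A rule: finite_induct)
  case (insert a A)
  have "finite {x. (\<Sum>i\<in>A. t i x) \<noteq> 0}"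
    by (rule finite_subset[of _ "\<Union>i\<in>A. {x. t i x \<noteq> 0}"])
      (use insert in \<open>auto elim: sum.not_neutral_contains_not_neutral\<close>)
  with insert show ?case by (simp add: Sum_any.distrib)
qed simp

text \<open>Both factors are rewritten in the variables $z_0=z_1+\varepsilon z_2$ and $z_2$, which is
  multiplicative. Comparing coefficients amounts to Vandermonde's identity.\<close>

lemma conv_bsum_substitution:
  assumes f: "truncated f" and g: "truncated g"
  shows "conv (\<lambda>s n. bsum \<epsilon> f 0 n s) (\<lambda>s n. bsum \<epsilon> g 0 n s) r q = bsum \<epsilon> (conv f g) 0 q r"
proof -
  obtain N where N: "\<And>m n. n \<ge> N \<Longrightarrow> f m n = 0"
    using f unfolding truncated_def by blast
  obtain N' where N': "\<And>m n. n \<ge> N' \<Longrightarrow> g m n = 0"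
    using g unfolding truncated_def by blast
  \<comment> \<open>One cutoff for all expansions: if n < N and q - 1 - n < N', then raising either
    second index by L, or one of them by i + j \<ge> L, passes its bound.\<close>
  define L where "L = nat (N + N' - q + 1)"
  define C where "C s i = \<epsilon> ^ i * (of_int s gchoose i)" for s i
  \<comment> \<open>\<open>t i j\<close> is a term of the product of the two expanded factors.
    Renaming the indices so that f carries (m, n) turns it into \<open>u i j\<close>, where the
    f-factor no longer depends on i and j.\<close>
  define t where "t i j s n = (C s i * C (r - 1 - s) j) *\<^sub>C
    (f (s - int i) (n + int i) \<otimes> g (r - 1 - s - int j) (q - 1 - n + int j))" for i j s n
  define u where "u i j m n = (C (m + int i) i * C (r - 1 - m - int i) j) *\<^sub>C
    (f m n \<otimes> g (r - 1 - m - int i - int j) (q - 1 - n + int i + int j))" for i j m n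
  have fin_t: "finite {x. (case x of (s, n) \<Rightarrow> t i j s n) \<noteq> 0}" for i j
    using conv_finite_support[OF truncated_shift[OF f, of "- int i" "int i"]
        truncated_shift[OF g, of "- int j" "int j"], of r q]
    by (rule rev_finite_subset) (auto simp: t_def)
  have fin_u: "finite {x. (case x of (m, n) \<Rightarrow> u i j m n) \<noteq> 0}" for i j
    using conv_finite_support[OF f g, of "r - int i - int j" "q + int i + int j"]
    by (rule rev_finite_subset) (auto simp: u_def algebra_simps)
  have reindex: "Sum_any (\<lambda>(s, n). t i j s n) = Sum_any (\<lambda>(m, n). u i j m n)" for i j
  proof -
    have "bij (\<lambda>(m, n). (m + int i, n - int i))"
      by (rule o_bij[where g = "\<lambda>(m, n). (m - int i, n + int i)"]) auto
    from Sum_any_reindex[OF this, of "\<lambda>(s, n). t i j s n"] show ?thesis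
      by (simp add: case_prod_unfold t_def u_def algebra_simps)
  qed
  have expand: "bsum \<epsilon> f 0 n s \<otimes> bsum \<epsilon> g 0 (q - 1 - n) (r - 1 - s) = (\<Sum>i<L. \<Sum>j<L. t i j s n)" for s n
  proof -
    consider "n \<ge> N" | "q - 1 - n \<ge> N'" | "n < N" "q - 1 - n < N'" by linarith
    then show ?thesis
    proof cases
      case 1
      then show ?thesis using bsum_eq_sum[of N f n 0 \<epsilon> 0 s] by (simp add: N t_def)
    next
      case 2
      then show ?thesis
        using bsum_eq_sum[of N' g "q - 1 - n" 0 \<epsilon> 0 "r - 1 - s"] by (simp add: N' t_def)
    next
      case 3
      then have L: "n + int L \<ge> N" "q - 1 - n + int L \<ge> N'" by (auto simp: L_def)
      show ?thesis
        by (subst bsum_eq_sum[OF N L(1)], simp, subst bsum_eq_sum[OF N' L(2)], simp)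
          (simp add: tens_sum tens_scale_left tens_scale_right scaleC_scaleC t_def C_def mult_ac)
    qed
  qed
  \<comment> \<open>The tensor in \<open>u i j m n\<close> depends only on l = i + j. The terms with
    l \<ge> L vanish, so the square of indices may be replaced by a triangle and summed along its
    diagonals.\<close>
  have collapse: "(\<Sum>i<L. \<Sum>j<L. u i j m n) =
    (\<Sum>l<L. C r l *\<^sub>C (f m n \<otimes> g (r - int l - 1 - m) (q + int l - 1 - n)))" for m n
  proof -
    have zero: "u i j m n = 0" if "i + j \<ge> L" for i j
    proof (cases "n \<ge> N")
      case False
      with that have "q - 1 - n + int i + int j \<ge> N'" by (auto simp: L_def)
      then show ?thesis by (simp add: u_def N')
    qed (simp add: u_def N)
    have "(\<Sum>i<L. \<Sum>j<L. u i j m n) = (\<Sum>(i, j)\<in>{..<L} \<times> {..<L}. u i j m n)"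
      by (simp add: sum.cartesian_product)
    also have "\<dots> = (\<Sum>(i, j)\<in>{(i, j). i + j < L}. u i j m n)"
      by (rule sum.mono_neutral_right) (use zero in \<open>auto simp: not_less[symmetric]\<close>)
    also have "\<dots> = (\<Sum>l<L. \<Sum>i\<le>l. u i (l - i) m n)"
      by (rule sum.triangle_reindex)
    also have "\<dots> = (\<Sum>l<L. C r l *\<^sub>C (f m n \<otimes> g (r - int l - 1 - m) (q + int l - 1 - n)))"
    proof (rule sum.cong[OF refl])
      fix l
      let ?v = "f m n \<otimes> g (r - int l - 1 - m) (q + int l - 1 - n)"
      have "u i (l - i) m n = (\<epsilon> ^ l * ((of_int (m + int i) gchoose i) *
          (of_int (r - 1 - m - int i) gchoose (l - i)))) *\<^sub>C ?v" if "i \<le> l" for i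
      proof -
        have "\<epsilon> ^ l = \<epsilon> ^ i * \<epsilon> ^ (l - i)"
          using that by (simp flip: power_add)
        then show ?thesis
          using that by (simp add: u_def C_def of_nat_diff algebra_simps)
      qed
      then have "(\<Sum>i\<le>l. u i (l - i) m n) = (\<epsilon> ^ l * (\<Sum>i\<le>l. (of_int (m + int i) gchoose i) *
          (of_int (r - 1 - m - int i) gchoose (l - i)))) *\<^sub>C ?v"
        unfolding cvs.scale_sum_left sum_distrib_left by (intro sum.cong[OF refl]) simp
      then show "(\<Sum>i\<le>l. u i (l - i) m n) = C r l *\<^sub>C ?v"
        unfolding gbinomial_Vandermonde_shifted by (simp add: C_def)
    qed
    finally show ?thesis .
  qed
  have "conv (\<lambda>s n. bsum \<epsilon> f 0 n s) (\<lambda>s n. bsum \<epsilon> g 0 n s) r q =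
      Sum_any (\<lambda>x. \<Sum>i<L. \<Sum>j<L. case x of (s, n) \<Rightarrow> t i j s n)"
    unfolding conv_def by (rule Sum_any.cong) (simp add: case_prod_unfold expand)
  also have "\<dots> = Sum_any (\<lambda>x. \<Sum>(i, j)\<in>{..<L} \<times> {..<L}. case x of (s, n) \<Rightarrow> t i j s n)"
    by (simp add: sum.cartesian_product)
  also have "\<dots> = (\<Sum>(i, j)\<in>{..<L} \<times> {..<L}. Sum_any (\<lambda>(s, n). t i j s n))"
    by (subst Sum_any_sum) (use fin_t in \<open>auto simp: case_prod_unfold\<close>)
  also have "\<dots> = (\<Sum>(i, j)\<in>{..<L} \<times> {..<L}. Sum_any (\<lambda>(m, n). u i j m n))"
    by (simp only: reindex)
  also have "\<dots> = Sum_any (\<lambda>x. \<Sum>(i, j)\<in>{..<L} \<times> {..<L}. case x of (m, n) \<Rightarrow> u i j m n)"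
    by (subst Sum_any_sum) (use fin_u in \<open>auto simp: case_prod_unfold\<close>)
  also have "\<dots> = Sum_any (\<lambda>x. \<Sum>l<L. C r l *\<^sub>C (case x of (m, n) \<Rightarrow>
      f m n \<otimes> g (r - int l - 1 - m) (q + int l - 1 - n)))"
    by (rule Sum_any.cong) (simp add: case_prod_unfold
        collapse[unfolded sum.cartesian_product case_prod_unfold])
  also have "\<dots> = (\<Sum>l<L. Sum_any (\<lambda>x. C r l *\<^sub>C (case x of (m, n) \<Rightarrow>
      f m n \<otimes> g (r - int l - 1 - m) (q + int l - 1 - n))))"
    by (rule Sum_any_sum, simp, rule rev_finite_subset[OF conv_finite_support[OF f g]]) auto
  also have "\<dots> = (\<Sum>l<L. C r l *\<^sub>C conv f g (r - int l) (q + int l))"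
  proof (rule sum.cong[OF refl])
    fix l
    show "Sum_any (\<lambda>x. C r l *\<^sub>C (case x of (m, n) \<Rightarrow>
        f m n \<otimes> g (r - int l - 1 - m) (q + int l - 1 - n))) = C r l *\<^sub>C conv f g (r - int l) (q + int l)"
      unfolding conv_def
      by (rule clinear_Sum_any[symmetric])
        (use conv_finite_support[OF f g, of "r - int l" "q + int l"] in
          \<open>auto simp: clinear_iff scaleC_add_right cvs.scale_left_commute case_prod_unfold\<close>)
  qed
  also have "\<dots> = bsum \<epsilon> (conv f g) 0 q r"
    by (subst bsum_eq_sum[where N = "N + N'" and K = L])
      (auto simp: C_def L_def intro: conv_truncated_second[of N f N' g] N N')
  finally show ?thesis .
qed

section \<open>Tensor products of modules over vertex algebras\<close>

text \<open>Only linearity and truncation are assumed, no identity between modes. The locale can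
  therefore be instantiated for a tensor product before the Borcherds identity is known
  there.\<close>

locale va_fields =
  fixes np :: "'a::complex_vector \<Rightarrow> int \<Rightarrow> 'a \<Rightarrow> 'a"
    and act :: "'a \<Rightarrow> int \<Rightarrow> 'm \<Rightarrow> 'm::complex_vector"
  assumes np_bilinear: "cbilinear (\<lambda>a. np a n)"
    and act_bilinear: "cbilinear (\<lambda>a. act a n)"
    and np_truncation: "\<exists>N. \<forall>n\<ge>N. np a n b = 0"
    and act_truncation: "\<exists>N. \<forall>n\<ge>N. act a n x = 0"
begin

lemmas act_left = cbilinear_left[OF act_bilinear]
  and act_right = cbilinear_right[OF act_bilinear]
  and np_left = cbilinear_left[OF np_bilinear]
  and np_right = cbilinear_right[OF np_bilinear]

text \<open>The difference of the two sides of the Borcherds identity. It satisfies a linear recursion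
  that propagates its vanishing from large \<open>r\<close> (locality) and large \<open>p\<close> (weak associativity) to
  all indices.\<close>

definition defect :: "'a \<Rightarrow> 'a \<Rightarrow> 'm \<Rightarrow> int \<Rightarrow> int \<Rightarrow> int \<Rightarrow> 'm"
  where "defect a b x p q r =
    bsum 1 (\<lambda>n s. act (np a s b) n x) q r p - bsum (-1) (\<lambda>m n. act a m (act b n x)) p q r
      + (-1) powi r *\<^sub>C bsum (-1) (\<lambda>m n. act b m (act a n x)) q p r"

lemma truncated_comp: "truncated (\<lambda>m n. act a m (act b n x))"
proof -
  obtain N where "\<forall>n\<ge>N. act b n x = 0" using act_truncation by blast
  then have "\<forall>m. \<forall>n\<ge>N. act a m (act b n x) = 0"
    by (simp add: clinear_zero[OF act_right])
  then show ?thesis unfolding truncated_def using act_truncation by blast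
qed

lemma truncated_iterate: "truncated (\<lambda>n s. act (np a s b) n x)"
proof -
  obtain N where "\<forall>n\<ge>N. np a n b = 0" using np_truncation by blast
  then have "\<forall>m. \<forall>n\<ge>N. act (np a n b) m x = 0"
    by (simp add: clinear_zero[OF act_left])
  then show ?thesis unfolding truncated_def using act_truncation by blast
qed

lemma bsum_finite_support:
  fixes f :: "int \<Rightarrow> int \<Rightarrow> 'n::complex_vector"
  assumes "truncated f"
  shows "finite {j::nat. (\<epsilon> ^ j * (of_int r gchoose j)) *\<^sub>C f (p + r - int j) (q + int j) \<noteq> 0}"
proof -
  obtain N where N: "\<And>m n. n \<ge> N \<Longrightarrow> f m n = 0"
    using assms unfolding truncated_def by blast
  have "(\<epsilon> ^ j * (of_int r gchoose j)) *\<^sub>C f (p + r - int j) (q + int j) = 0" if "\<not> j < nat (N - q)" for j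
    using that N[of "q + int j" "p + r - int j"] by simp
  then show ?thesis
    by (intro finite_subset[OF _ finite_lessThan[of "nat (N - q)"]]) blast
qed

lemma defect_eq_0_iff:
  "defect a b x p q r = 0 \<longleftrightarrow>
    Sum_any (\<lambda>j::nat. ((of_int p :: complex) gchoose j) *\<^sub>C act (np a (r + int j) b) (p + q - int j) x) =
      Sum_any (\<lambda>j::nat. ((-1) ^ j * ((of_int r :: complex) gchoose j)) *\<^sub>C
        (act a (p + r - int j) (act b (q + int j) x)
          - ((-1) powi r) *\<^sub>C act b (q + r - int j) (act a (p + int j) x)))"
proof -
  let ?c = "\<lambda>j. (-1) ^ j * ((of_int r :: complex) gchoose j)"
  let ?A = "\<lambda>j. ?c j *\<^sub>C act a (p + r - int j) (act b (q + int j) x)"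
  let ?B = "\<lambda>j. ?c j *\<^sub>C act b (q + r - int j) (act a (p + int j) x)"
  note fin = bsum_finite_support[OF truncated_comp, of "-1" r a p b q x]
    bsum_finite_support[OF truncated_comp, of "-1" r b q a p x]
  have scale: "(- ((-1) powi r)) *\<^sub>C Sum_any ?B = Sum_any (\<lambda>j. (- ((-1) powi r)) *\<^sub>C ?B j)"
    by (rule clinear_Sum_any[OF _ fin(2)])
      (auto simp: clinear_iff scaleC_add_right cvs.scale_left_commute)
  have "Sum_any (\<lambda>j. ?c j *\<^sub>C (act a (p + r - int j) (act b (q + int j) x)
          - ((-1) powi r) *\<^sub>C act b (q + r - int j) (act a (p + int j) x))) =
      Sum_any (\<lambda>j. ?A j + (- ((-1) powi r)) *\<^sub>C ?B j)"
    by (simp add: cvs.scale_right_diff_distrib cvs.scale_minus_left mult_ac)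
  also have "\<dots> = Sum_any ?A + Sum_any (\<lambda>j. (- ((-1) powi r)) *\<^sub>C ?B j)"
    by (rule Sum_any.distrib[OF fin(1)]) (rule rev_finite_subset[OF fin(2)], auto)
  also have "\<dots> = Sum_any ?A - (-1) powi r *\<^sub>C Sum_any ?B"
    unfolding scale[symmetric] by (simp add: cvs.scale_minus_left)
  finally have rhs: "Sum_any (\<lambda>j. ?c j *\<^sub>C (act a (p + r - int j) (act b (q + int j) x)
          - ((-1) powi r) *\<^sub>C act b (q + r - int j) (act a (p + int j) x))) =
      Sum_any ?A - (-1) powi r *\<^sub>C Sum_any ?B" .
  have "defect a b x p q r = Sum_any (\<lambda>j::nat. ((of_int p :: complex) gchoose j) *\<^sub>C
      act (np a (r + int j) b) (p + q - int j) x) - (Sum_any ?A - (-1) powi r *\<^sub>C Sum_any ?B)"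
    by (simp add: defect_def bsum_def add.commute[of q p])
  then show ?thesis
    by (simp only: rhs right_minus_eq)
qed

text \<open>This is z_1 = z_2 + (z_1 - z_2), used in each of the three expansions of z_1^p z_2^q
  (z_1 - z_2)^r.\<close>

lemma defect_recursion:
  "defect a b x (p + 1) q r = defect a b x p (q + 1) r + defect a b x p q (r + 1)"
proof -
  let ?f = "\<lambda>m n. act a m (act b n x)" and ?g = "\<lambda>m n. act b m (act a n x)"
  have "bsum 1 (\<lambda>n s. act (np a s b) n x) q r (p + 1) =
      bsum 1 (\<lambda>n s. act (np a s b) n x) (q + 1) r p + bsum 1 (\<lambda>n s. act (np a s b) n x) q (r + 1) p"
    using bsum_add_one[of "\<lambda>n s. act (np a s b) n x" 1] truncated_iterate[of a b x]
    by (simp add: truncated_def scaleC_one)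
  moreover have "bsum (-1) ?f p q (r + 1) = bsum (-1) ?f (p + 1) q r - bsum (-1) ?f p (q + 1) r"
    using bsum_add_one[of ?f "-1"] truncated_comp[of a b x]
    by (simp add: truncated_def scaleC_one cvs.scale_minus_left)
  moreover have "bsum (-1) ?g q p (r + 1) = bsum (-1) ?g (q + 1) p r - bsum (-1) ?g q (p + 1) r"
    using bsum_add_one[of ?g "-1"] truncated_comp[of b a x]
    by (simp add: truncated_def scaleC_one cvs.scale_minus_left)
  moreover have "(-1 :: complex) powi (r + 1) = - ((-1) powi r)"
    by (simp add: power_int_add)
  ultimately show ?thesis
    by (simp add: defect_def cvs.scale_minus_left cvs.scale_right_diff_distrib)
qed

text \<open>Downward induction on r: where the defect vanishes at r + 1, the recursion makes it at r
  constant along (p, q), (p + 1, q - 1), and so on, and increasing p reaches the range of weak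
  associativity.\<close>

lemma defect_eq_0I:
  assumes locality: "\<And>p q r. r \<ge> r\<^sub>0 \<Longrightarrow> defect a b x p q r = 0"
    and associativity: "\<And>p q r. p \<ge> p\<^sub>0 \<Longrightarrow> defect a b x p q r = 0"
  shows "defect a b x p q r = 0"
proof -
  have "\<forall>p q. defect a b x p q (r\<^sub>0 - int k) = 0" for k
  proof (induction k)
    case (Suc k)
    have step: "defect a b x p q (r\<^sub>0 - int (Suc k)) = defect a b x (p + 1) (q - 1) (r\<^sub>0 - int (Suc k))" for p q
      using defect_recursion[of a b x p "q - 1" "r\<^sub>0 - int (Suc k)"] Suc by simp
    have "defect a b x p q (r\<^sub>0 - int (Suc k)) = defect a b x (p + int n) (q - int n) (r\<^sub>0 - int (Suc k))" for n p q
    proof (induction n arbitrary: p q)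
      case (Suc n)
      show ?case
        by (subst step, subst Suc.IH) (simp add: algebra_simps)
    qed simp
    from this[of _ _ "nat (p\<^sub>0 - p)" for p] show ?case
      by (metis associativity add.commute diff_le_eq int_nat_eq nle_le diff_add_cancel le_add_same_cancel2)
  qed (use locality in simp)
  from this[of "nat (r\<^sub>0 - r)"] locality[of r] show ?thesis
    by (cases "r \<ge> r\<^sub>0") simp_all
qed

text \<open>Additivity in all three arguments reduces the Borcherds identity on a tensor product to
  pure tensors.\<close>

lemma defect_add:
  "defect (a + a') b x p q r = defect a b x p q r + defect a' b x p q r"
  "defect a (b + b') x p q r = defect a b x p q r + defect a b' x p q r"
  "defect a b (x + x') p q r = defect a b x p q r + defect a b x' p q r"
proof -
  note lin = act_left[THEN clinear_add] act_right[THEN clinear_add]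
    np_left[THEN clinear_add] np_right[THEN clinear_add]
  have add: "bsum \<epsilon> (\<lambda>m n. f m n + g m n) p q r = bsum \<epsilon> f p q r + bsum \<epsilon> g p q r"
    if "truncated f" "truncated g" for \<epsilon> p q r and f g :: "int \<Rightarrow> int \<Rightarrow> 'm"
    unfolding bsum_def scaleC_add_right
    by (rule Sum_any.distrib) (intro bsum_finite_support that)+
  note truncated_iterate truncated_comp
  then show "defect (a + a') b x p q r = defect a b x p q r + defect a' b x p q r"
    "defect a (b + b') x p q r = defect a b x p q r + defect a b' x p q r"
    "defect a b (x + x') p q r = defect a b x p q r + defect a b x' p q r"
    by (simp_all add: defect_def lin add scaleC_add_right)
qed

end

lemma va_fields_module:
  assumes "va_module V (nprod V)" "va_module V act"
  shows "va_fields (nprod V) act"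
  using assms by (simp add: va_fields_def va_module_def)

lemma va_module_iff_defect:
  assumes "va_fields (nprod V) act"
  shows "va_module V act \<longleftrightarrow>
    (\<forall>n x. act (vacuum V) n x = (if n = -1 then x else 0)) \<and>
    (\<forall>a b x p q r. va_fields.defect (nprod V) act a b x p q r = 0)"
proof -
  interpret va_fields "nprod V" act by fact
  show ?thesis
    unfolding va_module_def defect_eq_0_iff
    using act_bilinear act_truncation by blast
qed

lemma conv_scale:
  assumes "truncated f" "truncated g"
  shows "conv (\<lambda>m n. s *\<^sub>C f m n) (\<lambda>m n. t *\<^sub>C g m n) p q = (s * t) *\<^sub>C conv f g p q"
proof -
  have "(s * t) *\<^sub>C conv f g p q = Sum_any (\<lambda>x. (s * t) *\<^sub>C (case x of (m, n) \<Rightarrow> f m n \<otimes> g (p - 1 - m) (q - 1 - n)))"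
    unfolding conv_def
    by (rule clinear_Sum_any)
      (use conv_finite_support[OF assms, of p q] in
        \<open>auto simp: clinear_iff scaleC_add_right cvs.scale_left_commute case_prod_unfold\<close>)
  then show ?thesis
    by (simp add: conv_def case_prod_unfold tens_scale_left tens_scale_right scaleC_scaleC mult.commute)
qed

text \<open>Locality: once r has passed the truncation bound of a_(r) b, the iterate drops out of
  the Borcherds identity.\<close>

lemma (in va_fields) borcherds_large_r:
  assumes "\<And>a b x p q r. defect a b x p q r = 0"
  obtains R :: nat where "\<And>p q r. r \<ge> int R \<Longrightarrow>
    bsum (-1) (\<lambda>m n. act a m (act b n x)) p q r = (-1) powi r *\<^sub>C bsum (-1) (\<lambda>m n. act b m (act a n x)) q p r"
proof -
  obtain N where N: "\<And>s. s \<ge> N \<Longrightarrow> np a s b = 0" using np_truncation by blast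
  show ?thesis
  proof
    fix p q r assume "r \<ge> int (nat N)"
    then have "r \<ge> N" by linarith
    then have "bsum 1 (\<lambda>n s. act (np a s b) n x) q r p = 0"
      by (subst bsum_eq_sum[where N = N and K = 0]) (auto simp: N nat_le_iff clinear_zero[OF act_left])
    with assms[of a b x p q r] show "bsum (-1) (\<lambda>m n. act a m (act b n x)) p q r =
        (-1) powi r *\<^sub>C bsum (-1) (\<lambda>m n. act b m (act a n x)) q p r"
      by (simp add: defect_def)
  qed
qed

text \<open>Weak associativity: once p has passed the truncation bound of a_(p) x, the term in which
  a acts first drops out.\<close>

lemma (in va_fields) borcherds_large_p:
  assumes "\<And>a b x p q r. defect a b x p q r = 0"
  obtains R :: nat where "\<And>p q r. p \<ge> int R \<Longrightarrow>
    bsum 1 (\<lambda>n s. act (np a s b) n x) q r p = bsum (-1) (\<lambda>m n. act a m (act b n x)) p q r"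
proof -
  obtain N where N: "\<And>s. s \<ge> N \<Longrightarrow> act a s x = 0" using act_truncation by blast
  show ?thesis
  proof
    fix p q r assume "p \<ge> int (nat N)"
    then have "p \<ge> N" by linarith
    then have "bsum (-1) (\<lambda>m n. act b m (act a n x)) q p r = 0"
      by (subst bsum_eq_sum[where N = N and K = 0]) (auto simp: N nat_le_iff clinear_zero[OF act_right])
    with assms[of a b x p q r] show "bsum 1 (\<lambda>n s. act (np a s b) n x) q r p =
        bsum (-1) (\<lambda>m n. act a m (act b n x)) p q r"
      by (simp add: defect_def)
  qed
qed

section \<open>Composites and iterates of pure tensors as products of formal distributions\<close>

lemma conv_iterated:
  assumes "truncated f" "truncated g"
  shows "conv f g p q = Sum_any (\<lambda>n. Sum_any (\<lambda>m. f m n \<otimes> g (p - m - 1) (q - n - 1)))"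
proof -
  let ?h = "\<lambda>m n. f m n \<otimes> g (p - 1 - m) (q - 1 - n)"
  have "finite {x. ?h (snd x) (fst x) \<noteq> 0}"
    using finite_vimageI[OF conv_finite_support[OF assms, of p q] inj_swap]
    by (simp add: vimage_def)
  from Sum_any_pair[OF this] conv_swap[of f g q p, symmetric] show ?thesis
    by (simp add: conv_def case_prod_unfold algebra_simps)
qed

lemma tensor_act_comp_tens:
  assumes V: "va_module V F" and W: "va_module W G"
    and "va_module V (nprod V)" "va_module W (nprod W)"
  shows "tensor_act F G (a \<otimes> a') m (tensor_act F G (b \<otimes> b') n (x \<otimes> x')) =
    conv (\<lambda>m n. F a m (F b n x)) (\<lambda>m n. G a' m (G b' n x')) m n"
proof -
  interpret F: va_fields "nprod V" F using assms by (intro va_fields_module)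
  interpret G: va_fields "nprod W" G using assms by (intro va_fields_module)
  note lin = cbilinear_right[OF cbilinear_tensor_act[OF V W]]
  show ?thesis
    by (simp only: conv_iterated[OF F.truncated_comp G.truncated_comp] tensor_act_tens[OF V W]
        clinear_Sum_any[OF lin tensor_act_finite_support[OF V W]])
qed

lemma tensor_act_iterate_tens:
  assumes V: "va_module V F" and W: "va_module W G"
    and V': "va_module V (nprod V)" and W': "va_module W (nprod W)"
  shows "tensor_act F G (tensor_act (nprod V) (nprod W) (a \<otimes> a') s (b \<otimes> b')) n (x \<otimes> x') =
    conv (\<lambda>n s. F (nprod V a s b) n x) (\<lambda>n s. G (nprod W a' s b') n x') n s"
proof -
  interpret F: va_fields "nprod V" F using assms by (intro va_fields_module)
  interpret G: va_fields "nprod W" G using assms by (intro va_fields_module)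
  note lin = cbilinear_left[OF cbilinear_tensor_act[OF V W]]
  show ?thesis
    by (simp only: conv_iterated[OF F.truncated_iterate G.truncated_iterate] tensor_act_tens[OF V W]
        tensor_act_tens[OF V' W'] clinear_Sum_any[OF lin tensor_act_finite_support[OF V' W']])
qed

text \<open>On pure tensors the locality and weak associativity of the two factors multiply, their
  exponents adding up; \<open>defect_eq_0I\<close> turns the two properties into the full Borcherds
  identity.\<close>

theorem va_module_tensor:
  fixes V :: "'a::complex_vector va" and W :: "'b::complex_vector va"
  assumes V: "va_module V F" and W: "va_module W G"
    and V': "va_module V (nprod V)" and W': "va_module W (nprod W)"
  shows "va_module (tensor_va V W) (tensor_act F G)"
proof -
  let ?T = "tensor_act F G" and ?nT = "tensor_act (nprod V) (nprod W)"
  interpret F: va_fields "nprod V" F using assms by (intro va_fields_module)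
  interpret G: va_fields "nprod W" G using assms by (intro va_fields_module)
  interpret T: va_fields ?nT ?T
    using cbilinear_tensor_act[OF V W] cbilinear_tensor_act[OF V' W']
      tensor_act_truncation[OF V W] tensor_act_truncation[OF V' W']
    by unfold_locales auto
  have F0: "F.defect a b x p q r = 0" and G0: "G.defect a' b' x' p q r = 0" for a b x a' b' x' p q r
    using V W va_module_iff_defect[OF F.va_fields_axioms] va_module_iff_defect[OF G.va_fields_axioms]
    by blast+
  have pure: "T.defect (a \<otimes> a') (b \<otimes> b') (x \<otimes> x') p q r = 0" for a a' b b' x x' p q r
  proof -
    define f\<^sub>1 where "f\<^sub>1 m n = F a m (F b n x)" for m n
    define f\<^sub>2 where "f\<^sub>2 m n = G a' m (G b' n x')" for m n
    define g\<^sub>1 where "g\<^sub>1 m n = F b m (F a n x)" for m n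
    define g\<^sub>2 where "g\<^sub>2 m n = G b' m (G a' n x')" for m n
    define h\<^sub>1 where "h\<^sub>1 n s = F (nprod V a s b) n x" for n s
    define h\<^sub>2 where "h\<^sub>2 n s = G (nprod W a' s b') n x'" for n s
    have tr: "truncated f\<^sub>1" "truncated f\<^sub>2" "truncated g\<^sub>1" "truncated g\<^sub>2" "truncated h\<^sub>1" "truncated h\<^sub>2"
      unfolding f\<^sub>1_def[abs_def] f\<^sub>2_def[abs_def] g\<^sub>1_def[abs_def] g\<^sub>2_def[abs_def] h\<^sub>1_def[abs_def] h\<^sub>2_def[abs_def]
      by (rule F.truncated_comp G.truncated_comp F.truncated_iterate G.truncated_iterate)+
    have f: "(\<lambda>m n. ?T (a \<otimes> a') m (?T (b \<otimes> b') n (x \<otimes> x'))) = conv f\<^sub>1 f\<^sub>2"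
      and g: "(\<lambda>m n. ?T (b \<otimes> b') m (?T (a \<otimes> a') n (x \<otimes> x'))) = conv g\<^sub>1 g\<^sub>2"
      and h: "(\<lambda>n s. ?T (?nT (a \<otimes> a') s (b \<otimes> b')) n (x \<otimes> x')) = conv h\<^sub>1 h\<^sub>2"
      by (intro ext, simp add: tensor_act_comp_tens[OF assms] tensor_act_iterate_tens[OF assms]
          f\<^sub>1_def[abs_def] f\<^sub>2_def[abs_def] g\<^sub>1_def[abs_def] g\<^sub>2_def[abs_def] h\<^sub>1_def[abs_def] h\<^sub>2_def[abs_def])+
    obtain R\<^sub>1 :: nat where R\<^sub>1: "\<And>p q r. r \<ge> int R\<^sub>1 \<Longrightarrow> bsum (-1) f\<^sub>1 p q r = (-1) powi r *\<^sub>C bsum (-1) g\<^sub>1 q p r"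
      using F.borcherds_large_r[OF F0, where a = a and b = b and x = x] unfolding f\<^sub>1_def[abs_def] g\<^sub>1_def[abs_def] by blast
    obtain R\<^sub>2 :: nat where R\<^sub>2: "\<And>p q r. r \<ge> int R\<^sub>2 \<Longrightarrow> bsum (-1) f\<^sub>2 p q r = (-1) powi r *\<^sub>C bsum (-1) g\<^sub>2 q p r"
      using G.borcherds_large_r[OF G0, where a = a' and b = b' and x = x'] unfolding f\<^sub>2_def[abs_def] g\<^sub>2_def[abs_def] by blast
    obtain P\<^sub>1 :: nat where P\<^sub>1: "\<And>p q r. p \<ge> int P\<^sub>1 \<Longrightarrow> bsum 1 h\<^sub>1 q r p = bsum (-1) f\<^sub>1 p q r"
      using F.borcherds_large_p[OF F0, where a = a and b = b and x = x] unfolding f\<^sub>1_def[abs_def] h\<^sub>1_def[abs_def] by blast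
    obtain P\<^sub>2 :: nat where P\<^sub>2: "\<And>p q r. p \<ge> int P\<^sub>2 \<Longrightarrow> bsum 1 h\<^sub>2 q r p = bsum (-1) f\<^sub>2 p q r"
      using G.borcherds_large_p[OF G0, where a = a' and b = b' and x = x'] unfolding f\<^sub>2_def[abs_def] h\<^sub>2_def[abs_def] by blast
    have locality: "bsum (-1) (conv f\<^sub>1 f\<^sub>2) p q r = (-1) powi r *\<^sub>C bsum (-1) (conv g\<^sub>1 g\<^sub>2) q p r"
      if "r \<ge> int (R\<^sub>1 + R\<^sub>2)" for p q r
    proof -
      \<comment> \<open>The exponent r is split so that each factor receives a power large enough
        for its own locality.\<close>
      define s where "s = nat (r - int R\<^sub>1)"
      have r: "r = int R\<^sub>1 + int s" and s: "int s \<ge> int R\<^sub>2" using that by (auto simp: s_def)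
      have "bsum (-1) (conv f\<^sub>1 f\<^sub>2) p q r =
          conv (\<lambda>m n. bsum (-1) f\<^sub>1 m n (int R\<^sub>1)) (\<lambda>m n. bsum (-1) f\<^sub>2 m n (int s)) p q"
        unfolding r by (rule bsum_conv) (rule tr)+
      also have "\<dots> = conv (\<lambda>m n. (-1) powi (int R\<^sub>1) *\<^sub>C bsum (-1) g\<^sub>1 n m (int R\<^sub>1))
          (\<lambda>m n. (-1) powi (int s) *\<^sub>C bsum (-1) g\<^sub>2 n m (int s)) p q"
        by (simp only: R\<^sub>1[OF order_refl] R\<^sub>2[OF s])
      also have "\<dots> = conv (\<lambda>m n. (-1) powi (int R\<^sub>1) *\<^sub>C bsum (-1) g\<^sub>1 m n (int R\<^sub>1))
          (\<lambda>m n. (-1) powi (int s) *\<^sub>C bsum (-1) g\<^sub>2 m n (int s)) q p"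
        by (rule conv_swap)
      also have "\<dots> = ((-1) powi (int R\<^sub>1) * (-1) powi (int s)) *\<^sub>C
          conv (\<lambda>m n. bsum (-1) g\<^sub>1 m n (int R\<^sub>1)) (\<lambda>m n. bsum (-1) g\<^sub>2 m n (int s)) q p"
        by (rule conv_scale) (rule truncated_bsum tr)+
      also have "conv (\<lambda>m n. bsum (-1) g\<^sub>1 m n (int R\<^sub>1)) (\<lambda>m n. bsum (-1) g\<^sub>2 m n (int s)) q p =
          bsum (-1) (conv g\<^sub>1 g\<^sub>2) q p r"
        unfolding r by (rule bsum_conv[symmetric]) (rule tr)+
      finally show ?thesis by (simp add: r power_int_add)
    qed
    have associativity: "bsum 1 (conv h\<^sub>1 h\<^sub>2) q r p = bsum (-1) (conv f\<^sub>1 f\<^sub>2) p q r"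
      if "p \<ge> int (P\<^sub>1 + P\<^sub>2)" for p q r
    proof -
      define s where "s = nat (p - int P\<^sub>1)"
      have p: "p = int P\<^sub>1 + int s" and s: "int s \<ge> int P\<^sub>2" using that by (auto simp: s_def)
      have "bsum 1 (conv h\<^sub>1 h\<^sub>2) q r p =
          conv (\<lambda>m n. bsum 1 h\<^sub>1 m n (int P\<^sub>1)) (\<lambda>m n. bsum 1 h\<^sub>2 m n (int s)) q r"
        unfolding p by (rule bsum_conv) (rule tr)+
      \<comment> \<open>Weak associativity turns the mode index s' of the iterate into an exponent
        of z_1 - z_2, which is why the product has to be compared in the variables z_1 - z_2 and
        z_2.\<close>
      also have "\<dots> = conv (\<lambda>n s'. bsum (-1) f\<^sub>1 (int P\<^sub>1) n s') (\<lambda>n s'. bsum (-1) f\<^sub>2 (int s) n s') q r"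
        by (simp only: P\<^sub>1[OF order_refl] P\<^sub>2[OF s])
      also have "\<dots> = conv (\<lambda>s' n. bsum (-1) (\<lambda>m n. f\<^sub>1 (m + int P\<^sub>1) n) 0 n s')
          (\<lambda>s' n. bsum (-1) (\<lambda>m n. f\<^sub>2 (m + int s) n) 0 n s') r q"
        by (subst conv_swap[symmetric]) (simp add: bsum_shift_first)
      also have "\<dots> = bsum (-1) (conv (\<lambda>m n. f\<^sub>1 (m + int P\<^sub>1) n) (\<lambda>m n. f\<^sub>2 (m + int s) n)) 0 q r"
        using truncated_shift[OF tr(1), of "int P\<^sub>1" 0] truncated_shift[OF tr(2), of "int s" 0]
        by (intro conv_bsum_substitution) simp_all
      also have "conv (\<lambda>m n. f\<^sub>1 (m + int P\<^sub>1) n) (\<lambda>m n. f\<^sub>2 (m + int s) n) =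
          (\<lambda>m n. conv f\<^sub>1 f\<^sub>2 (m + p) n)"
        using conv_shift[of f\<^sub>1 "int P\<^sub>1" 0 f\<^sub>2 "int s" 0] by (intro ext) (simp add: p add_ac)
      finally show ?thesis by (simp add: bsum_shift_first)
    qed
    obtain N where N: "\<And>s. s \<ge> N \<Longrightarrow> ?nT (a \<otimes> a') s (b \<otimes> b') = 0"
      using T.np_truncation by blast
    obtain M where M: "\<And>s. s \<ge> M \<Longrightarrow> ?T (a \<otimes> a') s (x \<otimes> x') = 0"
      using T.act_truncation by blast
    show ?thesis
    proof (rule T.defect_eq_0I)
      fix p q r :: int assume r: "r \<ge> max N (int (R\<^sub>1 + R\<^sub>2))"
      have "bsum 1 (\<lambda>n s. ?T (?nT (a \<otimes> a') s (b \<otimes> b')) n (x \<otimes> x')) q r p = 0"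
        by (subst bsum_eq_sum[where N = N and K = 0]) (use r in \<open>auto simp: N clinear_zero[OF T.act_left]\<close>)
      then show "T.defect (a \<otimes> a') (b \<otimes> b') (x \<otimes> x') p q r = 0"
        using locality[of r p q] r by (simp add: T.defect_def f g)
    next
      fix p q r :: int assume p: "p \<ge> max M (int (P\<^sub>1 + P\<^sub>2))"
      have "bsum (-1) (\<lambda>m n. ?T (b \<otimes> b') m (?T (a \<otimes> a') n (x \<otimes> x'))) q p r = 0"
        by (subst bsum_eq_sum[where N = M and K = 0]) (use p in \<open>auto simp: M clinear_zero[OF T.act_right]\<close>)
      then show "T.defect (a \<otimes> a') (b \<otimes> b') (x \<otimes> x') p q r = 0"
        using associativity[of p q r] p by (simp add: T.defect_def f h)
    qed
  qed
  have "T.defect t u z p q r = 0" for t u z p q r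
  proof (induction t rule: tensor_induct)
    case (tens a a')
    show ?case
    proof (induction u rule: tensor_induct)
      case (tens b b')
      show ?case
        by (induction z rule: tensor_induct) (simp_all add: pure T.defect_add)
    qed (simp add: T.defect_add)
  qed (simp add: T.defect_add)
  moreover have "?T (vacuum V \<otimes> vacuum W) n z = (if n = -1 then z else 0)" for n z
  proof (induction z rule: tensor_induct)
    case (tens x y)
    have "F (vacuum V) i x \<otimes> G (vacuum W) (n - i - 1) y =
        (if i = -1 then if n = -1 then x \<otimes> y else 0 else 0)" for i
      by (simp add: va_module_vacuum[OF V] va_module_vacuum[OF W])
    then show ?case by (simp add: tensor_act_tens[OF V W])
  next
    case (add t u)
    then show ?case by (simp add: clinear_add[OF T.act_right])
  qed
  ultimately show ?thesis
    using va_module_iff_defect[of "tensor_va V W" ?T] T.va_fields_axioms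
    by (simp add: tensor_va_def)
qed

section \<open>Localization at a zero mode\<close>

lemma gchoose_zero_nat: "((0 :: complex) gchoose j) = (if j = 0 then 1 else 0)"
  by (cases j) auto

lemma Sum_any_gchoose_zero:
  "Sum_any (\<lambda>j::nat. ((of_int 0 :: complex) gchoose j) *\<^sub>C f j) = f 0"
  "Sum_any (\<lambda>j::nat. ((-1) ^ j * ((of_int 0 :: complex) gchoose j)) *\<^sub>C f j) = f 0"
  for f :: "nat \<Rightarrow> 'a::complex_vector"
proof -
  have "((0 :: complex) gchoose j) *\<^sub>C f j = (if j = 0 then f j else 0)"
    "((-1) ^ j * ((0 :: complex) gchoose j)) *\<^sub>C f j = (if j = 0 then f j else 0)" for j
    by (simp_all add: gchoose_zero_nat scaleC_one)
  then show "Sum_any (\<lambda>j::nat. ((of_int 0 :: complex) gchoose j) *\<^sub>C f j) = f 0"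
    "Sum_any (\<lambda>j::nat. ((-1) ^ j * ((of_int 0 :: complex) gchoose j)) *\<^sub>C f j) = f 0"
    by simp_all
qed

lemma va_module_commutator:
  assumes "va_module V act"
  shows "act a m (act b n x) = act b n (act a m x) +
    Sum_any (\<lambda>j::nat. ((of_int m :: complex) gchoose j) *\<^sub>C act (nprod V a (int j) b) (m + n - int j) x)"
  using va_module_borcherds[OF assms, of m a 0 b n x]
  unfolding Sum_any_gchoose_zero by (simp add: scaleC_one)

lemma va_module_commute:
  assumes "va_module V act" and "\<And>j. nprod V a (int j) b = 0"
  shows "act a m (act b n x) = act b n (act a m x)"
  using va_module_commutator[OF assms(1), of a m b n x]
  by (simp add: assms(2) clinear_zero[OF va_module_clinear_left[OF assms(1)]])

lemma va_module_commutator_simple_pole: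
  assumes "va_module V act" and "\<And>j. j > 0 \<Longrightarrow> nprod V a j b = 0"
  shows "act a m (act b n x) = act b n (act a m x) + act (nprod V a 0 b) (m + n) x"
proof -
  have "((of_int m :: complex) gchoose j) *\<^sub>C act (nprod V a (int j) b) (m + n - int j) x =
      (if j = 0 then act (nprod V a 0 b) (m + n) x else 0)" for j
    by (simp add: assms(2) clinear_zero[OF va_module_clinear_left[OF assms(1)]] scaleC_one)
  with va_module_commutator[OF assms(1), of a m b n x] show ?thesis by simp
qed

lemma va_module_commutator_zero_mode:
  assumes "va_module V act"
  shows "act a 0 (act b n x) = act b n (act a 0 x) + act (nprod V a 0 b) n x"
proof -
  have "((0 :: complex) gchoose j) *\<^sub>C act (nprod V a (int j) b) (0 + n - int j) x =
      (if j = 0 then act (nprod V a 0 b) n x else 0)" for j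
    by (simp add: gchoose_zero_nat scaleC_one)
  with va_module_commutator[OF assms, of a 0 b n x] show ?thesis by simp
qed

lemma va_module_iterate:
  assumes "va_module V act"
  shows "act (nprod V a r b) q x =
      Sum_any (\<lambda>j::nat. ((-1) ^ j * ((of_int r :: complex) gchoose j)) *\<^sub>C
        (act a (r - int j) (act b (q + int j) x)
          - ((-1) powi r) *\<^sub>C act b (q + r - int j) (act a (int j) x)))"
  using va_module_borcherds[OF assms, of 0 a r b q x]
  unfolding Sum_any_gchoose_zero by simp

lemma va_module_iterate_minus_one:
  assumes "va_module V act"
  shows "act (nprod V a (-1) b) q x =
      Sum_any (\<lambda>j::nat. act a (- 1 - int j) (act b (q + int j) x) + act b (q - 1 - int j) (act a (int j) x))"
proof -
  have "(-1) ^ j * ((of_int (-1) :: complex) gchoose j) = 1" for j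
    by (simp add: gbinomial_minus flip: binomial_gbinomial power_add)
  then show ?thesis
    using va_module_iterate[OF assms, of a "-1" b q x]
    by (simp add: scaleC_one cvs.scale_minus_left)
qed

lemma va_module_pullback:
  assumes "va_hom V W \<phi>" "va_module W act"
  shows "va_module V (\<lambda>a. act (\<phi> a))"
  using assms unfolding va_module_def va_hom_def cbilinear_def
  by (auto simp: clinear_iff)

text \<open>For a subspace N of a module this set contains the vacuum and is closed under all
  products. Stability of N under many fields thus becomes membership of generators.\<close>

definition stabilizer :: "('a \<Rightarrow> int \<Rightarrow> 'm \<Rightarrow> 'm) \<Rightarrow> 'm set \<Rightarrow> 'a set"
  where "stabilizer act N = {a. \<forall>n. \<forall>x\<in>N. act a n x \<in> N}"

lemma stabilizerI: "(\<And>n x. x \<in> N \<Longrightarrow> act a n x \<in> N) \<Longrightarrow> a \<in> stabilizer act N"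
  and stabilizerD: "a \<in> stabilizer act N \<Longrightarrow> x \<in> N \<Longrightarrow> act a n x \<in> N"
  by (auto simp: stabilizer_def)

lemma subspace_stabilizer:
  assumes "va_module V act" "cvs.subspace N"
  shows "cvs.subspace (stabilizer act N)"
  using assms(2) clinear_zero[OF va_module_clinear_left[OF assms(1)]]
    clinear_add[OF va_module_clinear_left[OF assms(1)]] clinear_scale[OF va_module_clinear_left[OF assms(1)]]
  by (auto simp: cvs.subspace_def stabilizer_def)

lemma vacuum_in_stabilizer:
  assumes "va_module V act" "cvs.subspace N"
  shows "vacuum V \<in> stabilizer act N"
  using assms(2) by (auto simp: stabilizer_def va_module_vacuum[OF assms(1)] cvs.subspace_0)

lemma nprod_in_stabilizer:
  assumes V: "va_module V act" and N: "cvs.subspace N"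
    and a: "a \<in> stabilizer act N" and b: "b \<in> stabilizer act N"
  shows "nprod V a r b \<in> stabilizer act N"
proof (rule stabilizerI)
  fix n x assume "x \<in> N"
  with a b show "act (nprod V a r b) n x \<in> N"
    unfolding va_module_iterate[OF V]
    by (intro subspace_Sum_any[OF N] cvs.subspace_scale[OF N] cvs.subspace_diff[OF N]
        stabilizerD[OF a] stabilizerD[OF b])
qed

text \<open>For a bijective E that preserves N this is the localization of N at E, realized inside
  the ambient space. For N = {0} it is the generalized kernel of E.\<close>

definition upper_closure :: "('m \<Rightarrow> 'm) \<Rightarrow> 'm set \<Rightarrow> 'm set"
  where "upper_closure E N = {x. \<exists>k. (E ^^ k) x \<in> N}"

text \<open>Dual to \<open>upper_closure\<close>; for N = \<open>UNIV\<close> it is the intersection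
  of the images of all powers of E.\<close>

definition lower_core :: "('m \<Rightarrow> 'm) \<Rightarrow> 'm set \<Rightarrow> 'm set"
  where "lower_core E N = {x. \<forall>k. \<exists>y\<in>N. x = (E ^^ k) y}"

lemma upper_closure_inverse:
  assumes "E x \<in> upper_closure E N"
  shows "x \<in> upper_closure E N"
proof -
  obtain k where "(E ^^ k) (E x) \<in> N"
    using assms by (auto simp: upper_closure_def)
  then have "(E ^^ Suc k) x \<in> N"
    by (simp only: funpow_Suc_right comp_apply)
  then show ?thesis unfolding upper_closure_def by blast
qed

lemma upper_closure_superset: "x \<in> N \<Longrightarrow> x \<in> upper_closure E N"
  unfolding upper_closure_def by (auto intro: exI[of _ 0])

lemma subspace_upper_closure:
  fixes E :: "'m::complex_vector \<Rightarrow> 'm"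
  assumes E: "clinear E" and N: "cvs.subspace N" and inv: "\<And>x. x \<in> N \<Longrightarrow> E x \<in> N"
  shows "cvs.subspace (upper_closure E N)"
proof (rule cvs.subspaceI)
  have pow: "x \<in> N \<Longrightarrow> (E ^^ k) x \<in> N" for k x
    by (induction k) (auto simp: inv)
  show "0 \<in> upper_closure E N"
    by (rule upper_closure_superset) (rule cvs.subspace_0[OF N])
  fix x y s assume "x \<in> upper_closure E N"
  then obtain k where k: "(E ^^ k) x \<in> N" by (auto simp: upper_closure_def)
  then show "s *\<^sub>C x \<in> upper_closure E N"
    unfolding upper_closure_def
    by (auto intro!: exI[of _ k] simp: clinear_scale[OF clinear_funpow[OF E]] cvs.subspace_scale[OF N])
  assume "y \<in> upper_closure E N"
  then obtain l where l: "(E ^^ l) y \<in> N" by (auto simp: upper_closure_def)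
  \<comment> \<open>x and y may enter N at different powers; since E preserves N, both are in N at
    the power k + l.\<close>
  have "(E ^^ (l + k)) x \<in> N" "(E ^^ (k + l)) y \<in> N"
    using pow[OF k, of l] pow[OF l, of k] by (simp_all add: funpow_add)
  then have "(E ^^ (k + l)) (x + y) \<in> N"
    by (simp add: clinear_add[OF clinear_funpow[OF E]] cvs.subspace_add[OF N] add.commute)
  then show "x + y \<in> upper_closure E N"
    by (auto simp: upper_closure_def)
qed

lemma subspace_lower_core:
  fixes E :: "'m::complex_vector \<Rightarrow> 'm"
  assumes E: "clinear E" and N: "cvs.subspace N"
  shows "cvs.subspace (lower_core E N)"
proof (rule cvs.subspaceI)
  show "0 \<in> lower_core E N"
    using cvs.subspace_0[OF N] clinear_zero[OF clinear_funpow[OF E]]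
    by (force simp: lower_core_def)
next
  fix x y assume xy: "x \<in> lower_core E N" "y \<in> lower_core E N"
  have "\<exists>z\<in>N. x + y = (E ^^ k) z" for k
  proof -
    obtain x' y' where "x' \<in> N" "x = (E ^^ k) x'" "y' \<in> N" "y = (E ^^ k) y'"
      using xy unfolding lower_core_def by blast
    then show ?thesis
      by (intro bexI[of _ "x' + y'"]) (simp_all add: clinear_add[OF clinear_funpow[OF E]] cvs.subspace_add[OF N])
  qed
  then show "x + y \<in> lower_core E N" by (simp add: lower_core_def)
next
  fix s x assume x: "x \<in> lower_core E N"
  have "\<exists>z\<in>N. s *\<^sub>C x = (E ^^ k) z" for k
  proof -
    obtain x' where "x' \<in> N" "x = (E ^^ k) x'"
      using x unfolding lower_core_def by blast
    then show ?thesis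
      by (intro bexI[of _ "s *\<^sub>C x'"]) (simp_all add: clinear_scale[OF clinear_funpow[OF E]] cvs.subspace_scale[OF N])
  qed
  then show "s *\<^sub>C x \<in> lower_core E N" by (simp add: lower_core_def)
qed

lemma lower_core_subset: "lower_core E N \<subseteq> N"
proof
  fix x assume "x \<in> lower_core E N"
  then obtain y where "y \<in> N" "x = (E ^^ 0) y" unfolding lower_core_def by blast
  then show "x \<in> N" by simp
qed

lemma lower_core_inverse:
  assumes "inj E" "E x \<in> lower_core E N"
  shows "x \<in> lower_core E N"
proof -
  have "\<exists>y\<in>N. x = (E ^^ k) y" for k
  proof -
    obtain y where "y \<in> N" "E x = (E ^^ Suc k) y"
      using assms(2) unfolding lower_core_def by blast
    with injD[OF assms(1)] show ?thesis by auto
  qed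
  then show ?thesis by (simp add: lower_core_def)
qed

text \<open>If $u_{(0)}$ acts nilpotently on \<open>a\<close>, then the modes of \<open>a\<close> can be moved past a power of
  $u_{(0)}$ (Ore condition), so they are defined on localizations with respect to $u_{(0)}$.\<close>

lemma stabilizer_upper_closure:
  assumes V: "va_module V act" and N: "cvs.subspace N" and u: "u \<in> stabilizer act N"
    and a: "\<And>j. ((nprod V u 0) ^^ j) a \<in> stabilizer act N" and nil: "((nprod V u 0) ^^ J) a = 0"
  shows "a \<in> stabilizer act (upper_closure (act u 0) N)"
  using a nil
proof (induction J arbitrary: a)
  case 0
  have "0 \<in> upper_closure (act u 0) N"
    by (rule upper_closure_superset) (rule cvs.subspace_0[OF N])
  with 0(2) show ?case
    by (simp add: stabilizer_def clinear_zero[OF va_module_clinear_left[OF V]])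
next
  case (Suc J)
  let ?E = "act u 0" and ?U = "nprod V u 0"
  have sub: "cvs.subspace (upper_closure ?E N)"
    by (rule subspace_upper_closure[OF va_module_clinear_right[OF V] N]) (rule stabilizerD[OF u])
  have U: "?U a \<in> stabilizer act (upper_closure ?E N)"
  proof (rule Suc.IH)
    show "(?U ^^ j) (?U a) \<in> stabilizer act N" for j
      using Suc.prems(1)[of "Suc j"] by (simp only: funpow_Suc_right comp_apply)
    show "(?U ^^ J) (?U a) = 0"
      using Suc.prems(2) by (simp only: funpow_Suc_right comp_apply)
  qed
  \<comment> \<open>The identity E (a x) = a (E x) + (U a) x feeds two inductions: E x needs one
    power less to reach N, and U a is nilpotent of smaller order.\<close>
  have step: "\<forall>x. (?E ^^ k) x \<in> N \<longrightarrow> act a n x \<in> upper_closure ?E N" for k n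
  proof (induction k)
    case 0
    show ?case
      using stabilizerD[OF Suc.prems(1)[of 0]] by (simp add: upper_closure_superset)
  next
    case (Suc k)
    show ?case
    proof (intro allI impI)
      fix x assume x: "(?E ^^ Suc k) x \<in> N"
      then have "(?E ^^ k) (?E x) \<in> N" by (simp only: funpow_Suc_right comp_apply)
      with Suc have "act a n (?E x) \<in> upper_closure ?E N" by blast
      moreover have "act (?U a) n x \<in> upper_closure ?E N"
        using x by (intro stabilizerD[OF U]) (unfold upper_closure_def, blast)
      ultimately have "?E (act a n x) \<in> upper_closure ?E N"
        by (simp add: va_module_commutator_zero_mode[OF V] cvs.subspace_add[OF sub])
      then show "act a n x \<in> upper_closure ?E N" by (rule upper_closure_inverse)
    qed
  qed
  show ?case
  proof (rule stabilizerI)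
    fix n x assume "x \<in> upper_closure ?E N"
    then obtain k where "(?E ^^ k) x \<in> N" unfolding upper_closure_def by blast
    with step show "act a n x \<in> upper_closure ?E N" by blast
  qed
qed

text \<open>The same double induction, read backwards: for x = E z one has a x = E (a z) - (U a) z.
  Injectivity of E guarantees that z lies in the core again.\<close>

lemma stabilizer_lower_core:
  assumes V: "va_module V act" and N: "cvs.subspace N" and u: "u \<in> stabilizer act N"
    and inj: "inj (act u 0)"
    and a: "\<And>j. ((nprod V u 0) ^^ j) a \<in> stabilizer act N" and nil: "((nprod V u 0) ^^ J) a = 0"
  shows "a \<in> stabilizer act (lower_core (act u 0) N)"
  using a nil
proof (induction J arbitrary: a)
  case 0
  let ?E = "act u 0"
  have "0 \<in> lower_core ?E N"
    by (rule cvs.subspace_0[OF subspace_lower_core[OF va_module_clinear_right[OF V] N]])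
  with 0(2) show ?case
    by (simp add: stabilizer_def clinear_zero[OF va_module_clinear_left[OF V]])
next
  case (Suc J)
  let ?E = "act u 0" and ?U = "nprod V u 0"
  note lin = clinear_funpow[OF va_module_clinear_right[OF V]]
  have U: "?U a \<in> stabilizer act (lower_core ?E N)"
  proof (rule Suc.IH)
    show "(?U ^^ j) (?U a) \<in> stabilizer act N" for j
      using Suc.prems(1)[of "Suc j"] by (simp only: funpow_Suc_right comp_apply)
    show "(?U ^^ J) (?U a) = 0"
      using Suc.prems(2) by (simp only: funpow_Suc_right comp_apply)
  qed
  have step: "\<forall>x\<in>lower_core ?E N. \<exists>y\<in>N. act a n x = (?E ^^ k) y" for k n
  proof (induction k)
    case 0
    show ?case
      using stabilizerD[OF Suc.prems(1)[of 0]] lower_core_subset[of ?E N] by auto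
  next
    case (Suc k)
    show ?case
    proof
      fix x assume x: "x \<in> lower_core ?E N"
      then obtain z where z: "x = ?E z"
        unfolding lower_core_def by (auto dest!: spec[of _ "Suc 0"])
      with x have z': "z \<in> lower_core ?E N"
        using lower_core_inverse[OF inj] by blast
      with Suc obtain y where y: "y \<in> N" "act a n z = (?E ^^ k) y" by blast
      obtain y' where y': "y' \<in> N" "act (?U a) n z = (?E ^^ Suc k) y'"
        using stabilizerD[OF U z', of n] unfolding lower_core_def by blast
      have "act a n x = ?E (act a n z) - act (?U a) n z"
        by (simp add: z va_module_commutator_zero_mode[OF V])
      also have "\<dots> = (?E ^^ Suc k) (y - y')"
        unfolding clinear_diff[OF lin] y'(2)[symmetric] by (simp add: y)
      finally show "\<exists>y\<in>N. act a n x = (?E ^^ Suc k) y"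
        using cvs.subspace_diff[OF N y(1) y'(1)] by blast
    qed
  qed
  show ?case
  proof (rule stabilizerI)
    fix n x assume "x \<in> lower_core ?E N"
    with step show "act a n x \<in> lower_core ?E N" unfolding lower_core_def by blast
  qed
qed

text \<open>X - \<mu> q annihilates the component with index q and multiplies the others by nonzero
  scalars, so the number of components can be lowered.\<close>

lemma eigencomponents_in_subspace:
  assumes X: "clinear X" and N: "cvs.subspace N" and XN: "\<And>x. x \<in> N \<Longrightarrow> X x \<in> N"
    and "finite A" and eig: "\<And>p. p \<in> A \<Longrightarrow> X (u p) = \<mu> p *\<^sub>C u p" and "inj_on \<mu> A"
    and "(\<Sum>p\<in>A. u p) \<in> N" and "p \<in> A"
  shows "u p \<in> N"
  using assms(4-)
proof (induction A arbitrary: u p rule: finite_induct)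
  case (insert q A)
  let ?z = "\<Sum>p\<in>insert q A. u p"
  have "X ?z - \<mu> q *\<^sub>C ?z = (\<Sum>p\<in>A. (\<mu> p - \<mu> q) *\<^sub>C u p)"
    using insert.hyps insert.prems(1)
    by (simp add: clinear_add[OF X] clinear_sum[OF X] scaleC_add_right cvs.scale_sum_right
        cvs.scale_left_diff_distrib sum_subtractf)
  moreover have "X ?z - \<mu> q *\<^sub>C ?z \<in> N"
    using insert.prems(3) by (intro cvs.subspace_diff[OF N] cvs.subspace_scale[OF N] XN)
  ultimately have sum: "(\<Sum>p\<in>A. (\<mu> p - \<mu> q) *\<^sub>C u p) \<in> N" by simp
  have A: "u p \<in> N" if "p \<in> A" for p
  proof -
    have "(\<mu> p - \<mu> q) *\<^sub>C u p \<in> N"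
      by (rule insert.IH[OF _ _ sum that])
        (use insert.prems in \<open>auto simp: clinear_scale[OF X] cvs.scale_left_commute\<close>)
    moreover have "\<mu> p - \<mu> q \<noteq> 0"
      using insert.prems(2) insert.hyps that by (auto simp: inj_on_def)
    ultimately show ?thesis
      using cvs.subspace_scale[OF N, of "(\<mu> p - \<mu> q) *\<^sub>C u p" "inverse (\<mu> p - \<mu> q)"]
      by (simp add: scaleC_scaleC scaleC_one)
  qed
  have "u q = ?z - (\<Sum>p\<in>A. u p)" using insert.hyps by simp
  then have "u q \<in> N"
    using insert.prems(3) A by (metis cvs.subspace_diff[OF N] cvs.subspace_sum[OF N])
  with A insert.prems(4) show ?case by auto
qed simp

section \<open>The half lattice vertex algebra\<close>

lemma free_over_induct:
  assumes "free_over act gens v" and S: "cvs.subspace S" and v: "\<And>i. v i \<in> S"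
    and step: "\<And>j n x. j < length gens \<Longrightarrow> x \<in> S \<Longrightarrow> act (gens ! j) (- int n - 1) x \<in> S"
  shows "x \<in> S"
proof -
  have word: "word_act act gens xs (v i) \<in> S" if "\<forall>(j, n)\<in>set xs. j < length gens" for xs i
    using that by (induction xs) (auto simp: word_act_def v step)
  have "cvs.span ((\<lambda>(xs, i). word_act act gens xs (v i)) ` (ordered_words (length gens) \<times> UNIV)) \<subseteq> S"
    by (rule cvs.span_minimal[OF _ S]) (auto simp: ordered_words_def intro!: word)
  with assms(1) show ?thesis by (auto simp: free_over_def Let_def)
qed

text \<open>In the order c_1, c_2, d_1, d_2, counted from 0, this exchanges c_i with d_i, the
  partner with which its pairing is nonzero.\<close>

definition dual_index :: "nat \<Rightarrow> nat"
  where "dual_index i = (i + 2) mod 4"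

lemma less_4_cases:
  fixes i :: nat
  assumes "i < 4"
  obtains "i = 0" | "i = 1" | "i = 2" | "i = 3"
  using assms by linarith

lemma va_module_commutator_heisenberg:
  assumes V: "va_module V act" and ope: "ope V a b [0, t *\<^sub>C vacuum V]"
  shows "act a m (act b n x) = act b n (act a m x) + (if m + n = 0 then (t * of_int m) *\<^sub>C x else 0)"
proof -
  have ab: "nprod V a (int j) b = (if j = 1 then t *\<^sub>C vacuum V else 0)" for j
    using ope[unfolded ope_def, rule_format, of j] by (auto simp: nth_Cons')
  have "((of_int m :: complex) gchoose j) *\<^sub>C act (nprod V a (int j) b) (m + n - int j) x =
      (if j = 1 then if m + n = 0 then (t * of_int m) *\<^sub>C x else 0 else 0)" for j
    by (simp add: ab clinear_zero[OF va_module_clinear_left[OF V]]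
        clinear_scale[OF va_module_clinear_left[OF V]] va_module_vacuum[OF V] scaleC_scaleC mult.commute)
  with va_module_commutator[OF V, of a m b n x] show ?thesis by simp
qed

locale pi_zero =
  fixes P :: "'p::complex_vector va" and c d :: "nat \<Rightarrow> 'p" and e :: "int \<Rightarrow> int \<Rightarrow> 'p"
  assumes P: "Pi_0_squared P c d e"
begin

definition heis :: "nat \<Rightarrow> 'p"
  where "heis i = [c 1, c 2, d 1, d 2] ! i"

text \<open>The eigenvalue of the zero mode of \<open>heis i\<close> on e^{a c_1 + b c_2}. Only the
  d_i see these exponentials, with the factor 2 of the pairing.\<close>

definition charge :: "nat \<Rightarrow> int \<Rightarrow> int \<Rightarrow> complex"
  where "charge i a b = [0, 0, 2 * of_int a, 2 * of_int b] ! i"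

lemma P_vertex_algebra: "vertex_algebra P"
  and P_fock: "Pi_fock_module P c d e 0 0 0 0 (nprod P) e"
  and e_zero: "e 0 0 = vacuum P"
  and deriv_e: "va_deriv P (e a b) = nprod P (of_int a *\<^sub>C c 1 + of_int b *\<^sub>C c 2) (-1) (e a b)"
  using P unfolding Pi_0_squared_def by blast+

lemma P_module: "va_module P (nprod P)"
  using P_vertex_algebra by (simp add: vertex_algebra_def)

lemma heis_simps:
  "heis 0 = c 1" "heis (Suc 0) = c 2" "heis 2 = d 1" "heis 3 = d 2"
  by (simp_all add: heis_def numeral_3_eq_3)

lemma charge_simps:
  "charge 0 a b = 0" "charge (Suc 0) a b = 0" "charge 2 a b = 2 * of_int a" "charge 3 a b = 2 * of_int b"
  by (simp_all add: charge_def numeral_3_eq_3)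

lemma heis_ope:
  assumes "i < 4" "j < 4" "i < 2 \<or> j \<ge> 2"
  shows "ope P (heis i) (heis j) [0, (if j = dual_index i then 2 else 0) *\<^sub>C vacuum P]"
proof -
  have cd: "ope P (c i) (d j) [0, (if i = j then 2 else 0) *\<^sub>C vacuum P]"
    "ope P (c i) (c j) []" "ope P (d i) (d j) []" if "i \<in> {1, 2}" "j \<in> {1, 2}" for i j
    using P that unfolding Pi_0_squared_def by blast+
  have nil: "ope P x y [0, 0 *\<^sub>C vacuum P]" if "ope P x y []" for x y
    using that by (simp add: ope_def nth_Cons')
  have c: "heis i = c (i + 1) \<and> i + 1 \<in> {1, 2} \<and> dual_index i = i + 2" if "i < 2" for i
    using that by (auto simp: heis_simps dual_index_def numeral_2_eq_2 less_Suc_eq)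
  have d: "heis i = d (i - 1) \<and> i - 1 \<in> {1, 2} \<and> dual_index i < 2" if "i < 4" "\<not> i < 2" for i
  proof -
    have "i = 2 \<or> i = 3" using that by linarith
    then show ?thesis by (elim disjE) (simp_all add: heis_simps dual_index_def)
  qed
  consider "i < 2" "j < 2" | "i < 2" "\<not> j < 2" | "\<not> i < 2" "\<not> j < 2"
    using assms(3) by linarith
  then show ?thesis
  proof cases
    case 1
    then show ?thesis using c[of i] c[of j] nil[OF cd(2)] by auto
  next
    case 2
    then have "i + 1 = j - 1 \<longleftrightarrow> j = dual_index i" using c[of i] by auto
    with 2 show ?thesis using c[of i] d[of j] assms cd(1)[of "i + 1" "j - 1"] by presburger
  next
    case 3
    then have "j \<noteq> dual_index i" using d[of i] assms by auto
    with 3 show ?thesis using d[of i] d[of j] assms nil[OF cd(3)[of "i - 1" "j - 1"]] by presburger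
  qed
qed

text \<open>The given operator products cover all orders except d before c. That one follows by
  exchanging the two operators, because m = -n turns the sign of the commutator into the right
  one.\<close>

lemma heis_commutator:
  assumes V: "va_module P act" and "i < 4" "j < 4"
  shows "act (heis i) m (act (heis j) n x) = act (heis j) n (act (heis i) m x) +
    (if j = dual_index i \<and> m + n = 0 then (2 * of_int m) *\<^sub>C x else 0)"
proof (cases "i < 2 \<or> j \<ge> 2")
  case True
  from va_module_commutator_heisenberg[OF V heis_ope[OF assms(2,3) True], of m n x]
  show ?thesis by auto
next
  case False
  then have *: "j < 2 \<or> i \<ge> 2" by auto
  have dual: "i = dual_index j \<longleftrightarrow> j = dual_index i"
    using assms(2,3) by (elim less_4_cases) (simp_all add: dual_index_def)
  show ?thesis
  proof (cases "j = dual_index i \<and> m + n = 0")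
    case True
    then have "n = - m" by simp
    with va_module_commutator_heisenberg[OF V heis_ope[OF assms(3,2) *], of n m x] True dual
    show ?thesis by (simp add: cvs.scale_minus_left)
  next
    case False
    with va_module_commutator_heisenberg[OF V heis_ope[OF assms(3,2) *], of n m x] dual
    show ?thesis by (auto simp: add.commute)
  qed
qed

lemma heis_e:
  assumes "i < 4" "n \<ge> 0"
  shows "nprod P (heis i) n (e a b) = (if n = 0 then charge i a b *\<^sub>C e a b else 0)"
  using P_fock assms unfolding Pi_fock_module_def
  by (elim less_4_cases) (auto simp: heis_simps charge_simps)

lemma e_e:
  shows e_e_nonneg: "n \<ge> 0 \<Longrightarrow> nprod P (e a b) n (e a' b') = 0"
    and e_e_minus_one: "nprod P (e a b) (-1) (e a' b') = e (a + a') (b + b')"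
  using P_fock unfolding Pi_fock_module_def by (auto simp: Let_def add.commute)

lemma heis_e_commutator:
  assumes V: "va_module P act" and i: "i < 4"
  shows "act (heis i) m (act (e a b) n x) =
    act (e a b) n (act (heis i) m x) + charge i a b *\<^sub>C act (e a b) (m + n) x"
  using va_module_commutator_simple_pole[OF V, of "heis i" "e a b" m n x] heis_e[OF i, of _ a b]
  by (simp add: clinear_scale[OF va_module_clinear_left[OF V]])

lemma e_commute:
  assumes V: "va_module P act"
  shows "act (e a b) m (act (e a' b') n x) = act (e a' b') n (act (e a b) m x)"
  by (rule va_module_commute[OF V]) (simp add: e_e_nonneg)

lemma P_induct:
  assumes S: "cvs.subspace S" and e: "\<And>a b. e a b \<in> S"
    and step: "\<And>i n x. i < 4 \<Longrightarrow> x \<in> S \<Longrightarrow> nprod P (heis i) (- int n - 1) x \<in> S"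
  shows "x \<in> S"
proof (rule free_over_induct)
  show "free_over (nprod P) [c 1, c 2, d 1, d 2] (\<lambda>(a, b). e a b)"
    using P_fock by (simp add: Pi_fock_module_def)
qed (use assms in \<open>auto simp: heis_def\<close>)

text \<open>The generalized kernel of the zero mode contains all exponentials. The zero mode squares
  to zero on each Heisenberg generator, so this kernel is stable under the Heisenberg modes and
  hence everything.\<close>

lemma e_zero_mode_nilpotent: "\<exists>J. (nprod P (e a b) 0 ^^ J) p = 0"
proof -
  let ?U = "nprod P (e a b) 0" and ?S = "upper_closure (nprod P (e a b) 0) {0}"
  note lin = va_module_clinear_right[OF P_module]
  have N: "cvs.subspace {0 :: 'p}" by (rule cvs.subspace_single_0)
  have stab: "x \<in> stabilizer (nprod P) {0}" for x
    by (simp add: stabilizer_def clinear_zero[OF lin])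
  have vac: "?U (vacuum P) = 0" and id: "nprod P x (-1) (vacuum P) = x" for x
    using P_vertex_algebra by (auto simp: vertex_algebra_def)
  have "?U (heis i) = - charge i a b *\<^sub>C e a b" if "i < 4" for i
    using heis_e_commutator[OF P_module that, of "-1" a b 0 "vacuum P"]
    by (simp add: vac id clinear_zero[OF lin] cvs.scale_minus_left eq_neg_iff_add_eq_0 add.commute)
  then have heis: "(?U ^^ 2) (heis i) = 0" if "i < 4" for i
    using that by (simp add: numeral_2_eq_2 clinear_minus[OF lin] clinear_scale[OF lin] e_e_nonneg)
  have S: "heis i \<in> stabilizer (nprod P) ?S" if "i < 4" for i
    by (rule stabilizer_upper_closure[OF P_module N stab stab heis[OF that]])
  have "p \<in> ?S"
  proof (rule P_induct)
    show "cvs.subspace ?S"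
      by (rule subspace_upper_closure[OF lin N]) (simp add: clinear_zero[OF lin])
    show "e a' b' \<in> ?S" for a' b'
      unfolding upper_closure_def by (auto intro!: exI[of _ 1] simp: e_e_nonneg)
    show "nprod P (heis i) (- int n - 1) x \<in> ?S" if "i < 4" "x \<in> ?S" for i n x
      by (rule stabilizerD[OF S[OF that(1)] that(2)])
  qed
  then show ?thesis by (simp add: upper_closure_def)
qed

text \<open>The zero mode of $h$ contributes the only correction to
  ${:}(h e^\alpha)e^{\alpha'}{:}=h_{(-1)}e^{\alpha+\alpha'}$.\<close>

lemma heis_e_normal_product:
  assumes "\<And>j. j > 0 \<Longrightarrow> nprod P h j (e a' b') = 0" and "nprod P h 0 (e a' b') = t *\<^sub>C e a' b'"
  shows "nprod P (nprod P h (-1) (e a b)) (-1) (e a' b') =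
    nprod P h (-1) (e (a + a') (b + b')) + t *\<^sub>C nprod P (e a b) (-2) (e a' b')"
proof -
  note lin = va_module_clinear_right[OF P_module]
  have "nprod P h (-1 - int j) (nprod P (e a b) (-1 + int j) (e a' b')) +
      nprod P (e a b) (-1 - 1 - int j) (nprod P h (int j) (e a' b')) =
      (if j = 0 then nprod P h (-1) (e (a + a') (b + b')) + t *\<^sub>C nprod P (e a b) (-2) (e a' b') else 0)" for j
    using assms by (auto simp: e_e_nonneg e_e_minus_one clinear_zero[OF lin] clinear_scale[OF lin])
  then show ?thesis
    unfolding va_module_iterate_minus_one[OF P_module] by simp
qed

end

section \<open>Irreducibility over the tensor product algebra\<close>

text \<open>The two arguments -1 of the Fock module are the eigenvalues of the zero modes of c_1 and
  c_2, that is, the shift -d_1/2 - d_2/2 of the exponents.\<close>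

locale fock_tensor = pi_zero P c d e
  for P :: "'p::complex_vector va" and c d e +
  fixes W :: "'w::complex_vector va"
    and F :: "'w \<Rightarrow> int \<Rightarrow> 'r \<Rightarrow> 'r::complex_vector"
    and G :: "'p \<Rightarrow> int \<Rightarrow> 'q \<Rightarrow> 'q::complex_vector"
    and v :: "int \<Rightarrow> int \<Rightarrow> 'q" and l\<^sub>1 l\<^sub>2 :: complex
  assumes W: "vertex_algebra W" and F: "va_irreducible W F"
    and G: "Pi_fock_module P c d e (-1) (-1) l\<^sub>1 l\<^sub>2 G v"
    and nontrivial: "\<exists>z :: ('r, 'q) tensor. z \<noteq> 0"
begin

abbreviation T :: "('w, 'p) tensor \<Rightarrow> int \<Rightarrow> ('r, 'q) tensor \<Rightarrow> ('r, 'q) tensor"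
  where "T \<equiv> tensor_act F G"

abbreviation in_W :: "'w \<Rightarrow> ('w, 'p) tensor"
  where "in_W w \<equiv> w \<otimes> vacuum P"

abbreviation in_P :: "'p \<Rightarrow> ('w, 'p) tensor"
  where "in_P p \<equiv> vacuum W \<otimes> p"

abbreviation np :: "('w, 'p) tensor \<Rightarrow> int \<Rightarrow> ('w, 'p) tensor \<Rightarrow> ('w, 'p) tensor"
  where "np \<equiv> tensor_act (nprod W) (nprod P)"

lemma W_module: "va_module W (nprod W)"
  using W by (simp add: vertex_algebra_def)

lemma F_module: "va_module W F"
  using F by (simp add: va_irreducible_def)

lemma G_module: "va_module P G"
  using G by (simp add: Pi_fock_module_def)

lemma T_module: "va_module (tensor_va W P) T"
  by (rule va_module_tensor[OF F_module G_module W_module P_module])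

lemma nprod_tensor_va [simp]: "nprod (tensor_va W P) = np"
  and vacuum_tensor_va [simp]: "vacuum (tensor_va W P) = vacuum W \<otimes> vacuum P"
  by (simp_all add: tensor_va_def)

lemma tensor_act_in_W:
  assumes "va_module W A" "va_module P B"
  shows "tensor_act A B (in_W w) n (x \<otimes> y) = A w n x \<otimes> y"
proof -
  have "A w i x \<otimes> B (vacuum P) (n - i - 1) y = (if i = n then A w n x \<otimes> y else 0)" for i
    by (auto simp: va_module_vacuum[OF assms(2)])
  then show ?thesis by (simp add: tensor_act_tens[OF assms])
qed

lemma tensor_act_in_P:
  assumes "va_module W A" "va_module P B"
  shows "tensor_act A B (in_P p) n (x \<otimes> y) = x \<otimes> B p n y"
proof -
  have "A (vacuum W) i x \<otimes> B p (n - i - 1) y = (if i = -1 then x \<otimes> B p n y else 0)" for i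
    by (auto simp: va_module_vacuum[OF assms(1)])
  then show ?thesis by (simp add: tensor_act_tens[OF assms])
qed

lemmas T_in_W = tensor_act_in_W[OF F_module G_module]
  and T_in_P = tensor_act_in_P[OF F_module G_module]
  and np_in_W = tensor_act_in_W[OF W_module P_module]
  and np_in_P = tensor_act_in_P[OF W_module P_module]

lemma T_in_P_module: "va_module P (\<lambda>p. T (in_P p))"
proof (rule va_module_pullback[OF _ T_module])
  show "va_hom P (tensor_va W P) (\<lambda>p. in_P p)"
    by (simp add: va_hom_def clinear_tens_right np_in_P)
qed

lemmas clinear_T = va_module_clinear_right[OF T_module]

text \<open>a c_1 + b c_2 pairs to -(a + b) with the exponents of the module, so its leading mode
  has index a + b - 1. It is the zero mode exactly for a + b = 1, the source of this condition
  below.\<close>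

lemma shift_v:
  "T (in_P (e a b)) (a + b - 1) (x \<otimes> v n\<^sub>1 n\<^sub>2) = x \<otimes> v (n\<^sub>1 + a) (n\<^sub>2 + b)"
  and shift_v_above: "n > a + b - 1 \<Longrightarrow> T (in_P (e a b)) n (x \<otimes> v n\<^sub>1 n\<^sub>2) = 0"
proof -
  have *: "G (e a b) (- (a * - 1 + b * - 1) - 1) (v n\<^sub>1 n\<^sub>2) = v (n\<^sub>1 + a) (n\<^sub>2 + b)"
    "\<forall>n > - (a * - 1 + b * - 1) - 1. G (e a b) n (v n\<^sub>1 n\<^sub>2) = 0"
    using G unfolding Pi_fock_module_def Let_def by blast+
  then show "T (in_P (e a b)) (a + b - 1) (x \<otimes> v n\<^sub>1 n\<^sub>2) = x \<otimes> v (n\<^sub>1 + a) (n\<^sub>2 + b)"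
    by (simp add: T_in_P add.commute)
  show "T (in_P (e a b)) n (x \<otimes> v n\<^sub>1 n\<^sub>2) = 0" if "n > a + b - 1"
    using *(2) that by (simp add: T_in_P)
qed

lemma heis_v_positive:
  assumes "i < 4" "n > 0"
  shows "T (in_P (heis i)) n (x \<otimes> v n\<^sub>1 n\<^sub>2) = 0"
  using G assms unfolding Pi_fock_module_def
  by (elim less_4_cases) (auto simp: heis_simps T_in_P)

lemma d_v:
  "T (in_P (d 1)) 0 (x \<otimes> v n\<^sub>1 n\<^sub>2) = (2 * (l\<^sub>1 + of_int n\<^sub>1)) *\<^sub>C (x \<otimes> v n\<^sub>1 n\<^sub>2)"
  "T (in_P (d 2)) 0 (x \<otimes> v n\<^sub>1 n\<^sub>2) = (2 * (l\<^sub>2 + of_int n\<^sub>2)) *\<^sub>C (x \<otimes> v n\<^sub>1 n\<^sub>2)"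
  using G unfolding Pi_fock_module_def by (simp_all add: T_in_P tens_scale_right)

lemma M_induct:
  assumes S: "cvs.subspace S" and v: "\<And>x n\<^sub>1 n\<^sub>2. x \<otimes> v n\<^sub>1 n\<^sub>2 \<in> S"
    and step: "\<And>i n z. i < 4 \<Longrightarrow> z \<in> S \<Longrightarrow> T (in_P (heis i)) (- int n - 1) z \<in> S"
  shows "z \<in> S"
proof (induction z rule: tensor_induct)
  case (tens x y)
  have "y \<in> {y. x \<otimes> y \<in> S}"
  proof (rule free_over_induct)
    show "free_over G [c 1, c 2, d 1, d 2] (\<lambda>(n\<^sub>1, n\<^sub>2). v n\<^sub>1 n\<^sub>2)"
      using G by (simp add: Pi_fock_module_def)
    show "cvs.subspace {y. x \<otimes> y \<in> S}"
      using S by (simp add: cvs.subspace_def tens_add_right tens_scale_right)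
    show "(case i of (n\<^sub>1, n\<^sub>2) \<Rightarrow> v n\<^sub>1 n\<^sub>2) \<in> {y. x \<otimes> y \<in> S}" for i
      by (cases i) (simp add: v)
    show "G ([c 1, c 2, d 1, d 2] ! j) (- int n - 1) y \<in> {y. x \<otimes> y \<in> S}"
      if "j < length [c 1, c 2, d 1, d 2]" "y \<in> {y. x \<otimes> y \<in> S}" for j n y
      using step[of j "x \<otimes> y" n] that by (simp add: T_in_P heis_def)
  qed
  then show ?case by simp
next
  case (add t u)
  then show ?case by (rule cvs.subspace_add[OF S])
qed

text \<open>Level \<open>Suc k\<close> is spanned by the words of at most k creation operators on
  vectors x \<otimes> v. Starting from {0} lets annihilation operators lower the level by one
  without exception.\<close>

primrec filtration :: "nat \<Rightarrow> ('r, 'q) tensor set"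
  where
    "filtration 0 = {0}"
  | "filtration (Suc k) = cvs.span ({x \<otimes> v n\<^sub>1 n\<^sub>2 | x n\<^sub>1 n\<^sub>2. True} \<union> filtration k \<union>
      {T (in_P (heis i)) (- int n - 1) z | i n z. i < 4 \<and> z \<in> filtration k})"

declare filtration.simps(2) [simp del]

lemma subspace_filtration: "cvs.subspace (filtration k)"
  by (cases k) (simp_all add: cvs.subspace_single_0 filtration.simps(2))

lemma filtration_Suc_mono: "filtration k \<subseteq> filtration (Suc k)"
  unfolding filtration.simps by (rule subsetI, rule cvs.span_base) blast

lemma filtration_mono: "k \<le> l \<Longrightarrow> filtration k \<subseteq> filtration l"
  by (rule lift_Suc_mono_le[of filtration, OF filtration_Suc_mono])

lemma v_in_filtration: "x \<otimes> v n\<^sub>1 n\<^sub>2 \<in> filtration (Suc k)"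
  unfolding filtration.simps by (rule cvs.span_base) blast

lemma filtration_heis:
  "i < 4 \<Longrightarrow> z \<in> filtration k \<Longrightarrow> T (in_P (heis i)) (- int n - 1) z \<in> filtration (Suc k)"
  unfolding filtration.simps by (rule cvs.span_base) blast

lemma filtration_Suc_induct [consumes 1, case_names subspace v lower heis]:
  assumes "z \<in> filtration (Suc k)" and "cvs.subspace {z. Q z}" and "\<And>x n\<^sub>1 n\<^sub>2. Q (x \<otimes> v n\<^sub>1 n\<^sub>2)"
    and "\<And>z. z \<in> filtration k \<Longrightarrow> Q z"
    and "\<And>i n z. i < 4 \<Longrightarrow> z \<in> filtration k \<Longrightarrow> Q (T (in_P (heis i)) (- int n - 1) z)"
  shows "Q z"
proof -
  have "filtration (Suc k) \<subseteq> {z. Q z}"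
    unfolding filtration.simps by (rule cvs.span_minimal) (use assms in blast)+
  with assms(1) show ?thesis by blast
qed

lemma in_some_filtration: "\<exists>k. z \<in> filtration k"
proof -
  have "z \<in> (\<Union>k. filtration k)"
  proof (rule M_induct)
    show "cvs.subspace (\<Union>k. filtration k)"
    proof (rule cvs.subspaceI)
      fix x y assume "x \<in> (\<Union>k. filtration k)" "y \<in> (\<Union>k. filtration k)"
      then obtain k l where "x \<in> filtration k" "y \<in> filtration l" by blast
      then have "x \<in> filtration (max k l)" "y \<in> filtration (max k l)"
        using filtration_mono[of k "max k l"] filtration_mono[of l "max k l"] by auto
      then show "x + y \<in> (\<Union>k. filtration k)"
        using cvs.subspace_add[OF subspace_filtration] by blast
    next
      show "0 \<in> (\<Union>k. filtration k)"
        using cvs.subspace_0[OF subspace_filtration] by blast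
      show "s *\<^sub>C x \<in> (\<Union>k. filtration k)" if "x \<in> (\<Union>k. filtration k)" for s x
        using that cvs.subspace_scale[OF subspace_filtration] by blast
    qed
    show "x \<otimes> v n\<^sub>1 n\<^sub>2 \<in> (\<Union>k. filtration k)" for x n\<^sub>1 n\<^sub>2
      using v_in_filtration[of x n\<^sub>1 n\<^sub>2 0] by blast
    show "T (in_P (heis i)) (- int n - 1) z \<in> (\<Union>k. filtration k)"
      if "i < 4" "z \<in> (\<Union>k. filtration k)" for i n z
    proof -
      from that(2) obtain k where "z \<in> filtration k" by blast
      from filtration_heis[OF that(1) this, of n] show ?thesis by blast
    qed
  qed
  then show ?thesis by blast
qed

lemma T_heis_commutator:
  assumes "i < 4" "j < 4"
  shows "T (in_P (heis i)) m (T (in_P (heis j)) n z) = T (in_P (heis j)) n (T (in_P (heis i)) m z) +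
    (if j = dual_index i \<and> m + n = 0 then (2 * of_int m) *\<^sub>C z else 0)"
  by (rule heis_commutator[OF T_in_P_module assms])

text \<open>An annihilation operator commutes with a creation operator up to a scalar and kills the
  vectors x \<otimes> v. Moved through a word, it can only delete a letter.\<close>

lemma filtration_annihilation:
  assumes "z \<in> filtration (Suc k)" "i < 4" "m > 0"
  shows "T (in_P (heis i)) m z \<in> filtration k"
  using assms(1)
proof (induction k arbitrary: z)
  case 0
  then show ?case
  proof (induction rule: filtration_Suc_induct)
    case subspace
    show ?case
      by (simp add: cvs.subspace_def clinear_zero[OF clinear_T] clinear_add[OF clinear_T] clinear_scale[OF clinear_T])
  qed (simp_all add: heis_v_positive[OF assms(2,3)] clinear_zero[OF clinear_T])
next
  case (Suc k)
  from Suc.prems show ?case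
  proof (induction rule: filtration_Suc_induct)
    case subspace
    show ?case
      using subspace_filtration[of "Suc k"]
      by (simp add: cvs.subspace_def clinear_zero[OF clinear_T] clinear_add[OF clinear_T] clinear_scale[OF clinear_T])
  next
    case (v x n\<^sub>1 n\<^sub>2)
    show ?case
      unfolding heis_v_positive[OF assms(2,3)] by (rule cvs.subspace_0[OF subspace_filtration])
  next
    case (lower z)
    show ?case using Suc.IH[OF lower] filtration_Suc_mono by blast
  next
    case (heis j n z)
    have "T (in_P (heis j)) (- int n - 1) (T (in_P (heis i)) m z) \<in> filtration (Suc k)"
      by (intro filtration_heis Suc.IH heis)
    moreover have "(if j = dual_index i \<and> m + (- int n - 1) = 0 then (2 * of_int m) *\<^sub>C z else 0) \<in> filtration (Suc k)"
      using cvs.subspace_scale[OF subspace_filtration heis(2)] cvs.subspace_0[OF subspace_filtration] by simp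
    ultimately show ?case
      unfolding T_heis_commutator[OF assms(2) heis(1)] by (rule cvs.subspace_add[OF subspace_filtration])
  qed
qed

text \<open>A number operator. The commutator of a dual pair of modes is 2 (m + 1), and the inverse
  coefficient makes each letter count once, whatever its mode. The cutoff K keeps the sum
  finite.\<close>

definition euler :: "nat \<Rightarrow> ('r, 'q) tensor \<Rightarrow> ('r, 'q) tensor"
  where "euler K z = (\<Sum>i<4. \<Sum>m<K. inverse (2 * of_nat (Suc m)) *\<^sub>C
    T (in_P (heis (dual_index i))) (- int m - 1) (T (in_P (heis i)) (int m + 1) z))"

lemma clinear_euler: "clinear (euler K)"
proof -
  have "clinear (\<lambda>z. \<Sum>i<4. \<Sum>m<K. inverse (2 * of_nat (Suc m)) *\<^sub>C
    T (in_P (heis (dual_index i))) (- int m - 1) (T (in_P (heis i)) (int m + 1) z))"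
    by (intro clinear_sum_fun clinear_scale_fun clinear_compose[OF clinear_T clinear_T])
  then show ?thesis by (simp only: euler_def[abs_def])
qed

lemma dual_index_less: "dual_index i < 4"
  by (simp add: dual_index_def)

lemma euler_filtration: "z \<in> filtration k \<Longrightarrow> euler K z \<in> filtration k"
proof (cases k)
  case (Suc l)
  assume "z \<in> filtration k"
  then have "T (in_P (heis i)) (int m + 1) z \<in> filtration l" if "i < 4" for i m
    using filtration_annihilation[of z l i "int m + 1"] Suc that by simp
  then show ?thesis
    unfolding euler_def Suc
    by (intro cvs.subspace_sum cvs.subspace_scale subspace_filtration filtration_heis dual_index_less) simp
qed (simp add: clinear_zero[OF clinear_euler])

text \<open>A single summand fails to commute with the creation operator, the one with i =
  \<open>dual_index j\<close> and m = n; its coefficient cancels the commutator 2 (n + 1).\<close>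

lemma euler_heis:
  assumes j: "j < 4" and n: "n < K"
  shows "euler K (T (in_P (heis j)) (- int n - 1) z) =
    T (in_P (heis j)) (- int n - 1) (euler K z) + T (in_P (heis j)) (- int n - 1) z"
proof -
  let ?H = "\<lambda>i. T (in_P (heis i))"
  have step: "?H (dual_index i) (- int m - 1) (?H i (int m + 1) (?H j (- int n - 1) z)) =
      ?H j (- int n - 1) (?H (dual_index i) (- int m - 1) (?H i (int m + 1) z)) +
      (if i = dual_index j then if m = n then (2 * of_nat (Suc m)) *\<^sub>C ?H j (- int n - 1) z else 0 else 0)"
    if i: "i < 4" for i m
  proof -
    have dual: "j = dual_index i \<longleftrightarrow> i = dual_index j"
      using i j by (elim less_4_cases) (simp_all add: dual_index_def)
    have "?H (dual_index i) (- int m - 1) (?H j (- int n - 1) y) = ?H j (- int n - 1) (?H (dual_index i) (- int m - 1) y)" for y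
      by (simp add: T_heis_commutator[OF dual_index_less j])
    moreover have "int m + 1 + (- int n - 1) = 0 \<longleftrightarrow> m = n" by auto
    ultimately show ?thesis
      using dual unfolding T_heis_commutator[OF i j]
      by (auto simp: clinear_add[OF clinear_T] clinear_scale[OF clinear_T] clinear_zero[OF clinear_T])
  qed
  have "euler K (?H j (- int n - 1) z) = (\<Sum>i<4. \<Sum>m<K. inverse (2 * of_nat (Suc m)) *\<^sub>C
      ?H j (- int n - 1) (?H (dual_index i) (- int m - 1) (?H i (int m + 1) z)) +
      (if i = dual_index j then if m = n then ?H j (- int n - 1) z else 0 else 0))"
    unfolding euler_def
  proof (intro sum.cong refl)
    fix i m :: nat assume "i \<in> {..<4}"
    then have i: "i < 4" by simp
    have "inverse (2 * of_nat (Suc m)) * (2 * of_nat (Suc m)) = (1 :: complex)"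
      by (rule left_inverse) (simp del: of_nat_Suc)
    then show "inverse (2 * of_nat (Suc m)) *\<^sub>C
        ?H (dual_index i) (- int m - 1) (?H i (int m + 1) (?H j (- int n - 1) z)) =
      inverse (2 * of_nat (Suc m)) *\<^sub>C
        ?H j (- int n - 1) (?H (dual_index i) (- int m - 1) (?H i (int m + 1) z)) +
      (if i = dual_index j then if m = n then ?H j (- int n - 1) z else 0 else 0)"
      unfolding step[OF i] by (simp add: scaleC_add_right scaleC_scaleC scaleC_one del: of_nat_Suc)
  qed
  also have "\<dots> = ?H j (- int n - 1) (euler K z) + (\<Sum>i<4. \<Sum>m<K.
      (if i = dual_index j then if m = n then ?H j (- int n - 1) z else 0 else 0))"
    by (simp add: sum.distrib euler_def clinear_sum[OF clinear_T] clinear_scale[OF clinear_T])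
  also have "(\<Sum>i<4. \<Sum>m<K. (if i = dual_index j then if m = n then ?H j (- int n - 1) z else 0 else 0)) =
      (\<Sum>i<4. if i = dual_index j then ?H j (- int n - 1) z else 0)"
    by (intro sum.cong refl) (use n in simp)
  also have "\<dots> = ?H j (- int n - 1) z"
    using dual_index_less by simp
  finally show ?thesis .
qed

lemma euler_v: "euler K (x \<otimes> v n\<^sub>1 n\<^sub>2) = 0"
  by (simp add: euler_def heis_v_positive clinear_zero[OF clinear_T])

text \<open>Every creation operator raises the eigenvalue by one, provided that K exceeds the modes
  occurring in z; this is why the bound on K depends on z.\<close>

lemma euler_eigenvalue:
  assumes "z \<in> filtration (Suc k)"
  shows "\<exists>K\<^sub>0. \<forall>K\<ge>K\<^sub>0. euler K z - of_nat k *\<^sub>C z \<in> filtration k"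
  using assms
proof (induction k arbitrary: z)
  case 0
  from 0 have "euler K z = 0" for K
  proof (induction rule: filtration_Suc_induct)
    case subspace
    show ?case
      by (simp add: cvs.subspace_def clinear_zero[OF clinear_euler] clinear_add[OF clinear_euler]
          clinear_scale[OF clinear_euler])
  qed (simp_all add: euler_v clinear_zero[OF clinear_T] clinear_zero[OF clinear_euler])
  then show ?case by simp
next
  case (Suc k)
  let ?X = "\<lambda>K z. euler K z - of_nat (Suc k) *\<^sub>C z"
  have lin: "clinear (?X K)" for K
    by (simp add: clinear_iff clinear_add[OF clinear_euler] clinear_scale[OF clinear_euler]
        scaleC_add_right cvs.scale_right_diff_distrib cvs.scale_left_commute)
  from Suc.prems have "\<exists>K\<^sub>0. \<forall>K\<ge>K\<^sub>0. ?X K z \<in> filtration (Suc k)"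
  proof (induction rule: filtration_Suc_induct)
    case subspace
    show ?case
    proof (rule cvs.subspaceI)
      show "0 \<in> {z. \<exists>K\<^sub>0. \<forall>K\<ge>K\<^sub>0. ?X K z \<in> filtration (Suc k)}"
        using cvs.subspace_0[OF subspace_filtration] by (simp add: clinear_zero[OF clinear_euler])
    next
      fix y z
      assume "y \<in> {z. \<exists>K\<^sub>0. \<forall>K\<ge>K\<^sub>0. ?X K z \<in> filtration (Suc k)}" "z \<in> {z. \<exists>K\<^sub>0. \<forall>K\<ge>K\<^sub>0. ?X K z \<in> filtration (Suc k)}"
      then obtain K\<^sub>1 K\<^sub>2 where "\<forall>K\<ge>K\<^sub>1. ?X K y \<in> filtration (Suc k)" "\<forall>K\<ge>K\<^sub>2. ?X K z \<in> filtration (Suc k)"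
        by blast
      then have "\<forall>K\<ge>max K\<^sub>1 K\<^sub>2. ?X K (y + z) \<in> filtration (Suc k)"
        unfolding clinear_add[OF lin] using cvs.subspace_add[OF subspace_filtration] by simp
      then show "y + z \<in> {z. \<exists>K\<^sub>0. \<forall>K\<ge>K\<^sub>0. ?X K z \<in> filtration (Suc k)}" by blast
    next
      fix s z assume "z \<in> {z. \<exists>K\<^sub>0. \<forall>K\<ge>K\<^sub>0. ?X K z \<in> filtration (Suc k)}"
      then show "s *\<^sub>C z \<in> {z. \<exists>K\<^sub>0. \<forall>K\<ge>K\<^sub>0. ?X K z \<in> filtration (Suc k)}"
        unfolding mem_Collect_eq clinear_scale[OF lin] using cvs.subspace_scale[OF subspace_filtration] by blast
    qed
  next
    case (v x n\<^sub>1 n\<^sub>2)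
    show ?case
      unfolding euler_v
      by (intro exI allI impI cvs.subspace_diff cvs.subspace_scale cvs.subspace_0 subspace_filtration v_in_filtration)
  next
    case (lower z)
    then show ?case
      by (intro exI allI impI cvs.subspace_diff cvs.subspace_scale euler_filtration subspace_filtration)
  next
    case (heis i n z)
    then obtain K\<^sub>0 where K\<^sub>0: "\<forall>K\<ge>K\<^sub>0. euler K z - of_nat k *\<^sub>C z \<in> filtration k"
      using Suc.IH by blast
    let ?h = "T (in_P (heis i)) (- int n - 1)"
    have "?X K (?h z) \<in> filtration (Suc k)" if "K \<ge> max K\<^sub>0 (Suc n)" for K
    proof -
      have "?X K (?h z) = ?h (euler K z - of_nat k *\<^sub>C z)"
        using euler_heis[OF heis(1), of n K z] that
        by (simp add: clinear_diff[OF clinear_T] clinear_scale[OF clinear_T] scaleC_add_left scaleC_one)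
      then show ?thesis
        using filtration_heis[OF heis(1)] K\<^sub>0 that by simp
    qed
    then show ?case by blast
  qed
  then show ?case .
qed

text \<open>A shortest vector of \<open>N\<close> is killed by the annihilation operators, hence by the Euler operator,
  which acts on words of length \<open>k\<close> by \<open>k\<close> up to shorter ones.\<close>

lemma exists_v_in_stable_subspace:
  assumes N: "cvs.subspace N" "N \<noteq> {0}"
    and heis: "\<And>i. i < 4 \<Longrightarrow> in_P (heis i) \<in> stabilizer T N"
  shows "\<exists>x n\<^sub>1 n\<^sub>2. x \<otimes> v n\<^sub>1 n\<^sub>2 \<in> N \<and> x \<otimes> v n\<^sub>1 n\<^sub>2 \<noteq> 0"
proof -
  obtain z\<^sub>0 where z\<^sub>0: "z\<^sub>0 \<in> N" "z\<^sub>0 \<noteq> 0"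
    using N cvs.subspace_0[OF N(1)] by blast
  define k where "k = (LEAST k. \<exists>z\<in>N \<inter> filtration k. z \<noteq> 0)"
  have "\<exists>k. \<exists>z\<in>N \<inter> filtration k. z \<noteq> 0"
    using in_some_filtration[of z\<^sub>0] z\<^sub>0 by blast
  then have "\<exists>z\<in>N \<inter> filtration k. z \<noteq> 0"
    unfolding k_def by (rule LeastI_ex)
  then obtain z where z: "z \<in> N" "z \<in> filtration k" "z \<noteq> 0" by blast
  have minimal: "y = 0" if "y \<in> N" "y \<in> filtration l" "l < k" for y l
    using not_less_Least[of l "\<lambda>k. \<exists>z\<in>N \<inter> filtration k. z \<noteq> 0"] that unfolding k_def by blast
  obtain l where l: "k = Suc l" using z by (cases k) auto
  have "T (in_P (heis i)) (int m + 1) z = 0" if "i < 4" for i m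
    by (rule minimal[of _ l]) (use z l that heis in \<open>auto intro!: filtration_annihilation stabilizerD[OF heis]\<close>)
  then have "euler K z = 0" for K
    by (simp add: euler_def clinear_zero[OF clinear_T])
  with euler_eigenvalue[of z l] z l have "- (of_nat l *\<^sub>C z) \<in> filtration l" by auto
  then have "of_nat l *\<^sub>C z \<in> filtration l"
    using cvs.subspace_neg[OF subspace_filtration] by fastforce
  then have "of_nat l *\<^sub>C z = 0"
    by (rule minimal[OF cvs.subspace_scale[OF N(1) z(1)]]) (simp add: l)
  with z(3) have "l = 0" by simp
  with z(2) l have "z \<in> filtration (Suc 0)" by simp
  let ?S = "{z :: ('r, 'q) tensor. \<exists>A x. finite A \<and> z = (\<Sum>p\<in>A. x p \<otimes> v (fst p) (snd p))}"
  from \<open>z \<in> filtration (Suc 0)\<close> have "\<exists>A x. finite A \<and> z = (\<Sum>p\<in>A. x p \<otimes> v (fst p) (snd p))"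
  proof (induction rule: filtration_Suc_induct)
    case subspace
    show ?case
    proof (rule cvs.subspaceI)
      show "0 \<in> ?S"
        by (auto intro: exI[of _ "{}"])
    next
      fix y z
      assume "y \<in> ?S"
        "z \<in> ?S"
      then obtain A x B x' where A: "finite A" "y = (\<Sum>p\<in>A. x p \<otimes> v (fst p) (snd p))"
        and B: "finite B" "z = (\<Sum>p\<in>B. x' p \<otimes> v (fst p) (snd p))" by blast
      have "y = (\<Sum>p\<in>A \<union> B. (if p \<in> A then x p else 0) \<otimes> v (fst p) (snd p))"
        unfolding A by (rule sum.mono_neutral_cong_left) (use A B in auto)
      moreover have "z = (\<Sum>p\<in>A \<union> B. (if p \<in> B then x' p else 0) \<otimes> v (fst p) (snd p))"
        unfolding B by (rule sum.mono_neutral_cong_left) (use A B in auto)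
      ultimately have "y + z = (\<Sum>p\<in>A \<union> B. ((if p \<in> A then x p else 0) + (if p \<in> B then x' p else 0)) \<otimes> v (fst p) (snd p))"
        by (simp only: tens_add_left sum.distrib)
      then show "y + z \<in> ?S"
        using finite_UnI[OF A(1) B(1)] by (intro CollectI exI conjI)
    next
      fix s z
      assume "z \<in> ?S"
      then obtain A x where A: "finite A" "z = (\<Sum>p\<in>A. x p \<otimes> v (fst p) (snd p))" by blast
      then have "s *\<^sub>C z = (\<Sum>p\<in>A. (s *\<^sub>C x p) \<otimes> v (fst p) (snd p))"
        by (simp add: cvs.scale_sum_right tens_scale_left)
      with A(1) show "s *\<^sub>C z \<in> ?S" by (intro CollectI exI conjI)
    qed
  next
    case (v x n\<^sub>1 n\<^sub>2)
    show ?case by (rule exI[of _ "{(n\<^sub>1, n\<^sub>2)}"]) auto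
  qed (auto simp: clinear_zero[OF clinear_T] intro: exI[of _ "{}"])
  then obtain A x where A: "finite A" "z = (\<Sum>p\<in>A. x p \<otimes> v (fst p) (snd p))" by blast
  \<comment> \<open>A single operator separating all exponentials: its eigenvalues at two pairs of
    integers differ by 2 (s + \<i> t), where s and t are the integer differences, and this is
    nonzero for distinct pairs.\<close>
  define X where "X z = T (in_P (d 1)) 0 z + \<i> *\<^sub>C T (in_P (d 2)) 0 z" for z
  define \<mu> where "\<mu> p = 2 * (l\<^sub>1 + of_int (fst p)) + \<i> * (2 * (l\<^sub>2 + of_int (snd p)))" for p :: "int \<times> int"
  have comp: "x p \<otimes> v (fst p) (snd p) \<in> N" if "p \<in> A" for p
  proof (rule eigencomponents_in_subspace[where X = X and \<mu> = \<mu> and A = A and u = "\<lambda>p. x p \<otimes> v (fst p) (snd p)"])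
    show "clinear X"
      by (simp add: X_def clinear_iff clinear_add[OF clinear_T] clinear_scale[OF clinear_T] scaleC_add_right
          cvs.scale_left_commute)
    show "X z \<in> N" if "z \<in> N" for z
      unfolding X_def using heis[of 2] heis[of 3] that
      by (intro cvs.subspace_add[OF N(1)] cvs.subspace_scale[OF N(1)]) (auto simp: heis_simps stabilizer_def)
    show "X (x p \<otimes> v (fst p) (snd p)) = \<mu> p *\<^sub>C (x p \<otimes> v (fst p) (snd p))" for p
      by (simp only: X_def \<mu>_def d_v scaleC_add_left scaleC_scaleC)
    show "inj_on \<mu> A"
    proof (rule inj_onI)
      fix p q assume "\<mu> p = \<mu> q"
      then show "p = q" by (simp add: \<mu>_def complex_eq_iff prod_eq_iff)
    qed
    show "(\<Sum>p\<in>A. x p \<otimes> v (fst p) (snd p)) \<in> N" using A z(1) by simp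
  qed (use A N that in auto)
  moreover have "\<exists>p\<in>A. x p \<otimes> v (fst p) (snd p) \<noteq> 0"
  proof (rule ccontr)
    assume "\<not> ?thesis"
    then have "z = 0" unfolding A by (intro sum.neutral) blast
    with z(3) show False by simp
  qed
  ultimately show ?thesis by blast
qed

text \<open>For a fixed exponential, the x with x \<otimes> v in N form a W-submodule of R, which is
  nonzero for a suitable exponential and hence all of R. The fields e^{a c_1 + b c_2} reach the
  other exponentials and the creation operators the rest.\<close>

theorem stable_subspace_trivial:
  assumes N: "cvs.subspace N"
    and W: "\<And>w. in_W w \<in> stabilizer T N" and heis: "\<And>i. i < 4 \<Longrightarrow> in_P (heis i) \<in> stabilizer T N"
    and e: "\<And>a b. in_P (e a b) \<in> stabilizer T N"
  shows "N = {0} \<or> N = UNIV"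
proof (cases "N = {0}")
  case False
  then obtain x n\<^sub>1 n\<^sub>2 where x: "x \<otimes> v n\<^sub>1 n\<^sub>2 \<in> N" "x \<otimes> v n\<^sub>1 n\<^sub>2 \<noteq> 0"
    using exists_v_in_stable_subspace[OF N False heis] by blast
  let ?S = "{x. x \<otimes> v n\<^sub>1 n\<^sub>2 \<in> N}"
  have sub: "cvs.subspace ?S"
    using N by (simp add: cvs.subspace_def tens_add_left tens_scale_left)
  have "\<forall>N. cvs.subspace N \<and> (\<forall>w n. \<forall>y\<in>N. F w n y \<in> N) \<longrightarrow> N = {0} \<or> N = UNIV"
    by (rule conjunct2[OF conjunct2[OF F[unfolded va_irreducible_def]]])
  moreover have "\<forall>w n. \<forall>y\<in>?S. F w n y \<in> ?S"
  proof (intro allI ballI)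
    fix w n y assume "y \<in> ?S"
    then show "F w n y \<in> ?S"
      using stabilizerD[OF W[of w], of "y \<otimes> v n\<^sub>1 n\<^sub>2" n] by (simp add: T_in_W)
  qed
  ultimately have "?S = {0} \<or> ?S = UNIV" using sub by (elim allE[of _ ?S]) simp
  moreover have "?S \<noteq> {0}"
  proof
    assume "?S = {0}"
    with x(1) have "x \<in> {0}" by blast
    with x(2) show False by simp
  qed
  ultimately have S: "?S = UNIV" by simp
  have v: "y \<otimes> v m\<^sub>1 m\<^sub>2 \<in> N" for y m\<^sub>1 m\<^sub>2
  proof -
    have "y \<in> ?S" unfolding S by simp
    then have "y \<otimes> v n\<^sub>1 n\<^sub>2 \<in> N" by simp
    from stabilizerD[OF e this, of "m\<^sub>1 - n\<^sub>1" "m\<^sub>2 - n\<^sub>2" "m\<^sub>1 - n\<^sub>1 + (m\<^sub>2 - n\<^sub>2) - 1"]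
    show ?thesis unfolding shift_v by simp
  qed
  have "z \<in> N" for z
    by (rule M_induct[OF N v]) (use heis in \<open>auto simp: stabilizer_def\<close>)
  then show ?thesis by blast
qed simp

end

section \<open>Zero modes of the exponentials\<close>

context fock_tensor
begin

text \<open>On pure tensors the operator acts in the second factor only, where nilpotency is known;
  the generalized kernel is a subspace and so contains their sums.\<close>

lemma in_P_e_nilpotent: "\<exists>J. (np (in_P (e a b)) 0 ^^ J) t = 0"
proof -
  let ?U = "np (in_P (e a b)) 0" and ?S = "upper_closure (np (in_P (e a b)) 0) {0}"
  have lin: "clinear ?U"
    by (rule va_module_clinear_right[OF va_module_tensor[OF W_module P_module W_module P_module]])
  have sub: "cvs.subspace ?S"
    by (rule subspace_upper_closure[OF lin cvs.subspace_single_0]) (simp add: clinear_zero[OF lin])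
  have "t \<in> ?S"
  proof (induction t rule: tensor_induct)
    case (tens w p)
    have pow: "(?U ^^ J) (w \<otimes> p) = w \<otimes> (nprod P (e a b) 0 ^^ J) p" for J
      by (induction J) (simp_all add: np_in_P)
    obtain J where "(nprod P (e a b) 0 ^^ J) p = 0" using e_zero_mode_nilpotent by blast
    then have "(?U ^^ J) (w \<otimes> p) = 0" by (simp add: pow)
    then show ?case unfolding upper_closure_def by blast
  next
    case (add t u)
    then show ?case by (rule cvs.subspace_add[OF sub])
  qed
  then show ?thesis by (simp add: upper_closure_def)
qed

lemma stabilizer_T_upper_closure:
  assumes N: "cvs.subspace N" and u: "in_P (e a b) \<in> stabilizer T N"
    and t: "\<And>j. (np (in_P (e a b)) 0 ^^ j) t \<in> stabilizer T N"
  shows "t \<in> stabilizer T (upper_closure (T (in_P (e a b)) 0) N)"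
  using in_P_e_nilpotent[of a b t] stabilizer_upper_closure[OF T_module N u, of t] t by auto

lemma stabilizer_T_lower_core:
  assumes N: "cvs.subspace N" and u: "in_P (e a b) \<in> stabilizer T N" and inj: "inj (T (in_P (e a b)) 0)"
    and t: "\<And>j. (np (in_P (e a b)) 0 ^^ j) t \<in> stabilizer T N"
  shows "t \<in> stabilizer T (lower_core (T (in_P (e a b)) 0) N)"
  using in_P_e_nilpotent[of a b t] stabilizer_lower_core[OF T_module N u inj, of t] t by auto

lemma e_zero_mode_power_v:
  assumes "a + b = 1"
  shows "(T (in_P (e a b)) 0 ^^ k) (x \<otimes> v n\<^sub>1 n\<^sub>2) = x \<otimes> v (n\<^sub>1 + int k * a) (n\<^sub>2 + int k * b)"
proof (induction k)
  case (Suc k)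
  have "T (in_P (e a b)) 0 (x \<otimes> v m\<^sub>1 m\<^sub>2) = x \<otimes> v (m\<^sub>1 + a) (m\<^sub>2 + b)" for m\<^sub>1 m\<^sub>2
    using shift_v[of a b x m\<^sub>1 m\<^sub>2] assms by simp
  then show ?case by (simp add: Suc algebra_simps)
qed simp

lemma inj_e_zero_mode:
  assumes ab: "a + b = 1"
  shows "inj (T (in_P (e a b)) 0)"
proof -
  let ?E = "T (in_P (e a b)) 0" and ?C = "upper_closure (T (in_P (e a b)) 0) {0}"
  have stab: "t \<in> stabilizer T {0}" for t
    by (simp add: stabilizer_def clinear_zero[OF clinear_T])
  have C: "t \<in> stabilizer T ?C" for t
    by (rule stabilizer_T_upper_closure[OF cvs.subspace_single_0 stab stab])
  have "cvs.subspace ?C"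
    by (rule subspace_upper_closure[OF clinear_T cvs.subspace_single_0]) (simp add: clinear_zero[OF clinear_T])
  then have "?C = {0} \<or> ?C = UNIV"
    by (rule stable_subspace_trivial) (rule C)+
  moreover have "?C \<noteq> UNIV"
  proof
    assume univ: "?C = UNIV"
    have "(UNIV :: ('r, 'q) tensor set) \<noteq> {0}" using nontrivial by auto
    from exists_v_in_stable_subspace[OF cvs.subspace_UNIV this]
    obtain x :: 'r and n\<^sub>1 n\<^sub>2 where x: "x \<otimes> v n\<^sub>1 n\<^sub>2 \<noteq> 0"
      by (auto simp: stabilizer_def)
    have "x \<otimes> v n\<^sub>1 n\<^sub>2 \<in> ?C" unfolding univ by simp
    then obtain k where k: "x \<otimes> v (n\<^sub>1 + int k * a) (n\<^sub>2 + int k * b) = 0"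
      unfolding upper_closure_def by (auto simp: e_zero_mode_power_v[OF ab])
    \<comment> \<open>A mode of the exponential with opposite exponent shifts back, so no power of
      the zero mode kills a nonzero x \<otimes> v.\<close>
    have "x \<otimes> v n\<^sub>1 n\<^sub>2 = T (in_P (e (- (int k * a)) (- (int k * b)))) (- (int k * a) + - (int k * b) - 1)
        (x \<otimes> v (n\<^sub>1 + int k * a) (n\<^sub>2 + int k * b))"
      unfolding shift_v by simp
    also have "\<dots> = 0" unfolding k by (rule clinear_zero[OF clinear_T])
    finally show False using x by simp
  qed
  ultimately have C0: "?C = {0}" by simp
  show ?thesis
  proof (rule injI)
    fix y z assume "?E y = ?E z"
    then have "(?E ^^ 1) (y - z) = 0" by (simp add: clinear_diff[OF clinear_T])
    then have "y - z \<in> ?C" unfolding upper_closure_def by blast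
    with C0 show "y = z" by simp
  qed
qed

text \<open>Every x \<otimes> v is a k-fold shift for all k, so it lies in the intersection of the
  images. The creation operators, under which injectivity makes this intersection stable, produce
  all of M.\<close>

lemma surj_e_zero_mode:
  assumes ab: "a + b = 1"
  shows "surj (T (in_P (e a b)) 0)"
proof -
  let ?E = "T (in_P (e a b)) 0"
  let ?C = "lower_core ?E UNIV"
  have stab: "t \<in> stabilizer T UNIV" for t
    by (simp add: stabilizer_def)
  have C: "t \<in> stabilizer T ?C" for t
    by (rule stabilizer_T_lower_core[OF cvs.subspace_UNIV stab inj_e_zero_mode[OF ab] stab])
  have "z \<in> ?C" for z
  proof (rule M_induct)
    show "cvs.subspace ?C" by (rule subspace_lower_core[OF clinear_T cvs.subspace_UNIV])
    show "x \<otimes> v n\<^sub>1 n\<^sub>2 \<in> ?C" for x n\<^sub>1 n\<^sub>2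
    proof -
      have "x \<otimes> v n\<^sub>1 n\<^sub>2 = (?E ^^ k) (x \<otimes> v (n\<^sub>1 - int k * a) (n\<^sub>2 - int k * b))" for k
        by (simp add: e_zero_mode_power_v[OF ab])
      then show ?thesis unfolding lower_core_def by blast
    qed
    show "T (in_P (heis i)) (- int n - 1) z \<in> ?C" if "z \<in> ?C" for i n z
      by (rule stabilizerD[OF C that])
  qed
  then have "\<exists>y. z = (?E ^^ 1) y" for z
    unfolding lower_core_def by blast
  then show ?thesis by auto
qed

text \<open>The vectors killed by every product of D positive modes of u. The depth controls how
  long the recursion for the modes of the inverse exponential runs.\<close>

primrec depth :: "'p \<Rightarrow> nat \<Rightarrow> ('r, 'q) tensor set"
  where
    "depth u 0 = {0}"
  | "depth u (Suc D) = {z. \<forall>j>0. T (in_P u) j z \<in> depth u D}"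

lemma subspace_depth: "cvs.subspace (depth u D)"
proof (induction D)
  case (Suc D)
  then show ?case
    by (simp add: cvs.subspace_def clinear_zero[OF clinear_T] clinear_add[OF clinear_T] clinear_scale[OF clinear_T])
qed (simp add: cvs.subspace_single_0)

lemma depth_Suc_mono: "depth u D \<subseteq> depth u (Suc D)"
  by (induction D) (auto simp: clinear_zero[OF clinear_T])

lemma depth_mono: "D \<le> D' \<Longrightarrow> depth u D \<subseteq> depth u D'"
  by (rule lift_Suc_mono_le[of "depth u", OF depth_Suc_mono])

lemma depth_e: "z \<in> depth (e a b) D \<Longrightarrow> T (in_P (e a' b')) n z \<in> depth (e a b) D"
proof (induction D arbitrary: z)
  case (Suc D)
  then show ?case
    by (simp add: e_commute[OF T_in_P_module, of a b])
qed (simp add: clinear_zero[OF clinear_T])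

text \<open>The commutator with a Heisenberg mode is again a mode of the exponential, and by
  \<open>depth_e\<close> this does not increase the depth. Each Heisenberg mode therefore costs at
  most one level.\<close>

lemma depth_heis:
  assumes "i < 4"
  shows "z \<in> depth (e a b) D \<Longrightarrow> T (in_P (heis i)) n z \<in> depth (e a b) (Suc D)"
proof (induction D arbitrary: z)
  case 0
  then show ?case by (simp add: clinear_zero[OF clinear_T])
next
  case (Suc D)
  show ?case
    unfolding depth.simps(2)[of _ "Suc D"]
  proof (intro CollectI allI impI)
    fix j :: int assume j: "j > 0"
    have "T (in_P (e a b)) j (T (in_P (heis i)) n z) = T (in_P (heis i)) n (T (in_P (e a b)) j z)
        - charge i a b *\<^sub>C T (in_P (e a b)) (n + j) z"
      by (simp add: heis_e_commutator[OF T_in_P_module assms])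
    moreover have "T (in_P (heis i)) n (T (in_P (e a b)) j z) \<in> depth (e a b) (Suc D)"
      using Suc.prems j by (intro Suc.IH) simp
    moreover have "T (in_P (e a b)) (n + j) z \<in> depth (e a b) (Suc D)"
      by (rule depth_e[OF Suc.prems])
    ultimately show "T (in_P (e a b)) j (T (in_P (heis i)) n z) \<in> depth (e a b) (Suc D)"
      by (simp only: cvs.subspace_diff[OF subspace_depth] cvs.subspace_scale[OF subspace_depth])
  qed
qed

lemma in_some_depth:
  assumes ab: "a + b = 1"
  shows "\<exists>D. z \<in> depth (e a b) D"
proof -
  have "z \<in> (\<Union>D. depth (e a b) D)"
  proof (rule M_induct)
    show "cvs.subspace (\<Union>D. depth (e a b) D)"
    proof (rule cvs.subspaceI)
      show "0 \<in> (\<Union>D. depth (e a b) D)"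
        using cvs.subspace_0[OF subspace_depth] by blast
      show "s *\<^sub>C x \<in> (\<Union>D. depth (e a b) D)" if "x \<in> (\<Union>D. depth (e a b) D)" for s x
        using that cvs.subspace_scale[OF subspace_depth] by blast
      fix x y assume "x \<in> (\<Union>D. depth (e a b) D)" "y \<in> (\<Union>D. depth (e a b) D)"
      then obtain k l where "x \<in> depth (e a b) k" "y \<in> depth (e a b) l" by blast
      then have "x \<in> depth (e a b) (max k l)" "y \<in> depth (e a b) (max k l)"
        using depth_mono[of k "max k l"] depth_mono[of l "max k l"] by auto
      then show "x + y \<in> (\<Union>D. depth (e a b) D)"
        using cvs.subspace_add[OF subspace_depth] by blast
    qed
    show "x \<otimes> v n\<^sub>1 n\<^sub>2 \<in> (\<Union>D. depth (e a b) D)" for x n\<^sub>1 n\<^sub>2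
    proof -
      have "x \<otimes> v n\<^sub>1 n\<^sub>2 \<in> depth (e a b) (Suc 0)" using ab by (simp add: shift_v_above)
      then show ?thesis by blast
    qed
    show "T (in_P (heis i)) (- int n - 1) z \<in> (\<Union>D. depth (e a b) D)"
      if "i < 4" "z \<in> (\<Union>D. depth (e a b) D)" for i n z
    proof -
      from that(2) obtain D where "z \<in> depth (e a b) D" by blast
      from depth_heis[OF that(1) this, of "- int n - 1"] show ?thesis by blast
    qed
  qed
  then show ?thesis by blast
qed

text \<open>The equation $e^\alpha(z)e^{-\alpha}(z)=1$ determines the modes of $e^{-\alpha}$ recursively once
  $e^\alpha_{(0)}$ can be divided by; the recursion ends because $e^\alpha_{(j)}$, $j>0$, are jointly
  locally nilpotent.\<close>

lemma inverse_exponential_in_stabilizer: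
  assumes ab: "a + b = 1" and N: "cvs.subspace N"
    and u: "in_P (e a b) \<in> stabilizer T N" and inv: "\<And>z. T (in_P (e a b)) 0 z \<in> N \<Longrightarrow> z \<in> N"
  shows "in_P (e (- a) (- b)) \<in> stabilizer T N"
proof -
  let ?u = "T (in_P (e a b))" and ?u' = "T (in_P (e (- a) (- b)))"
  have "\<forall>z\<in>N \<inter> depth (e a b) D. \<forall>n. ?u' n z \<in> N" for D
  proof (induction D)
    case 0
    show ?case by (simp add: clinear_zero[OF clinear_T] cvs.subspace_0[OF N])
  next
    case (Suc D)
    show ?case
    proof (intro ballI allI)
      fix z n assume z: "z \<in> N \<inter> depth (e a b) (Suc D)"
      obtain n\<^sub>0 where n\<^sub>0: "\<And>n. n \<ge> n\<^sub>0 \<Longrightarrow> ?u' n z = 0"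
        using va_module_truncation[OF T_in_P_module] by blast
      \<comment> \<open>Descending induction on the mode index, starting where the modes of the
        inverse exponential vanish on z.\<close>
      have "?u' (n\<^sub>0 - int k) z \<in> N" for k
      proof (induction k rule: less_induct)
        case (less k)
        let ?n = "n\<^sub>0 - int k"
        \<comment> \<open>These are the terms of the mode ?n + 1 of the normally ordered product of
          the two exponentials, which is the vacuum. The unknown mode ?n on z enters only through
          \<open>f 0\<close>, as ?u' ?n (?u 0 z) = ?u 0 (?u' ?n z).\<close>
        define f where "f j = ?u (- 1 - int j) (?u' (?n + 1 + int j) z) + ?u' (?n - int j) (?u (int j) z)" for j
        have higher: "?u' (?n + 1 + int j) z \<in> N" for j
        proof (cases "j < k")
          case True
          then show ?thesis using less[of "k - 1 - j"] by (simp add: of_nat_diff algebra_simps)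
        next
          case False
          then show ?thesis using n\<^sub>0[of "?n + 1 + int j"] cvs.subspace_0[OF N] by simp
        qed
        have f: "?u (- 1 - int j) (?u' (?n + 1 + int j) z) \<in> N" for j
          by (rule stabilizerD[OF u higher])
        \<comment> \<open>Here modes of index below ?n occur, but they act on a vector of smaller
          depth, for which all modes are already settled.\<close>
        have g: "?u' (?n - int j) (?u (int j) z) \<in> N" if "j > 0" for j
        proof -
          have "?u (int j) z \<in> N" using stabilizerD[OF u] z by blast
          moreover have "?u (int j) z \<in> depth (e a b) D" using z that by simp
          ultimately show ?thesis using Suc by blast
        qed
        have f_pos: "f (Suc j) \<in> N" for j
          unfolding f_def by (rule cvs.subspace_add[OF N f g]) simp
        obtain K where K: "\<And>j. int j \<ge> K \<Longrightarrow> ?u (int j) z = 0"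
          using va_module_truncation[OF T_in_P_module, of "e a b" z] by blast
        have "f j = 0" if "j \<ge> Suc (nat (max K (n\<^sub>0 - ?n)))" for j
          using that K[of j] n\<^sub>0[of "?n + 1 + int j"] unfolding f_def
          by (simp add: clinear_zero[OF clinear_T])
        then have "Sum_any f = (\<Sum>j<Suc (nat (max K (n\<^sub>0 - ?n))). f j)"
          by (rule Sum_any_eq_sum_lessThan)
        moreover have "Sum_any f = T (in_P (vacuum P)) (?n + 1) z"
          using va_module_iterate_minus_one[OF T_in_P_module, of "e a b" "e (- a) (- b)" "?n + 1" z]
          by (simp add: e_e_minus_one e_zero f_def[abs_def])
        ultimately have "f 0 = T (in_P (vacuum P)) (?n + 1) z - (\<Sum>j<nat (max K (n\<^sub>0 - ?n)). f (Suc j))"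
          by (simp only: sum.lessThan_Suc_shift) simp
        moreover have "T (in_P (vacuum P)) (?n + 1) z \<in> N"
          using z cvs.subspace_0[OF N] by (simp add: va_module_vacuum[OF T_in_P_module])
        ultimately have "f 0 \<in> N"
          using f_pos by (simp only: cvs.subspace_diff[OF N] cvs.subspace_sum[OF N])
        moreover have "?u 0 (?u' ?n z) = f 0 - ?u (- 1 - int 0) (?u' (?n + 1 + int 0) z)"
          by (simp add: f_def e_commute[OF T_in_P_module, of a b])
        ultimately have "?u 0 (?u' ?n z) \<in> N"
          using f[of 0] by (simp only: cvs.subspace_diff[OF N])
        then show ?case by (rule inv)
      qed
      from this[of "nat (n\<^sub>0 - n)"] n\<^sub>0[of n] show "?u' n z \<in> N"
        using cvs.subspace_0[OF N] by (cases "n \<ge> n\<^sub>0") simp_all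
    qed
  qed
  with in_some_depth[OF ab] show ?thesis by (blast intro: stabilizerI)
qed

end

section \<open>Inverting the free field realization\<close>

lemma (in fock_tensor) stabilizer_closed:
  assumes "cvs.subspace N"
  shows stabilizer_add: "s \<in> stabilizer T N \<Longrightarrow> t \<in> stabilizer T N \<Longrightarrow> s + t \<in> stabilizer T N"
    and stabilizer_diff: "s \<in> stabilizer T N \<Longrightarrow> t \<in> stabilizer T N \<Longrightarrow> s - t \<in> stabilizer T N"
    and stabilizer_minus: "t \<in> stabilizer T N \<Longrightarrow> - t \<in> stabilizer T N"
    and stabilizer_scale: "t \<in> stabilizer T N \<Longrightarrow> a *\<^sub>C t \<in> stabilizer T N"
    and stabilizer_np: "s \<in> stabilizer T N \<Longrightarrow> t \<in> stabilizer T N \<Longrightarrow> np s n t \<in> stabilizer T N"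
    and stabilizer_vacuum: "vacuum W \<otimes> vacuum P \<in> stabilizer T N"
  using subspace_stabilizer[OF T_module assms] nprod_in_stabilizer[OF T_module assms]
    vacuum_in_stabilizer[OF T_module assms]
  by (simp_all add: cvs.subspace_add cvs.subspace_diff cvs.subspace_neg cvs.subspace_scale)

lemma (in fock_tensor) stabilizer_in_P:
  assumes "cvs.subspace N"
  shows stabilizer_in_P_nprod: "in_P p \<in> stabilizer T N \<Longrightarrow> in_P q \<in> stabilizer T N \<Longrightarrow> in_P (nprod P p n q) \<in> stabilizer T N"
    and stabilizer_in_P_deriv: "in_P p \<in> stabilizer T N \<Longrightarrow> in_P (va_deriv P p) \<in> stabilizer T N"
    and stabilizer_tens: "in_W w \<in> stabilizer T N \<Longrightarrow> in_P p \<in> stabilizer T N \<Longrightarrow> w \<otimes> p \<in> stabilizer T N"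
  using stabilizer_np[OF assms, of "in_P p" "in_P q" n] stabilizer_vacuum[OF assms]
    stabilizer_np[OF assms, of "in_P p" "in_P (vacuum P)" "-2"]
    stabilizer_np[OF assms, of "in_P p" "in_W w" "-1"] P_vertex_algebra
  by (simp_all add: np_in_P va_deriv_def vertex_algebra_def)

lemmas in_P_add = clinear_add[OF clinear_tens_right]
  and in_P_diff = clinear_diff[OF clinear_tens_right]
  and in_P_scale = clinear_scale[OF clinear_tens_right]

lemma (in fock_tensor) stabilizer_exponentials:
  assumes N: "cvs.subspace N"
    and e: "in_P (e 1 0) \<in> stabilizer T N" "in_P (e (-1) 0) \<in> stabilizer T N"
      "in_P (e 0 1) \<in> stabilizer T N" "in_P (e 0 (-1)) \<in> stabilizer T N"
  shows "in_P (e a b) \<in> stabilizer T N"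
proof -
  have e0: "in_P (e 0 0) \<in> stabilizer T N"
    by (simp add: e_zero stabilizer_vacuum[OF N])
  have mult: "in_P (e a b) \<in> stabilizer T N \<Longrightarrow> in_P (e a' b') \<in> stabilizer T N \<Longrightarrow>
      in_P (e (a + a') (b + b')) \<in> stabilizer T N" for a b a' b'
    using stabilizer_in_P_nprod[OF N, of "e a b" "e a' b'" "-1"] by (simp add: e_e_minus_one)
  have pow: "in_P (e (int n * a) (int n * b)) \<in> stabilizer T N" if "in_P (e a b) \<in> stabilizer T N" for n a b
  proof (induction n)
    case (Suc n)
    have "int (Suc n) * a = a + int n * a" "int (Suc n) * b = b + int n * b"
      by (simp_all add: algebra_simps)
    with mult[OF that Suc] show ?case by (simp only:)
  qed (simp add: e0)
  have "in_P (e a 0) \<in> stabilizer T N"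
    using pow[OF e(1), of "nat a"] pow[OF e(2), of "nat (- a)"] by (cases "a \<ge> 0") auto
  moreover have "in_P (e 0 b) \<in> stabilizer T N"
    using pow[OF e(3), of "nat b"] pow[OF e(4), of "nat (- b)"] by (cases "b \<ge> 0") auto
  ultimately show ?thesis using mult[of a 0 0 b] by simp
qed

text \<open>Multiplying h_(-1) e^\<alpha> by e^{-\<alpha>} gives back h, up to a multiple of
  e^\<alpha>_(-2) e^{-\<alpha>}, which involves exponentials only.\<close>

lemma (in fock_tensor) stabilizer_heis_extract:
  assumes N: "cvs.subspace N" and e: "\<And>a b. in_P (e a b) \<in> stabilizer T N"
    and h: "in_P (nprod P h (-1) (e a b)) \<in> stabilizer T N"
    and pos: "\<And>j a b. j > 0 \<Longrightarrow> nprod P h j (e a b) = 0" and zero: "\<And>a b. nprod P h 0 (e a b) = \<kappa> a b *\<^sub>C e a b"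
  shows "in_P h \<in> stabilizer T N"
proof -
  have "nprod P h (-1) (e 0 0) = nprod P (nprod P h (-1) (e a b)) (-1) (e (- a) (- b)) -
      \<kappa> (- a) (- b) *\<^sub>C nprod P (e a b) (-2) (e (- a) (- b))"
    using heis_e_normal_product[OF pos zero, of a b "- a" "- b"] by simp
  moreover have "nprod P h (-1) (e 0 0) = h"
    using P_vertex_algebra by (simp add: e_zero vertex_algebra_def)
  ultimately have "in_P h = in_P (nprod P (nprod P h (-1) (e a b)) (-1) (e (- a) (- b))) -
      \<kappa> (- a) (- b) *\<^sub>C in_P (nprod P (e a b) (-2) (e (- a) (- b)))"
    by (metis in_P_diff in_P_scale)
  also have "\<dots> \<in> stabilizer T N"
    by (intro stabilizer_diff[OF N] stabilizer_scale[OF N] stabilizer_in_P_nprod[OF N] h e)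
  finally show ?thesis .
qed

text \<open>Strong generation by J, G+, G-, L is given for the universal algebra
  \<open>Wuniv\<close>; the surjection \<pi> carries it to W.\<close>

locale realization = fock_tensor P c d e W F G v l\<^sub>1 l\<^sub>2
  for P :: "'p::complex_vector va" and c d e and W :: "'w::complex_vector va"
    and F :: "'w \<Rightarrow> int \<Rightarrow> 'r \<Rightarrow> 'r::complex_vector" and G :: "'p \<Rightarrow> int \<Rightarrow> 'q \<Rightarrow> 'q::complex_vector"
    and v l\<^sub>1 l\<^sub>2 +
  fixes k :: complex and V :: "'l::complex_vector va" and \<iota> :: "mat3 \<Rightarrow> 'l"
    and \<phi> :: "'l \<Rightarrow> ('w, 'p) tensor"
    and Wuniv :: "'u::complex_vector va" and J Gp Gm L :: 'u and \<pi> :: "'u \<Rightarrow> 'w"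
  assumes realization: "free_field_realization k V \<iota> W (\<pi> J) (\<pi> Gp) (\<pi> Gm) P c d e \<phi>"
    and Wuniv: "bershadsky_polyakov k Wuniv J Gp Gm L"
    and \<pi>: "va_hom Wuniv W \<pi>" "surj \<pi>"
begin

definition \<gamma> :: 'p
  where "\<gamma> = (- 1 / 2) *\<^sub>C nprod P (c 1 + d 1) (-1) (e (-1) 0)"

lemma \<phi>_hom: "va_hom V (tensor_va W P) \<phi>"
  and \<phi>_e\<^sub>1: "\<phi> (\<iota> e\<^sub>1) = - in_P (nprod P \<gamma> (-1) (e 0 1))"
  and \<phi>_e\<^sub>2: "\<phi> (\<iota> e\<^sub>2) = in_P (e 1 0)"
  and \<phi>_e\<^sub>3: "\<phi> (\<iota> e\<^sub>3) = in_P (e 0 1)"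
  and \<phi>_h\<^sub>1: "\<phi> (\<iota> h\<^sub>1) = (- 2) *\<^sub>C in_W (\<pi> J)
    + in_P (nprod P \<gamma> (-1) (e 1 0) - ((2 * k + 9) / 6) *\<^sub>C c 2 + (1 / 2) *\<^sub>C d 2)"
  and \<phi>_h\<^sub>2: "\<phi> (\<iota> h\<^sub>2) = in_W (\<pi> J)
    + in_P ((- 2) *\<^sub>C nprod P \<gamma> (-1) (e 1 0) + ((4 * k + 9) / 6) *\<^sub>C c 2 + (1 / 2) *\<^sub>C d 2)"
  and \<phi>_f\<^sub>1: "\<phi> (\<iota> f\<^sub>1) = in_W (\<pi> Gp)
    - (2 *\<^sub>C (\<pi> J \<otimes> nprod P (e 1 0) (-1) (e 0 (-1)))
      + in_P (nprod P (((8 * k + 9) / 6) *\<^sub>C c 2 - (1 / 2) *\<^sub>C d 2) (-1) (nprod P (e 1 0) (-1) (e 0 (-1)))))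
    + (k + 1) *\<^sub>C in_P (nprod P (va_deriv P (e 1 0)) (-1) (e 0 (-1)))"
  and \<phi>_f\<^sub>2: "\<phi> (\<iota> f\<^sub>2) = \<pi> Gm \<otimes> e 0 (-1)
    + (\<pi> J \<otimes> \<gamma> + in_P (nprod P (((4 * k + 9) / 6) *\<^sub>C c 2 + (1 / 2) *\<^sub>C d 2) (-1) \<gamma>))
    + k *\<^sub>C in_P (va_deriv P \<gamma>)
    - in_P (nprod P \<gamma> (-1) (nprod P \<gamma> (-1) (e 1 0)))"
  using realization unfolding free_field_realization_def Let_def \<gamma>_def by blast+

text \<open>Once $e^{-c_1}$ and $e^{-c_2}$ are available, the realization can be inverted: $c_i$ comes from
  $\partial e^{c_i}$, then $d_1$ from $e_1$, $J$ and $d_2$ from $h_1,h_2$, $G^+$ and $G^-$ from $f_1,f_2$,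
  and $L$ from $G^+_{(0)}G^-$.\<close>

theorem localized_subspace_trivial:
  assumes N: "cvs.subspace N" and \<phi>: "\<And>x. \<phi> x \<in> stabilizer T N"
    and inv\<^sub>1: "\<And>z. T (in_P (e 1 0)) 0 z \<in> N \<Longrightarrow> z \<in> N"
    and inv\<^sub>2: "\<And>z. T (in_P (e 0 1)) 0 z \<in> N \<Longrightarrow> z \<in> N"
  shows "N = {0} \<or> N = UNIV"
proof -
  let ?A = "stabilizer T N"
  note add = stabilizer_add[OF N] and diff = stabilizer_diff[OF N] and minus = stabilizer_minus[OF N]
    and scale = stabilizer_scale[OF N] and np = stabilizer_np[OF N] and vac = stabilizer_vacuum[OF N]
    and nprod_P = stabilizer_in_P_nprod[OF N] and deriv_P = stabilizer_in_P_deriv[OF N]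
    and tens = stabilizer_tens[OF N]
  have \<beta>: "in_P (e 1 0) \<in> ?A" using \<phi>[of "\<iota> e\<^sub>2"] by (simp only: \<phi>_e\<^sub>2)
  have exp_c: "in_P (e 0 1) \<in> ?A" using \<phi>[of "\<iota> e\<^sub>3"] by (simp only: \<phi>_e\<^sub>3)
  have "in_P (e (-1) 0) \<in> ?A"
    using inverse_exponential_in_stabilizer[OF _ N \<beta> inv\<^sub>1] by simp
  moreover have "in_P (e 0 (-1)) \<in> ?A"
    using inverse_exponential_in_stabilizer[OF _ N exp_c inv\<^sub>2] by simp
  ultimately have e: "in_P (e a b) \<in> ?A" for a b
    using stabilizer_exponentials[OF N \<beta> _ exp_c] by blast
  have heis_zero: "nprod P (heis i) 0 (e a b) = charge i a b *\<^sub>C e a b"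
    and heis_pos: "j > 0 \<Longrightarrow> nprod P (heis i) j (e a b) = 0" if "i < 4" for i j a b
    using heis_e[OF that] by simp_all
  have c1: "in_P (heis 0) \<in> ?A"
    by (rule stabilizer_heis_extract[OF N e _ heis_pos heis_zero, of _ 1 0])
      (use deriv_P[OF \<beta>] in \<open>simp_all add: deriv_e heis_simps scaleC_one\<close>)
  have c2: "in_P (heis 1) \<in> ?A"
    by (rule stabilizer_heis_extract[OF N e _ heis_pos heis_zero, of _ 0 1])
      (use deriv_P[OF exp_c] in \<open>simp_all add: deriv_e heis_simps scaleC_one\<close>)
  have d1: "in_P (heis 2) \<in> ?A"
  proof -
    \<comment> \<open>e_1 maps to -\<gamma> e^{c_2}, half of :(c_1 + d_1) e^{-c_1 + c_2}: up to a
      product of exponentials. So c_1 + d_1 is extracted as a whole and c_1 subtracted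
      afterwards.\<close>
    let ?h = "heis 0 + heis 2"
    note lin = va_module_clinear_left[OF P_module]
    have zero: "nprod P ?h 0 (e a b) = (charge 0 a b + charge 2 a b) *\<^sub>C e a b" for a b
      by (simp add: clinear_add[OF lin] heis_zero scaleC_add_left)
    have pos: "nprod P ?h j (e a b) = 0" if "j > 0" for j a b
      by (simp add: clinear_add[OF lin] heis_pos[OF _ that])
    have "nprod P \<gamma> (-1) (e 0 1) = (- 1 / 2) *\<^sub>C nprod P (nprod P ?h (-1) (e (-1) 0)) (-1) (e 0 1)"
      by (simp only: \<gamma>_def heis_simps clinear_scale[OF lin])
    also have "nprod P (nprod P ?h (-1) (e (-1) 0)) (-1) (e 0 1) =
        nprod P ?h (-1) (e (-1) 1) + (charge 0 0 1 + charge 2 0 1) *\<^sub>C nprod P (e (-1) 0) (-2) (e 0 1)"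
      using heis_e_normal_product[OF pos zero, of "-1" 0 0 1] by simp
    finally have "- in_P (nprod P \<gamma> (-1) (e 0 1)) = (1 / 2) *\<^sub>C (in_P (nprod P ?h (-1) (e (-1) 1)) +
        (charge 0 0 1 + charge 2 0 1) *\<^sub>C in_P (nprod P (e (-1) 0) (-2) (e 0 1)))"
      by (simp only: in_P_add in_P_scale) (simp add: cvs.scale_minus_left)
    with \<phi>[of "\<iota> e\<^sub>1"] have half: "(1 / 2) *\<^sub>C (in_P (nprod P ?h (-1) (e (-1) 1)) +
        (charge 0 0 1 + charge 2 0 1) *\<^sub>C in_P (nprod P (e (-1) 0) (-2) (e 0 1))) \<in> ?A"
      by (simp only: \<phi>_e\<^sub>1)
    have "in_P (nprod P ?h (-1) (e (-1) 1)) =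
        2 *\<^sub>C ((1 / 2) *\<^sub>C (in_P (nprod P ?h (-1) (e (-1) 1)) +
        (charge 0 0 1 + charge 2 0 1) *\<^sub>C in_P (nprod P (e (-1) 0) (-2) (e 0 1)))) -
        (charge 0 0 1 + charge 2 0 1) *\<^sub>C in_P (nprod P (e (-1) 0) (-2) (e 0 1))"
      by (simp add: scaleC_scaleC scaleC_one)
    also have "\<dots> \<in> ?A"
      by (intro diff scale half nprod_P e)
    finally have "in_P ?h \<in> ?A"
      by (rule stabilizer_heis_extract[OF N e _ pos zero])
    from diff[OF this c1] show ?thesis by (simp add: in_P_add)
  qed
  have \<gamma>: "in_P \<gamma> \<in> ?A"
    unfolding \<gamma>_def in_P_scale
    by (intro scale nprod_P e) (use add[OF c1 d1] in \<open>simp add: in_P_add heis_simps\<close>)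
  let ?j = "in_W (\<pi> J)" and ?d = "in_P (heis 3)"
  have "\<phi> (\<iota> h\<^sub>1) - in_P (nprod P \<gamma> (-1) (e 1 0)) + ((2 * k + 9) / 6) *\<^sub>C in_P (heis 1) \<in> ?A"
    by (intro add diff scale \<phi> nprod_P \<gamma> e c2)
  then have y1: "(- 2) *\<^sub>C ?j + (1 / 2) *\<^sub>C ?d \<in> ?A"
    by (simp add: \<phi>_h\<^sub>1 in_P_add in_P_diff in_P_scale heis_simps)
  have "\<phi> (\<iota> h\<^sub>2) - ((- 2) *\<^sub>C in_P (nprod P \<gamma> (-1) (e 1 0)) + ((4 * k + 9) / 6) *\<^sub>C in_P (heis 1)) \<in> ?A"
    by (intro add diff scale \<phi> nprod_P \<gamma> e c2)
  then have y2: "?j + (1 / 2) *\<^sub>C ?d \<in> ?A"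
    by (simp add: \<phi>_h\<^sub>2 in_P_add in_P_diff in_P_scale heis_simps)
  \<comment> \<open>The terms in d_2 agree in the two combinations, so their difference is 3
    J.\<close>
  have "(1 / 3) *\<^sub>C ((?j + (1 / 2) *\<^sub>C ?d) - ((- 2) *\<^sub>C ?j + (1 / 2) *\<^sub>C ?d)) = (1 / 3) *\<^sub>C ((1 + 2) *\<^sub>C ?j)"
    by (simp only: scaleC_add_left scaleC_one) (simp add: cvs.scale_minus_left)
  also have "\<dots> = ?j" by (simp add: scaleC_scaleC scaleC_one)
  finally have j: "?j \<in> ?A" using scale[OF diff[OF y2 y1], of "1 / 3"] by simp
  have d2: "?d \<in> ?A"
    using scale[OF diff[OF y2 j], of 2] by (simp add: scaleC_scaleC scaleC_one)
  have heis: "in_P (heis i) \<in> ?A" if "i < 4" for i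
    using that c1 c2 d1 d2 by (elim less_4_cases) simp_all
  have cd: "in_P (c 2) \<in> ?A" "in_P (d 2) \<in> ?A"
    using c2 d2 by (simp_all add: heis_simps)
  have "\<phi> (\<iota> f\<^sub>1) + (2 *\<^sub>C (\<pi> J \<otimes> nprod P (e 1 0) (-1) (e 0 (-1)))
      + in_P (nprod P (((8 * k + 9) / 6) *\<^sub>C c 2 - (1 / 2) *\<^sub>C d 2) (-1) (nprod P (e 1 0) (-1) (e 0 (-1)))))
    - (k + 1) *\<^sub>C in_P (nprod P (va_deriv P (e 1 0)) (-1) (e 0 (-1))) \<in> ?A"
    by (intro add diff scale \<phi> tens[OF j] nprod_P deriv_P e)
      (simp add: in_P_diff in_P_scale diff scale cd)
  then have Gp: "in_W (\<pi> Gp) \<in> ?A"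
    by (simp add: \<phi>_f\<^sub>1)
  have "\<phi> (\<iota> f\<^sub>2) - (\<pi> J \<otimes> \<gamma> + in_P (nprod P (((4 * k + 9) / 6) *\<^sub>C c 2 + (1 / 2) *\<^sub>C d 2) (-1) \<gamma>))
      - k *\<^sub>C in_P (va_deriv P \<gamma>) + in_P (nprod P \<gamma> (-1) (nprod P \<gamma> (-1) (e 1 0))) \<in> ?A"
    by (intro add diff scale \<phi> tens[OF j] nprod_P deriv_P \<gamma> e)
      (simp add: in_P_add in_P_scale add scale cd)
  then have "\<pi> Gm \<otimes> e 0 (-1) \<in> ?A"
    by (simp add: \<phi>_f\<^sub>2)
  \<comment> \<open>Multiplication by e^{c_2} removes the factor e^{-c_2}.\<close>
  from np[OF exp_c this, of "-1"] have Gm: "in_W (\<pi> Gm) \<in> ?A"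
    by (simp add: np_in_P e_e_minus_one e_zero)
  \<comment> \<open>The preserved part of W is pulled back to the universal algebra, where the free
    generators are available.\<close>
  let ?B = "{u. in_W (\<pi> u) \<in> ?A}"
  have lin: "clinear \<pi>" and hom: "\<pi> (nprod Wuniv x n y) = nprod W (\<pi> x) n (\<pi> y)" and vacW: "\<pi> (vacuum Wuniv) = vacuum W" for x n y
    using \<pi>(1) by (simp_all add: va_hom_def)
  have B: "cvs.subspace ?B"
    using subspace_stabilizer[OF T_module N] vac
    by (simp add: cvs.subspace_def clinear_zero[OF lin] clinear_add[OF lin] clinear_scale[OF lin] tens_add_left tens_scale_left)
  have B_nprod: "nprod Wuniv x n y \<in> ?B" if "x \<in> ?B" "y \<in> ?B" for x n y
    using np[of "in_W (\<pi> x)" "in_W (\<pi> y)" n] that by (simp add: np_in_W hom)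
  have B_vac: "vacuum Wuniv \<in> ?B" using vac by (simp add: vacW)
  have B_gens: "J \<in> ?B" "Gp \<in> ?B" "Gm \<in> ?B" using j Gp Gm by simp_all
  let ?X = "3 *\<^sub>C nprod Wuniv J (-1) J + (3 * (k + 1) / 2) *\<^sub>C va_deriv Wuniv J"
  have "ope Wuniv Gp Gm [?X - (if k = -3 then L else (k + 3) *\<^sub>C L),
      (3 * (k + 1)) *\<^sub>C J, ((k + 1) * (2 * k + 3)) *\<^sub>C vacuum Wuniv]"
    using Wuniv by (simp only: bershadsky_polyakov_def)
  from this[unfolded ope_def, rule_format, of 0]
  have "nprod Wuniv Gp 0 Gm = ?X - (if k = -3 then L else (k + 3) *\<^sub>C L)" by simp
  then have "(if k = -3 then L else (k + 3) *\<^sub>C L) = ?X - nprod Wuniv Gp 0 Gm" by simp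
  also have "\<dots> \<in> ?B"
    unfolding va_deriv_def
    by (intro cvs.subspace_diff[OF B] cvs.subspace_add[OF B] cvs.subspace_scale[OF B] B_nprod B_gens B_vac)
  finally have scaled: "(if k = -3 then L else (k + 3) *\<^sub>C L) \<in> ?B" .
  \<comment> \<open>Off the critical level the factor k + 3 is invertible; at k = -3 the generator
    itself appears in the operator product with coefficient -1.\<close>
  have B_L: "L \<in> ?B"
  proof (cases "k = -3")
    case False
    then have "k + 3 \<noteq> 0" by (simp add: add_eq_0_iff2)
    then have "L = inverse (k + 3) *\<^sub>C (k + 3) *\<^sub>C L" by (simp add: scaleC_scaleC scaleC_one)
    with cvs.subspace_scale[OF B scaled, of "inverse (k + 3)"] False show ?thesis by simp
  qed (use scaled in simp)
  have "u \<in> ?B" for u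
  proof (rule free_over_induct[OF _ B])
    show "free_over (nprod Wuniv) [J, Gp, Gm, L] (\<lambda>_::unit. vacuum Wuniv)"
      using Wuniv by (simp only: bershadsky_polyakov_def freely_strongly_generated_def)
    fix i n x assume "i < length [J, Gp, Gm, L]" "x \<in> ?B"
    moreover from this have "[J, Gp, Gm, L] ! i \<in> set [J, Gp, Gm, L]" by (intro nth_mem)
    ultimately show "nprod Wuniv ([J, Gp, Gm, L] ! i) (- int n - 1) x \<in> ?B"
      using B_gens B_L by (intro B_nprod) auto
  qed (rule B_vac)
  then have "in_W w \<in> ?A" for w
    using \<pi>(2) by (metis (no_types, lifting) mem_Collect_eq surjD)
  from stable_subspace_trivial[OF N this heis e] show ?thesis .
qed

end

section \<open>Irreducibility of the relaxed modules\<close>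

lemma funpow_commute: "(\<And>x. f (g x) = g (f x)) \<Longrightarrow> (f ^^ k) (g x) = g ((f ^^ k) x)"
  by (induction k) simp_all

text \<open>Closure under inverses obtained at the first localization survives the second one,
  because the two operators commute.\<close>

lemma upper_closure_inverse_commute:
  assumes "\<And>x. E' x \<in> N \<Longrightarrow> x \<in> N" and "\<And>x. E (E' x) = E' (E x)" and "E' x \<in> upper_closure E N"
  shows "x \<in> upper_closure E N"
proof -
  obtain k where "(E ^^ k) (E' x) \<in> N"
    using assms(3) by (auto simp: upper_closure_def)
  then have "E' ((E ^^ k) x) \<in> N"
    by (simp only: funpow_commute[of E E', OF assms(2)])
  then have "(E ^^ k) x \<in> N" by (rule assms(1))
  then show ?thesis unfolding upper_closure_def by blast
qed

text \<open>From E' x = E^k y with y in N, surjectivity gives y = E' y'. Then y' lies in N by the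
  closure under inverses, and injectivity cancels E'.\<close>

lemma lower_core_inverse_commute:
  assumes "\<And>x. E' x \<in> N \<Longrightarrow> x \<in> N" and "\<And>x. E (E' x) = E' (E x)" and "inj E'" "surj E'"
    and "E' x \<in> lower_core E N"
  shows "x \<in> lower_core E N"
proof -
  have "\<exists>y\<in>N. x = (E ^^ k) y" for k
  proof -
    obtain y where y: "y \<in> N" "E' x = (E ^^ k) y"
      using assms(5) unfolding lower_core_def by blast
    obtain y' where y': "y = E' y'" using surjD[OF assms(4)] by blast
    have "E' x = E' ((E ^^ k) y')"
      unfolding y(2) y' by (rule funpow_commute[of E E', OF assms(2)])
    with injD[OF assms(3)] assms(1)[of y'] y(1) y' show ?thesis by blast
  qed
  then show ?thesis by (simp add: lower_core_def)
qed

lemma subset_lower_core: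
  assumes "S \<subseteq> N" and "S \<subseteq> E ` S"
  shows "S \<subseteq> lower_core E N"
proof -
  have "\<forall>x\<in>S. \<exists>y\<in>S. x = (E ^^ k) y" for k
  proof (induction k)
    case (Suc k)
    show ?case
    proof
      fix x assume "x \<in> S"
      then obtain y where y: "y \<in> S" "x = (E ^^ k) y" using Suc by blast
      then obtain z where "z \<in> S" "y = E z" using assms(2) by blast
      with y(2) have "x = (E ^^ Suc k) z" by (simp only: funpow_Suc_right comp_apply)
      with \<open>z \<in> S\<close> show "\<exists>y\<in>S. x = (E ^^ Suc k) y" by blast
    qed
  qed auto
  with assms(1) show ?thesis unfolding lower_core_def by blast
qed

context realization
begin

text \<open>Iterated zero mode brackets between elements of the image of \<phi> stay in that image,
  so localization preserves stability under this image alone, before stability under the whole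
  tensor product algebra is known.\<close>

lemma \<phi>_funpow: "(np (\<phi> x) 0 ^^ j) (\<phi> y) = \<phi> ((nprod V x 0 ^^ j) y)"
proof -
  have "\<phi> (nprod V x n y) = np (\<phi> x) n (\<phi> y)" for x n y
    using \<phi>_hom by (simp add: va_hom_def)
  then show ?thesis by (induction j) simp_all
qed

lemma upper_closure_submodule:
  assumes N: "cvs.subspace N" and \<phi>: "\<And>y. \<phi> y \<in> stabilizer T N" and x: "\<phi> x = in_P (e a b)"
  shows "cvs.subspace (upper_closure (T (in_P (e a b)) 0) N)"
    and "\<phi> y \<in> stabilizer T (upper_closure (T (in_P (e a b)) 0) N)"
proof -
  have u: "in_P (e a b) \<in> stabilizer T N" using \<phi>[of x] by (simp only: x)
  show "cvs.subspace (upper_closure (T (in_P (e a b)) 0) N)"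
    by (rule subspace_upper_closure[OF clinear_T N stabilizerD[OF u]])
  show "\<phi> y \<in> stabilizer T (upper_closure (T (in_P (e a b)) 0) N)"
    by (rule stabilizer_T_upper_closure[OF N u]) (simp only: x[symmetric] \<phi>_funpow \<phi>)
qed

lemma lower_core_submodule:
  assumes N: "cvs.subspace N" and \<phi>: "\<And>y. \<phi> y \<in> stabilizer T N" and x: "\<phi> x = in_P (e a b)"
    and ab: "a + b = 1"
  shows "cvs.subspace (lower_core (T (in_P (e a b)) 0) N)"
    and "\<phi> y \<in> stabilizer T (lower_core (T (in_P (e a b)) 0) N)"
proof -
  have u: "in_P (e a b) \<in> stabilizer T N" using \<phi>[of x] by (simp only: x)
  show "cvs.subspace (lower_core (T (in_P (e a b)) 0) N)"
    by (rule subspace_lower_core[OF clinear_T N])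
  show "\<phi> y \<in> stabilizer T (lower_core (T (in_P (e a b)) 0) N)"
    by (rule stabilizer_T_lower_core[OF N u inj_e_zero_mode[OF ab]]) (simp only: x[symmetric] \<phi>_funpow \<phi>)
qed

text \<open>With a + b = 1 the zero mode moves the exponent (\<open>n\<^sub>1\<close>,
  \<open>n\<^sub>2\<close>) by (a, b), and all pairs of integers occur, so each spanning vector of
  the top component has a preimage of the same kind.\<close>

lemma top_subset_image:
  assumes ab: "a + b = 1"
  shows "cvs.span {x \<otimes> y | x y. x \<in> S \<and> y \<in> cvs.span (range (\<lambda>(n\<^sub>1, n\<^sub>2). v n\<^sub>1 n\<^sub>2))} \<subseteq>
    T (in_P (e a b)) 0 ` cvs.span {x \<otimes> y | x y. x \<in> S \<and> y \<in> cvs.span (range (\<lambda>(n\<^sub>1, n\<^sub>2). v n\<^sub>1 n\<^sub>2))}"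
    (is "?Top \<subseteq> ?E ` ?Top")
proof (rule cvs.span_minimal)
  show sub: "cvs.subspace (?E ` ?Top)"
  proof (rule cvs.subspaceI)
    show "0 \<in> ?E ` ?Top"
      by (intro image_eqI[of _ _ 0]) (simp_all add: clinear_zero[OF clinear_T] cvs.span_zero)
    fix y z s assume "y \<in> ?E ` ?Top"
    then obtain y' where y: "y' \<in> ?Top" "y = ?E y'" by blast
    then show "s *\<^sub>C y \<in> ?E ` ?Top"
      by (intro image_eqI[of _ _ "s *\<^sub>C y'"]) (simp_all add: clinear_scale[OF clinear_T] cvs.span_scale)
    assume "z \<in> ?E ` ?Top"
    then obtain z' where "z' \<in> ?Top" "z = ?E z'" by blast
    with y show "y + z \<in> ?E ` ?Top"
      by (intro image_eqI[of _ _ "y' + z'"]) (simp_all add: clinear_add[OF clinear_T] cvs.span_add)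
  qed
  have "x \<otimes> y \<in> ?E ` ?Top" if x: "x \<in> S" and y: "y \<in> cvs.span (range (\<lambda>(n\<^sub>1, n\<^sub>2). v n\<^sub>1 n\<^sub>2))" for x y
  proof -
    have "range (\<lambda>(n\<^sub>1, n\<^sub>2). v n\<^sub>1 n\<^sub>2) \<subseteq> {y. x \<otimes> y \<in> ?E ` ?Top}"
    proof clarify
      fix n\<^sub>1 n\<^sub>2
      have "x \<otimes> v (n\<^sub>1 - a) (n\<^sub>2 - b) \<in> ?Top"
        using x by (intro cvs.span_base CollectI exI conjI refl) (auto intro!: cvs.span_base)
      moreover have "x \<otimes> v n\<^sub>1 n\<^sub>2 = ?E (x \<otimes> v (n\<^sub>1 - a) (n\<^sub>2 - b))"
        using shift_v[of a b x "n\<^sub>1 - a" "n\<^sub>2 - b"] ab by simp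
      ultimately show "x \<otimes> v n\<^sub>1 n\<^sub>2 \<in> ?E ` ?Top" by blast
    qed
    moreover have "cvs.subspace {y. x \<otimes> y \<in> ?E ` ?Top}"
      using sub unfolding cvs.subspace_def by (simp only: mem_Collect_eq tens_zero_right tens_add_right tens_scale_right simp_thms) blast
    ultimately have "cvs.span (range (\<lambda>(n\<^sub>1, n\<^sub>2). v n\<^sub>1 n\<^sub>2)) \<subseteq> {y. x \<otimes> y \<in> ?E ` ?Top}"
      by (rule cvs.span_minimal)
    with y show ?thesis by blast
  qed
  then show "{x \<otimes> y | x y. x \<in> S \<and> y \<in> cvs.span (range (\<lambda>(n\<^sub>1, n\<^sub>2). v n\<^sub>1 n\<^sub>2))} \<subseteq> ?E ` ?Top"
    by blast
qed

theorem irreducible_if_top_irreducible: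
  fixes S :: "'r set"
  defines "Top \<equiv> cvs.span {x \<otimes> y | x y. x \<in> S \<and> y \<in> cvs.span (range (\<lambda>(n\<^sub>1, n\<^sub>2). v n\<^sub>1 n\<^sub>2))}"
  assumes top: "sl3_irreducible (\<lambda>u. T (\<phi> (\<iota> u)) 0) Top"
  shows "va_irreducible V (\<lambda>a. T (\<phi> a))"
proof -
  let ?E\<^sub>1 = "T (in_P (e 1 0)) 0" and ?E\<^sub>2 = "T (in_P (e 0 1)) 0"
  have inj: "inj ?E\<^sub>1" "inj ?E\<^sub>2" and surj: "surj ?E\<^sub>1"
    by (rule inj_e_zero_mode surj_e_zero_mode, simp)+
  have comm: "?E\<^sub>2 (?E\<^sub>1 z) = ?E\<^sub>1 (?E\<^sub>2 z)" for z
    by (rule e_commute[OF T_in_P_module])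
  have "N = {0} \<or> N = UNIV" if N: "cvs.subspace N" and stable: "\<forall>a n. \<forall>z\<in>N. T (\<phi> a) n z \<in> N" for N
  proof (cases "N = {0}")
    case False
    have \<phi>: "\<phi> y \<in> stabilizer T N" for y
      using stable by (simp add: stabilizer_def)
    define C\<^sub>1 where "C\<^sub>1 = upper_closure ?E\<^sub>1 N"
    define C\<^sub>2 where "C\<^sub>2 = upper_closure ?E\<^sub>2 C\<^sub>1"
    note C\<^sub>1 = upper_closure_submodule[OF N \<phi> \<phi>_e\<^sub>2, folded C\<^sub>1_def]
    note C\<^sub>2 = upper_closure_submodule[OF C\<^sub>1 \<phi>_e\<^sub>3, folded C\<^sub>2_def]
    have up: "z \<in> C\<^sub>1" if "?E\<^sub>1 z \<in> C\<^sub>1" for z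
      using that unfolding C\<^sub>1_def by (rule upper_closure_inverse)
    have inv\<^sub>1: "z \<in> C\<^sub>2" if "?E\<^sub>1 z \<in> C\<^sub>2" for z
      unfolding C\<^sub>2_def
      by (rule upper_closure_inverse_commute[of ?E\<^sub>1 C\<^sub>1 ?E\<^sub>2, OF _ comm that[unfolded C\<^sub>2_def]])
        (rule up)
    have inv\<^sub>2: "z \<in> C\<^sub>2" if "?E\<^sub>2 z \<in> C\<^sub>2" for z
      using that unfolding C\<^sub>2_def by (rule upper_closure_inverse)
    have "C\<^sub>2 = {0} \<or> C\<^sub>2 = UNIV"
      by (rule localized_subspace_trivial[OF C\<^sub>2]) (erule inv\<^sub>1 inv\<^sub>2)+
    moreover have "N \<subseteq> C\<^sub>2"
      unfolding C\<^sub>2_def C\<^sub>1_def by (intro subsetI upper_closure_superset)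
    ultimately have C\<^sub>2_UNIV: "C\<^sub>2 = UNIV"
      using False cvs.subspace_0[OF N] by blast
    have sub: "cvs.subspace Top" by (simp add: Top_def)
    have mod: "T (\<phi> (\<iota> x)) 0 u \<in> Top" if "x \<in> sl3" "u \<in> Top" for x u
      using top that unfolding sl3_irreducible_def sl3_module_def by blast
    have Top_irr: "\<forall>M. cvs.subspace M \<and> M \<subseteq> Top \<and> (\<forall>x\<in>sl3. \<forall>u\<in>M. T (\<phi> (\<iota> x)) 0 u \<in> M) \<longrightarrow>
        M = {0} \<or> M = Top" and "Top \<noteq> {0}"
      using top unfolding sl3_irreducible_def by blast+
    then obtain t where t: "t \<in> Top" "t \<noteq> 0"
      using cvs.subspace_0[OF sub] by blast
    have "e\<^sub>2 \<in> sl3" "e\<^sub>3 \<in> sl3"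
      by (simp_all add: sl3_def trace_def e\<^sub>2_def e\<^sub>3_def mat_unit_def sum_3)
    then have E_Top: "?E\<^sub>1 u \<in> Top" "?E\<^sub>2 u \<in> Top" if "u \<in> Top" for u
      using mod[OF _ that] by (simp_all flip: \<phi>_e\<^sub>2 \<phi>_e\<^sub>3)
    have pow_Top: "(?E\<^sub>1 ^^ j) u \<in> Top" "(?E\<^sub>2 ^^ j) u \<in> Top" if "u \<in> Top" for u j
      using that by (induction j) (simp_all add: E_Top)
    have pow_nonzero: "(?E\<^sub>1 ^^ j) u \<noteq> 0" "(?E\<^sub>2 ^^ j) u \<noteq> 0" if "u \<noteq> 0" for u j
      using that inj clinear_zero[OF clinear_T] by (induction j) (auto dest: injD[of _ _ 0])
    have "t \<in> C\<^sub>2" by (simp add: C\<^sub>2_UNIV)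
    then obtain j\<^sub>1 j\<^sub>2 where t': "(?E\<^sub>1 ^^ j\<^sub>1) ((?E\<^sub>2 ^^ j\<^sub>2) t) \<in> N"
      unfolding C\<^sub>2_def C\<^sub>1_def upper_closure_def by blast
    \<comment> \<open>The monomial in E_1 and E_2 that moves t into N keeps it in
      \<open>Top\<close>, where e_2 and e_3 act, and injectivity keeps it nonzero.\<close>
    have "Top \<inter> N \<noteq> {0}"
      using t' pow_Top(1)[OF pow_Top(2)[OF t(1)]] pow_nonzero(1)[OF pow_nonzero(2)[OF t(2)]] by blast
    moreover have "cvs.subspace (Top \<inter> N)"
      by (rule cvs.subspace_inter[OF sub N])
    moreover have "T (\<phi> (\<iota> x)) 0 u \<in> Top \<inter> N" if "x \<in> sl3" "u \<in> Top \<inter> N" for x u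
      using that mod stabilizerD[OF \<phi>] by blast
    ultimately have "Top \<inter> N = Top"
      using Top_irr[rule_format, of "Top \<inter> N"] by blast
    then have Top_N: "Top \<subseteq> N" by blast
    define K\<^sub>1 where "K\<^sub>1 = lower_core ?E\<^sub>1 N"
    define K\<^sub>2 where "K\<^sub>2 = lower_core ?E\<^sub>2 K\<^sub>1"
    note K\<^sub>1 = lower_core_submodule[OF N \<phi> \<phi>_e\<^sub>2, simplified, folded K\<^sub>1_def]
    note K\<^sub>2 = lower_core_submodule[OF K\<^sub>1 \<phi>_e\<^sub>3, simplified, folded K\<^sub>2_def]
    have low: "z \<in> K\<^sub>1" if "?E\<^sub>1 z \<in> K\<^sub>1" for z
      using that unfolding K\<^sub>1_def by (rule lower_core_inverse[OF inj(1)])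
    have inv\<^sub>1': "z \<in> K\<^sub>2" if "?E\<^sub>1 z \<in> K\<^sub>2" for z
      unfolding K\<^sub>2_def
      by (rule lower_core_inverse_commute[of ?E\<^sub>1 K\<^sub>1 ?E\<^sub>2, OF _ comm inj(1) surj that[unfolded K\<^sub>2_def]])
        (rule low)
    have inv\<^sub>2': "z \<in> K\<^sub>2" if "?E\<^sub>2 z \<in> K\<^sub>2" for z
      using that unfolding K\<^sub>2_def by (rule lower_core_inverse[OF inj(2)])
    have "K\<^sub>2 = {0} \<or> K\<^sub>2 = UNIV"
      by (rule localized_subspace_trivial[OF K\<^sub>2]) (erule inv\<^sub>1' inv\<^sub>2')+
    moreover have "Top \<subseteq> K\<^sub>2"
      unfolding K\<^sub>2_def K\<^sub>1_def Top_def
      by (intro subset_lower_core top_subset_image Top_N[unfolded Top_def]) simp_all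
    ultimately have "K\<^sub>2 = UNIV" using t by blast
    moreover have "K\<^sub>2 \<subseteq> N"
      unfolding K\<^sub>2_def K\<^sub>1_def by (intro subset_trans[OF lower_core_subset lower_core_subset])
    ultimately show ?thesis by blast
  qed simp
  with nontrivial show ?thesis
    unfolding va_irreducible_def using va_module_pullback[OF \<phi>_hom T_module] by blast
qed

end

theorem theorem7p3:
  fixes k l\<^sub>1 l\<^sub>2 :: complex
    and Vk :: "'v::complex_vector va" and \<iota> :: "mat3 \<Rightarrow> 'v"
    and Lk :: "'l::complex_vector va" and \<pi>\<^sub>L :: "'v \<Rightarrow> 'l"
    and Wuniv :: "'u::complex_vector va" and J Gp Gm LBP :: 'u
    and Wk :: "'w::complex_vector va" and \<pi>\<^sub>W :: "'u \<Rightarrow> 'w"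
    and P :: "'p::complex_vector va" and c d :: "nat \<Rightarrow> 'p" and e :: "int \<Rightarrow> int \<Rightarrow> 'p"
    and \<phi> :: "'l \<Rightarrow> ('w, 'p) tensor"
    and act\<^sub>R :: "'w \<Rightarrow> int \<Rightarrow> 'r \<Rightarrow> 'r::complex_vector" and R :: "nat \<Rightarrow> 'r set"
    and act\<^sub>P :: "'p \<Rightarrow> int \<Rightarrow> 'q \<Rightarrow> 'q::complex_vector" and v :: "int \<Rightarrow> int \<Rightarrow> 'q"
  assumes k: "k \<notin> \<nat>"
    and Vk: "universal_affine_sl3 k Vk \<iota>"
    and Lk: "simple_graded_quotient Vk (affine_grading Vk \<iota>) Lk \<pi>\<^sub>L"
    and Wuniv: "bershadsky_polyakov k Wuniv J Gp Gm LBP"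
    and Wk: "simple_graded_quotient Wuniv (bp_grading Wuniv J Gp Gm LBP) Wk \<pi>\<^sub>W"
    and P: "Pi_0_squared P c d e"
    and \<phi>: "free_field_realization k Lk (\<pi>\<^sub>L \<circ> \<iota>) Wk (\<pi>\<^sub>W J) (\<pi>\<^sub>W Gp) (\<pi>\<^sub>W Gm) P c d e \<phi>"
    and R_graded: "graded_va_module Wk (\<lambda>n. \<pi>\<^sub>W ` bp_grading Wuniv J Gp Gm LBP n) act\<^sub>R R"
    and R_irreducible: "va_irreducible Wk act\<^sub>R"
    and Pi: "Pi_fock_module P c d e (-1) (-1) l\<^sub>1 l\<^sub>2 act\<^sub>P v"
    and top_irreducible: "sl3_irreducible (\<lambda>u. tensor_act act\<^sub>R act\<^sub>P (\<phi> (\<pi>\<^sub>L (\<iota> u))) 0)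
      (cvs.span {x \<otimes> y | x y. x \<in> R 0 \<and> y \<in> cvs.span (range (\<lambda>(n\<^sub>1, n\<^sub>2). v n\<^sub>1 n\<^sub>2))})"
  shows "va_irreducible Lk (\<lambda>a. tensor_act act\<^sub>R act\<^sub>P (\<phi> a))"
proof -
  interpret pi_zero P c d e
    by unfold_locales (rule P)
  \<comment> \<open>A zero tensor product would force the top component to be {0}, which its
    irreducibility excludes.\<close>
  have "\<exists>z :: ('r, 'q) tensor. z \<noteq> 0"
  proof (rule ccontr)
    let ?U = "cvs.span {x \<otimes> y | x y. x \<in> R 0 \<and> y \<in> cvs.span (range (\<lambda>(n\<^sub>1, n\<^sub>2). v n\<^sub>1 n\<^sub>2))}"
    assume "\<not> ?thesis"
    then have "?U = {0}" using cvs.span_zero[of "{x \<otimes> y | x y. x \<in> R 0 \<and> y \<in> cvs.span (range (\<lambda>(n\<^sub>1, n\<^sub>2). v n\<^sub>1 n\<^sub>2))}"] by blast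
    with top_irreducible show False by (simp add: sl3_irreducible_def)
  qed
  then interpret fock_tensor P c d e Wk act\<^sub>R act\<^sub>P v l\<^sub>1 l\<^sub>2
    using Wk R_irreducible Pi by unfold_locales (simp_all add: simple_graded_quotient_def)
  interpret realization P c d e Wk act\<^sub>R act\<^sub>P v l\<^sub>1 l\<^sub>2 k Lk "\<pi>\<^sub>L \<circ> \<iota>" \<phi> Wuniv J Gp Gm LBP \<pi>\<^sub>W
    using \<phi> Wuniv Wk by unfold_locales (simp_all add: simple_graded_quotient_def)
  show ?thesis
    using top_irreducible by (intro irreducible_if_top_irreducible[of "R 0"]) (simp add: comp_def)
qed

end
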